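(* Fix an integer $k\ge 2$. There is a constant $c_k>0$, depending only on $k$, such that for every $n\in\mathbb N=\{1,2,\dots\}$, $$\mathsf c_{L_1}\big(\mathsf{Wa}_1(\mathsf D_{k,k}^{\oslash n})\big)\ \ge\ c_k\sqrt{\log|\mathsf D_{k,k}^{\oslash n}|},$$ where $\mathsf D_{k,k}^{\oslash n}$ is the $n$-th $\oslash$-power of the generalized diamond graph $\mathsf D_{k,k}$ with its shortest path metric and $|\mathsf D_{k,k}^{\oslash n}|$ is its number of vertices.
   Context: **Graphs.** Graphs are finite, connected, directed, with at least one edge, without self-loops or multiple edges between the same pair of vertices. $V(G)$, $E(G)$ are the vertex and edge sets; for $e=(u,v)\in E(G)$, $e^-=u$ and $e^+=v$. The shortest path metric ignores orientations (paths may traverse edges in either direction, each edge having length 1). **$s$-$t$ graphs.** An $s$-$t$ graph is a graph $G$ with two distinct distinguished vertices $s(G)$ (source), $t(G)$ (sink) such that every vertex lies on a directed path from $s(G)$ to $t(G)$. **Diamond graphs.** For integers $k,m\ge2$, let $\mathsf P_k$ be the path with vertices $\{i/k:0\le i\le k\}$ and edges $(\frac{i-1}{k},\frac ik)$, $1\le i\le k$. $\mathsf D_{k,m}$ is the $s$-$t$ graph with vertex set $V(\mathsf P_k)\times\{1,\dots,m\}/\sim$, where all $(0,i)$ are identified to one point (the source) and all $(1,i)$ are identified to one point (the sink), and with edges $([(e^-,i)],[(e^+,i)])$, $e\in E(\mathsf P_k)$, $1\le i\le m$. **$\oslash$-products.** For a graph $H$ and an $s$-$t$ graph $G$, $H\oslash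 G$ is obtained by replacing each edge $e$ of $H$ by a copy of $G$, with $s(G)$ placed at $e^-$ and $t(G)$ at $e^+$. Precisely, $V(H\oslash G)=E(H)\times V(G)/\sim$, where $(e_1,u_1)\sim(e_2,u_2)$ iff they are equal, or $u_1,u_2\in\{s(G),t(G)\}$ and the corresponding endpoints in $H$ coincide ($(e,s(G))$ corresponds to $e^-$, $(e,t(G))$ to $e^+$). The class of $(e,u)$ is $e\oslash u$, and the edges are $e\oslash f:=(e\oslash f^-,e\oslash f^+)$, $e\in E(H)$, $f\in E(G)$. $V(H)$ is viewed as a subset of $V(H\oslash G)$. If $H$ is an $s$-$t$ graph, so is $H\oslash G$ with $s(H\oslash G)=s(H)$, $t(H\oslash G)=t(H)$. Powers: $G^{\oslash1}=G$, $G^{\oslash (n+1)}=G^{\oslash n}\oslash G$. **Wasserstein space.** For a finite metric space $(X,d)$, $\mathsf{Wa}_1(X)$ is the set of probability measures on $X$ with metric $d_{W_1}(\mu,\nu)=\inf_\gamma\int_{X\times X}d(x,y)\,d\gamma(x,y)$, the infimum over all probability measures $\gamma$ on $X\times X$ with marginals $\mu,\nu$. **Distortion.** For metric spaces $X,Y$, $\mathsf c_Y(X)=\inf_f\mathrm{Lip}(f)\,\mathrm{Lip}(f^{-1})$ over all injections $f:X\to Y$ (with $f^{-1}$ defined on $f(X)$). $L_1=L_1([0,1])$. *)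

theory Defs
  imports "HOL-Probability.Probability" "Graph_Theory.Graph_Theory"
begin

text \<open>Edges are pairs of vertices, so there are no multiple edges. The shortest path metric
  ignores orientations, hence the passage to the symmetrisation; all edges have length 1.\<close>

definition graph_dist :: "'a pair_pre_digraph \<Rightarrow> 'a \<Rightarrow> 'a \<Rightarrow> real" where
  "graph_dist G u v = real_of_ereal (wf_digraph.\<mu> (with_proj (mk_symmetric (with_proj G))) (\<lambda>_. 1) u v)"

record 'a st_graph =
  digraph_of :: "'a pair_pre_digraph"
  source :: 'a
  sink :: 'a

abbreviation vertices :: "'a st_graph \<Rightarrow> 'a set" where
  "vertices G \<equiv> pverts (digraph_of G)"

abbreviation edges :: "'a st_graph \<Rightarrow> ('a \<times> 'a) set" where
  "edges G \<equiv> parcs (digraph_of G)"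

definition path_graph :: "nat \<Rightarrow> real pair_pre_digraph" where
  "path_graph k = \<lparr> pverts = (\<lambda>i. real i / real k) ` {0..k},
                    parcs = (\<lambda>i. ((real i - 1) / real k, real i / real k)) ` {1..k} \<rparr>"

definition diamond_rel :: "nat \<Rightarrow> nat \<Rightarrow> (real \<times> nat) rel" where
  "diamond_rel k m = {(p, q). p \<in> pverts (path_graph k) \<times> {1..m} \<and>
      q \<in> pverts (path_graph k) \<times> {1..m} \<and>
      (p = q \<or> (fst p = 0 \<and> fst q = 0) \<or> (fst p = 1 \<and> fst q = 1))}"

definition diamond :: "nat \<Rightarrow> nat \<Rightarrow> (real \<times> nat) set st_graph" where
  "diamond k m =
    \<lparr> digraph_of =
        \<lparr> pverts = (pverts (path_graph k) \<times> {1..m}) // diamond_rel k m,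
          parcs = (\<lambda>(e, i). (diamond_rel k m `` {(fst e, i)}, diamond_rel k m `` {(snd e, i)}))
                    ` (parcs (path_graph k) \<times> {1..m}) \<rparr>,
      source = diamond_rel k m `` {(0, 1)},
      sink = diamond_rel k m `` {(1, 1)} \<rparr>"

lemma equiv_diamond_rel:
  "equiv (pverts (path_graph k) \<times> {1..m}) (diamond_rel k m)"
  by (rule equivI) (auto simp: diamond_rel_def refl_on_def sym_def trans_def)

text \<open>For \<open>u\<close> the source or sink of \<open>G\<close>, the vertex of \<open>H\<close> where the copy of \<open>u\<close> that belongs
  to the edge \<open>e\<close> of \<open>H\<close> is placed.\<close>

definition endpoint :: "'b st_graph \<Rightarrow> 'a \<times> 'a \<Rightarrow> 'b \<Rightarrow> 'a" where
  "endpoint G e u = (if u = source G then fst e else snd e)"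

definition oslash_rel :: "'a pair_pre_digraph \<Rightarrow> 'b st_graph \<Rightarrow> (('a \<times> 'a) \<times> 'b) rel" where
  "oslash_rel H G = {((e1, u1), (e2, u2)).
      (e1, u1) \<in> parcs H \<times> vertices G \<and> (e2, u2) \<in> parcs H \<times> vertices G \<and>
      ((e1, u1) = (e2, u2) \<or>
       u1 \<in> {source G, sink G} \<and> u2 \<in> {source G, sink G} \<and> endpoint G e1 u1 = endpoint G e2 u2)}"

definition oslash_vertex ::
  "'a pair_pre_digraph \<Rightarrow> 'b st_graph \<Rightarrow> 'a \<times> 'a \<Rightarrow> 'b \<Rightarrow> (('a \<times> 'a) \<times> 'b) set" where
  "oslash_vertex H G e u = oslash_rel H G `` {(e, u)}"

definition oslash ::
  "'a pair_pre_digraph \<Rightarrow> 'b st_graph \<Rightarrow> (('a \<times> 'a) \<times> 'b) set pair_pre_digraph" where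
  "oslash H G =
    \<lparr> pverts = (parcs H \<times> vertices G) // oslash_rel H G,
      parcs = (\<lambda>(e, f). (oslash_vertex H G e (fst f), oslash_vertex H G e (snd f)))
                ` (parcs H \<times> edges G) \<rparr>"

text \<open>The inclusion of the vertices of \<open>H\<close>: if \<open>v\<close> is an endpoint of some edge of \<open>H\<close>, this set
  is an equivalence class of \<open>oslash_rel H G\<close>.\<close>

definition oslash_incl ::
  "'a pair_pre_digraph \<Rightarrow> 'b st_graph \<Rightarrow> 'a \<Rightarrow> (('a \<times> 'a) \<times> 'b) set" where
  "oslash_incl H G v = {(e, u). e \<in> parcs H \<and> u \<in> {source G, sink G} \<and> endpoint G e u = v}"

definition st_oslash ::
  "'a st_graph \<Rightarrow> 'b st_graph \<Rightarrow> (('a \<times> 'a) \<times> 'b) set st_graph" where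
  "st_oslash H G =
    \<lparr> digraph_of = oslash (digraph_of H) G,
      source = oslash_incl (digraph_of H) G (source H),
      sink = oslash_incl (digraph_of H) G (sink H) \<rparr>"

lemma equiv_oslash_rel: "equiv (parcs H \<times> vertices G) (oslash_rel H G)"
proof (rule equivI)
  show "trans (oslash_rel H G)"
    unfolding trans_def oslash_rel_def by (clarify, simp, metis)
qed (auto simp: oslash_rel_def refl_on_def sym_def)

lemma oslash_vertex_source:
  assumes "e \<in> parcs H" "source G \<in> vertices G" "sink G \<in> vertices G"
  shows "oslash_vertex H G e (source G) = oslash_incl H G (fst e)"
  using assms by (auto simp: oslash_vertex_def oslash_incl_def oslash_rel_def endpoint_def)

lemma oslash_vertex_sink:
  assumes "e \<in> parcs H" "source G \<in> vertices G" "sink G \<in> vertices G" "source G \<noteq> sink G"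
  shows "oslash_vertex H G e (sink G) = oslash_incl H G (snd e)"
  using assms by (auto simp: oslash_vertex_def oslash_incl_def oslash_rel_def endpoint_def)

text \<open>The product changes the vertex type, so to iterate it the vertices of a finite graph are
  renumbered as \<open>0, 1, \<dots>\<close> after each step. This replaces a graph by an isomorphic copy, since
  \<open>to_nat_on A\<close> maps a finite set \<open>A\<close> bijectively onto \<open>{..<card A}\<close>.\<close>

definition nat_copy :: "'a st_graph \<Rightarrow> nat st_graph" where
  "nat_copy G = (let h = to_nat_on (vertices G) in
    \<lparr> digraph_of = \<lparr> pverts = h ` vertices G, parcs = map_prod h h ` edges G \<rparr>,
      source = h (source G), sink = h (sink G) \<rparr>)"

text \<open>Only exponents \<open>n \<ge> 1\<close> are meaningful.\<close>

definition oslash_power :: "'a st_graph \<Rightarrow> nat \<Rightarrow> nat st_graph" where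
  "oslash_power G n = ((\<lambda>H. nat_copy (st_oslash H G)) ^^ (n - 1)) (nat_copy G)"

lemma oslash_power_1: "oslash_power G 1 = nat_copy G"
  by (simp add: oslash_power_def)

lemma oslash_power_Suc:
  "n \<ge> 1 \<Longrightarrow> oslash_power G (Suc n) = nat_copy (st_oslash (oslash_power G n) G)"
  by (cases n) (simp_all add: oslash_power_def)

text \<open>From here on a metric space is given by its carrier and its distance
  function, as in \<^locale>\<open>Metric_space\<close>. Probability measures on a finite set are pmfs supported
  in it.\<close>

definition Wa1 :: "'a set \<Rightarrow> 'a pmf set" where
  "Wa1 X = {p. set_pmf p \<subseteq> X}"

definition couplings :: "'a pmf \<Rightarrow> 'a pmf \<Rightarrow> ('a \<times> 'a) pmf set" where
  "couplings p q = {r. map_pmf fst r = p \<and> map_pmf snd r = q}"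

definition W1_dist :: "('a \<Rightarrow> 'a \<Rightarrow> real) \<Rightarrow> 'a pmf \<Rightarrow> 'a pmf \<Rightarrow> real" where
  "W1_dist d p q = (INF r\<in>couplings p q. measure_pmf.expectation r (\<lambda>(x, y). d x y))"

definition L1_funs :: "(real \<Rightarrow> real) set" where
  "L1_funs = {f. integrable (lebesgue_on {0..1}) f}"

definition L1_rel :: "(real \<Rightarrow> real) rel" where
  "L1_rel = {(f, g). f \<in> L1_funs \<and> g \<in> L1_funs \<and> (AE x in lebesgue_on {0..1}. f x = g x)}"

definition L1 :: "(real \<Rightarrow> real) set set" where
  "L1 = L1_funs // L1_rel"

definition L1_dist :: "(real \<Rightarrow> real) set \<Rightarrow> (real \<Rightarrow> real) set \<Rightarrow> real" where
  "L1_dist A B = (\<integral>x. \<bar>(SOME f. f \<in> A) x - (SOME g. g \<in> B) x\<bar> \<partial>lebesgue_on {0..1})"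

lemma equiv_L1_rel: "equiv L1_funs L1_rel"
proof (rule equivI)
  show "trans L1_rel"
    unfolding trans_def L1_rel_def by auto
qed (auto simp: L1_rel_def refl_on_def sym_def eq_commute)

lemma L1_dist_class:
  assumes f: "f \<in> L1_funs" and g: "g \<in> L1_funs"
  shows "L1_dist (L1_rel `` {f}) (L1_rel `` {g}) = (\<integral>x. \<bar>f x - g x\<bar> \<partial>lebesgue_on {0..1})"
proof -
  define f' where "f' = (SOME u. u \<in> L1_rel `` {f})"
  define g' where "g' = (SOME u. u \<in> L1_rel `` {g})"
  have "f \<in> L1_rel `` {f}" "g \<in> L1_rel `` {g}"
    using f g by (auto simp: L1_rel_def)
  then have *: "(f, f') \<in> L1_rel" "(g, g') \<in> L1_rel"
    unfolding f'_def g'_def by (metis Image_singleton_iff someI)+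
  then have "AE x in lebesgue_on {0..1}. \<bar>f' x - g' x\<bar> = \<bar>f x - g x\<bar>"
    by (auto simp: L1_rel_def)
  moreover have "(\<lambda>x. \<bar>f' x - g' x\<bar>) \<in> borel_measurable (lebesgue_on {0..1})"
      "(\<lambda>x. \<bar>f x - g x\<bar>) \<in> borel_measurable (lebesgue_on {0..1})"
    using f g * unfolding L1_rel_def L1_funs_def
    by (auto intro!: borel_measurable_abs borel_measurable_diff)
  ultimately show ?thesis
    unfolding L1_dist_def f'_def[symmetric] g'_def[symmetric] by (intro integral_cong_AE) auto
qed

text \<open>The optimal Lipschitz constant, which is \<open>\<infinity>\<close> for maps that are not Lipschitz.\<close>

definition Lip :: "'a set \<Rightarrow> ('a \<Rightarrow> 'a \<Rightarrow> real) \<Rightarrow> ('b \<Rightarrow> 'b \<Rightarrow> real) \<Rightarrow> ('a \<Rightarrow> 'b) \<Rightarrow> ennreal" where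
  "Lip X dX dY f = (SUP (x, y)\<in>{(x, y). x \<in> X \<and> y \<in> X \<and> x \<noteq> y}. ennreal (dY (f x) (f y) / dX x y))"

definition distortion ::
  "'a set \<Rightarrow> ('a \<Rightarrow> 'a \<Rightarrow> real) \<Rightarrow> 'b set \<Rightarrow> ('b \<Rightarrow> 'b \<Rightarrow> real) \<Rightarrow> ennreal" where
  "distortion X dX Y dY =
    (INF f\<in>{f. f \<in> X \<rightarrow> Y \<and> inj_on f X}. Lip X dX dY f * Lip (f ` X) dY dX (inv_into X f))"

end

theory Submission
  imports Defs "HOL-Library.Function_Algebras"
begin

text \<open>Let \<open>\<phi>\<close> be a function on the vertices of the \<open>n\<close>-th power. By a Sobolev inequality of dimension
  two, the \<open>\<ell>\<^sub>2\<close> norm of \<open>\<phi>\<close> (normalised at the source) is at most \<open>k + 1\<close> times its total variation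
  over the edges. By orthogonality the \<open>\<ell>\<^sub>2\<close> norm controls, on all \<open>n\<close> levels of the construction
  at once, the differences of the sums of \<open>\<phi>\<close> over two parallel branches. Taking random
  signs over the copies of one level turns these differences into signed measures, which have large
  Wasserstein norm, witnessed by tent functions. All \<open>n\<close> levels contribute equally.

  A linear map \<open>\<mu> \<mapsto> (\<omega> \<mapsto> \<integral> \<phi>\<^sub>\<omega> d\<mu>)\<close> into \<open>L\<^sub>1\<close> is thus controlled by applying the inequality to every
  \<open>\<phi>\<^sub>\<omega>\<close> and integrating. A Lipschitz map is treated in the same way, after restriction to a fine
  lattice of measures around the uniform one, smoothing, and averaging over translations.\<close>

section \<open>Words and the Sobolev inequality\<close>

text \<open>The square root: for a single function the sign averages of the \<open>n\<close> levels,
  suitably normalised, have squares summing to at most a multiple of the squared variation, with no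
  dependence on \<open>n\<close>; Cauchy-Schwarz bounds their sum by \<open>sqrt n\<close> times the
  variation. A map with Lipschitz constant \<open>A\<close> has integrated variation at most
  \<open>A\<close> times the number of edges, whereas the normalised transport norms of each single
  level average to at least a fixed fraction of that number and so add up to order \<open>n\<close>
  times it. The quotient is \<open>sqrt n\<close>, and the logarithm of the number of vertices is of
  order \<open>n\<close>. The obstacle with Lipschitz maps is that \<open>L1\<close> lacks the
  Radon-Nikodym property, so they need not be differentiable anywhere. A competition of scales
  replaces the derivative: smoothing over boxes of side \<open>R\<close> leaves a bend of order
  \<open>1/R\<close> per step but displaces the map by order \<open>R\<close>, and comparing points
  \<open>R^2\<close> steps apart makes this displacement per step of order \<open>1/R\<close> too.
  The space is fixed while \<open>R\<close> grows, so error constants that depend on it disappear in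
  the limit.\<close>

text \<open>An edge of the \<open>n\<close>-th power is a word of \<open>n\<close> letters \<open>(i, b)\<close>, the \<open>i\<close>-th edge (from \<open>0\<close>) on
  branch \<open>b\<close>, with the finest level at the head. \<open>Mid w i b\<close> is the \<open>i\<close>-th interior vertex on branch
  \<open>b\<close> of the diamond that replaces the edge \<open>w\<close>.\<close>

datatype vert = Src | Snk | Mid "(nat \<times> nat) list" nat nat

locale diamond_words =
  fixes k :: nat
  assumes k2: "k \<ge> 2"
begin

primrec lo :: "(nat \<times> nat) list \<Rightarrow> vert" where
  "lo [] = Src"
| "lo (c # w) = (if fst c = 0 then lo w else Mid w (fst c) (snd c))"

primrec hi :: "(nat \<times> nat) list \<Rightarrow> vert" where
  "hi [] = Snk"
| "hi (c # w) = (if Suc (fst c) = k then hi w else Mid w (Suc (fst c)) (snd c))"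

definition pt :: "(nat \<times> nat) list \<Rightarrow> nat \<Rightarrow> nat \<Rightarrow> vert" where
  "pt w i b = (if i = 0 then lo w else if i = k then hi w else Mid w i b)"

definition sym :: "(nat \<times> nat) set" where
  "sym = {..<k} \<times> {1..k}"

definition words :: "nat \<Rightarrow> (nat \<times> nat) list set" where
  "words m = {w. set w \<subseteq> sym \<and> length w = m}"

lemma pt_0 [simp]: "pt w 0 b = lo w" and pt_k [simp]: "pt w k b = hi w"
  using k2 by (auto simp: pt_def)

text \<open>Once the ends of a child are consecutive points of a branch, sums along a branch
  telescope; the case distinctions of the defining equations are therefore kept out of the
  simplifier.\<close>

lemma lo_Cons: "i < k \<Longrightarrow> lo ((i, b) # w) = pt w i b"
  and hi_Cons: "i < k \<Longrightarrow> hi ((i, b) # w) = pt w (Suc i) b"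
  by (auto simp: pt_def)

declare lo.simps(2) [simp del] hi.simps(2) [simp del]

lemma finite_sym [simp]: "finite sym"
  by (simp add: sym_def)

lemma card_sym: "card sym = k ^ 2"
  by (simp add: sym_def power2_eq_square)

lemma sum_sym: "(\<Sum>c\<in>sym. f c) = (\<Sum>b=1..k. \<Sum>i<k. f (i, b))" for f :: "_ \<Rightarrow> 'a::comm_monoid_add"
  unfolding sym_def sum.cartesian_product' by (rule sum.swap)

lemma finite_words [simp]: "finite (words m)"
  using finite_lists_length_eq[OF finite_sym] by (simp add: words_def)

lemma card_words: "card (words m) = (k ^ m) ^ 2"
  using card_lists_length_eq[OF finite_sym, of m]
  by (simp add: words_def card_sym flip: power_mult) (simp add: mult.commute)

lemma words_0 [simp]: "words 0 = {[]}"
  by (auto simp: words_def)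

lemma words_Suc: "words (Suc m) = (\<lambda>(c, u). c # u) ` (sym \<times> words m)"
  by (force simp: words_def length_Suc_conv)

text \<open>The last letter of \<open>u\<close> is its coarsest, so \<open>(u @ [c]) @ w\<close>
  lies below the child \<open>c # w\<close>. All inductions over the levels use this
  splitting.\<close>

lemma words_Suc_snoc: "words (Suc m) = (\<lambda>(c, u). u @ [c]) ` (sym \<times> words m)"
proof -
  have "v \<in> (\<lambda>(c, u). u @ [c]) ` (sym \<times> words m)" if "v \<in> words (Suc m)" for v
  proof -
    have "v \<noteq> []"
      using that by (auto simp: words_def)
    then obtain u c where v: "v = u @ [c]"
      by (metis rev_exhaust)
    then show ?thesis
      using that by (auto simp: words_def intro!: image_eqI[of _ _ "(c, u)"])
  qed
  then show ?thesis by (auto simp: words_def)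
qed

lemma sum_words_Suc: "(\<Sum>u\<in>words (Suc m). f u) = (\<Sum>c\<in>sym. \<Sum>u\<in>words m. f (u @ [c]))"
  for f :: "_ \<Rightarrow> 'a::comm_monoid_add"
  unfolding words_Suc_snoc sum.cartesian_product
  by (subst sum.reindex) (auto simp: inj_on_def case_prod_unfold)

section \<open>Sums over the edges of the copy that replaces an edge\<close>

definition esum :: "((nat \<times> nat) list \<Rightarrow> real) \<Rightarrow> nat \<Rightarrow> (nat \<times> nat) list \<Rightarrow> real" where
  "esum F m w = (\<Sum>u\<in>words m. F (u @ w))"

lemma esum_0 [simp]: "esum F 0 w = F w"
  by (simp add: esum_def)

lemma esum_Suc: "esum F (Suc m) w = (\<Sum>c\<in>sym. esum F m (c # w))"
  by (simp add: esum_def sum_words_Suc)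

lemma esum_nonneg: "(\<And>v. F v \<ge> 0) \<Longrightarrow> esum F m w \<ge> 0"
  by (simp add: esum_def sum_nonneg)

definition variation :: "(vert \<Rightarrow> real) \<Rightarrow> nat \<Rightarrow> (nat \<times> nat) list \<Rightarrow> real" where
  "variation \<phi> = esum (\<lambda>v. \<bar>\<phi> (hi v) - \<phi> (lo v)\<bar>)"

definition total :: "(vert \<Rightarrow> real) \<Rightarrow> nat \<Rightarrow> (nat \<times> nat) list \<Rightarrow> real" where
  "total \<phi> = esum (\<lambda>v. \<phi> (hi v))"

text \<open>Indexing by edges weights each vertex by the number of edges of the copy that end in it.
  The norms over the children of \<open>w\<close> then combine exactly, without corrections at
  shared vertices.\<close>

definition l2 :: "(vert \<Rightarrow> real) \<Rightarrow> nat \<Rightarrow> (nat \<times> nat) list \<Rightarrow> real" where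
  "l2 \<phi> m w = L2_set (\<lambda>u. \<phi> (hi (u @ w))) (words m)"

lemma l2_sq: "(l2 \<phi> m w)\<^sup>2 = esum (\<lambda>v. (\<phi> (hi v))\<^sup>2) m w"
  by (simp add: l2_def L2_set_def esum_def sum_nonneg)

lemma l2_Suc: "l2 \<phi> (Suc m) w = L2_set (\<lambda>c. l2 \<phi> m (c # w)) sym"
  unfolding L2_set_def l2_sq esum_Suc[symmetric]
  by (simp add: l2_def L2_set_def esum_def)

text \<open>The copy contains \<open>k^m\<close> edge-disjoint paths from \<open>lo w\<close> to
  \<open>hi w\<close>. Each level of the induction contributes one factor \<open>k\<close>, its
  number of branches.\<close>

lemma variation_ge: "real k ^ m * \<bar>\<phi> (hi w) - \<phi> (lo w)\<bar> \<le> variation \<phi> m w"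
proof (induction m arbitrary: w)
  case 0
  then show ?case by (simp add: variation_def)
next
  case (Suc m)
  have tele: "\<bar>\<phi> (hi w) - \<phi> (lo w)\<bar> \<le> (\<Sum>i<k. \<bar>\<phi> (hi ((i, b) # w)) - \<phi> (lo ((i, b) # w))\<bar>)" for b
  proof -
    have "\<phi> (hi w) - \<phi> (lo w) = (\<Sum>i<k. \<phi> (pt w (Suc i) b) - \<phi> (pt w i b))"
      by (subst sum_lessThan_telescope) simp
    also have "\<dots> = (\<Sum>i<k. \<phi> (hi ((i, b) # w)) - \<phi> (lo ((i, b) # w)))"
      by (simp add: lo_Cons hi_Cons)
    finally show ?thesis by (simp add: sum_abs)
  qed
  have "real k ^ Suc m * \<bar>\<phi> (hi w) - \<phi> (lo w)\<bar>
      = (\<Sum>b=1..k. real k ^ m * \<bar>\<phi> (hi w) - \<phi> (lo w)\<bar>)"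
    by simp
  also have "\<dots> \<le> (\<Sum>b=1..k. \<Sum>i<k. real k ^ m * \<bar>\<phi> (hi ((i, b) # w)) - \<phi> (lo ((i, b) # w))\<bar>)"
    unfolding sum_distrib_left[symmetric] by (intro sum_mono mult_left_mono tele) auto
  also have "\<dots> \<le> (\<Sum>b=1..k. \<Sum>i<k. variation \<phi> m ((i, b) # w))"
    by (intro sum_mono Suc.IH)
  also have "\<dots> = variation \<phi> (Suc m) w"
    by (simp add: variation_def esum_Suc sum_sym)
  finally show ?case .
qed

section \<open>Clipping and the Sobolev inequality\<close>

definition clip :: "real \<Rightarrow> real \<Rightarrow> real \<Rightarrow> real" where
  "clip a b x = max (min a b) (min (max a b) x)"

lemma clip_ends [simp]: "clip a b a = a" "clip a b b = b"
  by (auto simp: clip_def)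

lemma abs_clip_le: "\<bar>a\<bar> \<le> q \<Longrightarrow> \<bar>b\<bar> \<le> q \<Longrightarrow> \<bar>clip a b x\<bar> \<le> q"
  by (auto simp: clip_def)

text \<open>Both \<open>clip a b\<close> and \<open>x - clip a b x\<close> are monotone, so variation splits exactly.\<close>

lemma abs_diff_clip:
  "\<bar>x - y\<bar> = \<bar>clip a b x - clip a b y\<bar> + \<bar>(x - clip a b x) - (y - clip a b y)\<bar>"
proof -
  have mono: "clip a b x \<le> clip a b y \<and> clip a b y - clip a b x \<le> y - x" if "x \<le> y" for x y
    using that by (auto simp: clip_def min_def max_def)
  show ?thesis
    using mono[of x y] mono[of y x] by (cases "x \<le> y") auto
qed

lemma variation_clip:
  "variation \<phi> m w = variation (\<lambda>x. clip a b (\<phi> x)) m w + variation (\<lambda>x. \<phi> x - clip a b (\<phi> x)) m w"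
  unfolding variation_def esum_def sum.distrib[symmetric] by (rule sum.cong[OF refl], rule abs_diff_clip)

text \<open>On each child \<open>c # w\<close>, clip \<phi> between its two end values. The clipped
  part is bounded by \<open>q\<close> and has variation at least \<open>real k ^ m * d c\<close>;
  the rest vanishes at both ends, so induction applies to it with the remaining variation. The
  \<open>k^2\<close> bounds \<open>q * k^m\<close> combine in l2 to \<open>k * q * k^m\<close>, and
  the savings \<open>k * k^m * d c\<close> add up to the same amount. The constant \<open>k\<close>,
  the square root of the number of children, makes the two cancel, so nothing is lost from level to
  level.\<close>

lemma sobolev:
  assumes "\<phi> (lo w) = 0" "\<phi> (hi w) = 0"
  shows "l2 \<phi> m w \<le> real k * variation \<phi> m w"
  using assms
proof (induction m arbitrary: \<phi> w)
  case 0
  then show ?case by (simp add: l2_def variation_def)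
next
  case (Suc m)
  define d where "d c = \<bar>\<phi> (hi (c # w)) - \<phi> (lo (c # w))\<bar>" for c
  \<comment> \<open>The sum runs over all children and not over one branch: this is exactly the
    amount that the savings give back at the end.\<close>
  define q where "q = (\<Sum>c\<in>sym. d c)"
  have q: "\<bar>\<phi> (pt w i b)\<bar> \<le> q" if "i \<le> k" "b \<in> {1..k}" for i b
  proof -
    have "\<phi> (pt w i b) = (\<Sum>j<i. \<phi> (pt w (Suc j) b) - \<phi> (pt w j b))"
      using Suc.prems by (subst sum_lessThan_telescope) simp
    also have "\<bar>\<dots>\<bar> \<le> (\<Sum>j<i. \<bar>\<phi> (pt w (Suc j) b) - \<phi> (pt w j b)\<bar>)"
      by (rule sum_abs)
    also have "\<dots> \<le> (\<Sum>j<k. \<bar>\<phi> (pt w (Suc j) b) - \<phi> (pt w j b)\<bar>)"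
      using that by (intro sum_mono2) auto
    also have "\<dots> = (\<Sum>j<k. d (j, b))"
      by (simp add: d_def lo_Cons hi_Cons)
    also have "\<dots> \<le> (\<Sum>b=1..k. \<Sum>j<k. d (j, b))"
      using that by (intro member_le_sum[of b _ "\<lambda>b. \<Sum>j<k. d (j, b)"]) (auto simp: d_def intro: sum_nonneg)
    finally show ?thesis by (simp add: q_def sum_sym)
  qed
  have step: "l2 \<phi> m (c # w) \<le> q * real k ^ m + real k * (variation \<phi> m (c # w) - real k ^ m * d c)"
    if "c \<in> sym" for c
  proof -
    define cl where "cl = clip (\<phi> (lo (c # w))) (\<phi> (hi (c # w)))"
    have "l2 \<phi> m (c # w) = l2 (\<lambda>x. cl (\<phi> x) + (\<phi> x - cl (\<phi> x))) m (c # w)"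
      by simp
    also have "\<dots> \<le> l2 (\<lambda>x. cl (\<phi> x)) m (c # w) + l2 (\<lambda>x. \<phi> x - cl (\<phi> x)) m (c # w)"
      unfolding l2_def by (rule L2_set_triangle_ineq)
    also have "l2 (\<lambda>x. cl (\<phi> x)) m (c # w) \<le> q * real k ^ m"
    proof -
      have c: "fst c < k" "snd c \<in> {1..k}"
        using that by (auto simp: sym_def)
      have "\<bar>\<phi> (lo (c # w))\<bar> \<le> q" "\<bar>\<phi> (hi (c # w))\<bar> \<le> q"
        using q[of "fst c" "snd c"] q[of "Suc (fst c)" "snd c"] c
          lo_Cons[of "fst c" "snd c" w] hi_Cons[of "fst c" "snd c" w] by auto
      then have le: "\<bar>cl x\<bar> \<le> q" for x
        unfolding cl_def by (rule abs_clip_le)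
      then have "0 \<le> q" by (meson abs_ge_zero order_trans)
      have "l2 (\<lambda>x. cl (\<phi> x)) m (c # w) \<le> L2_set (\<lambda>u. q) (words m)"
        unfolding l2_def L2_set_def using le \<open>0 \<le> q\<close>
        by (intro real_sqrt_le_mono sum_mono) (simp add: abs_le_square_iff[symmetric])
      also have "\<dots> = q * real k ^ m"
        using \<open>0 \<le> q\<close> by (simp add: L2_set_constant card_words real_sqrt_mult)
      finally show ?thesis .
    qed
    also have "l2 (\<lambda>x. \<phi> x - cl (\<phi> x)) m (c # w) \<le> real k * variation (\<lambda>x. \<phi> x - cl (\<phi> x)) m (c # w)"
      by (rule Suc.IH) (auto simp: cl_def)
    also have "variation (\<lambda>x. \<phi> x - cl (\<phi> x)) m (c # w) \<le> variation \<phi> m (c # w) - real k ^ m * d c"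
      using variation_ge[of m "\<lambda>x. cl (\<phi> x)" "c # w"] variation_clip[of \<phi> m "c # w" "\<phi> (lo (c # w))" "\<phi> (hi (c # w))"]
      by (simp add: d_def cl_def)
    finally show ?thesis by (simp add: mult_left_mono)
  qed
  have "l2 \<phi> (Suc m) w = L2_set (\<lambda>c. l2 \<phi> m (c # w)) sym"
    by (rule l2_Suc)
  also have "\<dots> \<le> L2_set (\<lambda>c. q * real k ^ m + real k * (variation \<phi> m (c # w) - real k ^ m * d c)) sym"
    using step by (intro L2_set_mono) (auto simp: l2_def)
  also have "\<dots> \<le> L2_set (\<lambda>c. q * real k ^ m) sym
      + L2_set (\<lambda>c. real k * (variation \<phi> m (c # w) - real k ^ m * d c)) sym"
    by (rule L2_set_triangle_ineq)
  also have "L2_set (\<lambda>c. q * real k ^ m) sym = real k * (q * real k ^ m)"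
    by (simp add: L2_set_constant card_sym q_def d_def sum_nonneg)
  also have "L2_set (\<lambda>c. real k * (variation \<phi> m (c # w) - real k ^ m * d c)) sym
      \<le> (\<Sum>c\<in>sym. real k * (variation \<phi> m (c # w) - real k ^ m * d c))"
    using variation_ge by (intro L2_set_le_sum) (simp add: d_def)
  also have "\<dots> = real k * variation \<phi> (Suc m) w - real k * (q * real k ^ m)"
    by (simp add: variation_def esum_Suc q_def sum_distrib_left sum_distrib_right sum_subtractf
        algebra_simps)
  finally show ?case by simp
qed

definition gap :: "(vert \<Rightarrow> real) \<Rightarrow> nat \<Rightarrow> (nat \<times> nat) list \<Rightarrow> real" where
  "gap \<phi> m w = total \<phi> m ((0, 1) # w) - total \<phi> m ((0, 2) # w)"

text \<open>\<open>gap\<close> compares only the copies on the first edges of branches 1 and 2.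
  Below the \<open>j\<close> letters of \<open>u\<close> and the letter of that edge,
  \<open>m - 1 - j\<close> levels remain, hence \<open>(k^(m-1-j))^2\<close> edges; dividing by this
  number turns the square of a total into the squared l2 norm of the constant function with the same
  total.\<close>

definition gaps :: "(vert \<Rightarrow> real) \<Rightarrow> nat \<Rightarrow> (nat \<times> nat) list \<Rightarrow> real" where
  "gaps \<phi> m w = (\<Sum>j<m. (\<Sum>u\<in>words j. (gap \<phi> (m - 1 - j) (u @ w))\<^sup>2) / (real k ^ (m - 1 - j)) ^ 2)"

lemma gaps_Suc: "gaps \<phi> (Suc m) w = (gap \<phi> m w)\<^sup>2 / (real k ^ m) ^ 2 + (\<Sum>c\<in>sym. gaps \<phi> m (c # w))"
proof -
  have "gaps \<phi> (Suc m) w = (gap \<phi> m w)\<^sup>2 / (real k ^ m) ^ 2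
     + (\<Sum>j<m. (\<Sum>u\<in>words (Suc j). (gap \<phi> (m - Suc j) (u @ w))\<^sup>2) / (real k ^ (m - Suc j)) ^ 2)"
    unfolding gaps_def by (subst sum.lessThan_Suc_shift) simp
  also have "(\<Sum>j<m. (\<Sum>u\<in>words (Suc j). (gap \<phi> (m - Suc j) (u @ w))\<^sup>2) / (real k ^ (m - Suc j)) ^ 2)
      = (\<Sum>c\<in>sym. gaps \<phi> m (c # w))"
    unfolding gaps_def sum_words_Suc sum_divide_distrib by (subst sum.swap) simp
  finally show ?thesis .
qed

text \<open>The variance over a copy is the sum of the variances over its \<open>k\<^sup>2\<close> subcopies plus the
  variance of their means, and the latter sees the gap.\<close>

lemma gaps_le_variance:
  "gaps \<phi> m w \<le> 2 * ((l2 \<phi> m w)\<^sup>2 - (total \<phi> m w)\<^sup>2 / (real k ^ m) ^ 2)"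
proof (induction m arbitrary: w)
  case 0
  then show ?case by (simp add: gaps_def l2_def total_def)
next
  case (Suc m)
  define T where "T c = total \<phi> m (c # w)" for c
  define \<mu> where "\<mu> = (\<Sum>c\<in>sym. T c) / real k ^ 2"
  have kpos: "real k > 0" using k2 by simp
  have in_sym: "(0, 1) \<in> sym" "(0, 2) \<in> sym"
    using k2 by (auto simp: sym_def)
  have "(T (0, 1) - \<mu>)\<^sup>2 + (T (0, 2) - \<mu>)\<^sup>2 = (\<Sum>c\<in>{(0, 1), (0, 2)}. (T c - \<mu>)\<^sup>2)"
    by simp
  also have "\<dots> \<le> (\<Sum>c\<in>sym. (T c - \<mu>)\<^sup>2)"
    using in_sym by (intro sum_mono2) auto
  also have "\<dots> = (\<Sum>c\<in>sym. (T c)\<^sup>2) - 2 * \<mu> * (\<Sum>c\<in>sym. T c) + real k ^ 2 * \<mu>\<^sup>2"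
    by (simp add: power2_diff sum.distrib sum_subtractf sum_distrib_left card_sym algebra_simps)
  also have "\<dots> = (\<Sum>c\<in>sym. (T c)\<^sup>2) - (\<Sum>c\<in>sym. T c)\<^sup>2 / real k ^ 2"
    using kpos by (simp add: \<mu>_def field_simps power2_eq_square)
  \<comment> \<open>Parallelogram identity for the deviations from the mean: (x - y)^2 + (x + y)^2 =
    2 x^2 + 2 y^2. This is the source of the factor 2.\<close>
  finally have "(T (0, 1) - T (0, 2))\<^sup>2 \<le> 2 * ((\<Sum>c\<in>sym. (T c)\<^sup>2) - (\<Sum>c\<in>sym. T c)\<^sup>2 / real k ^ 2)"
    using zero_le_power2[of "(T (0, 1) - \<mu>) + (T (0, 2) - \<mu>)"]
    by (simp add: power2_eq_square algebra_simps)
  then have *: "(gap \<phi> m w)\<^sup>2 \<le> 2 * ((\<Sum>c\<in>sym. (T c)\<^sup>2) - (total \<phi> (Suc m) w)\<^sup>2 / real k ^ 2)"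
    by (simp add: T_def gap_def total_def esum_Suc)
  have "gaps \<phi> (Suc m) w \<le> (gap \<phi> m w)\<^sup>2 / (real k ^ m) ^ 2
      + (\<Sum>c\<in>sym. 2 * ((l2 \<phi> m (c # w))\<^sup>2 - (T c)\<^sup>2 / (real k ^ m) ^ 2))"
    unfolding gaps_Suc T_def by (intro add_left_mono sum_mono Suc.IH)
  also have "\<dots> = (gap \<phi> m w)\<^sup>2 / (real k ^ m) ^ 2 + 2 * (l2 \<phi> (Suc m) w)\<^sup>2
      - 2 * (\<Sum>c\<in>sym. (T c)\<^sup>2) / (real k ^ m) ^ 2"
    unfolding l2_sq esum_Suc
    by (simp add: sum_subtractf sum_distrib_left[symmetric] sum_divide_distrib[symmetric])
  also have "(gap \<phi> m w)\<^sup>2 / (real k ^ m) ^ 2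
      \<le> 2 * ((\<Sum>c\<in>sym. (T c)\<^sup>2) - (total \<phi> (Suc m) w)\<^sup>2 / real k ^ 2) / (real k ^ m) ^ 2"
    using * by (rule divide_right_mono) simp
  finally show ?case
    by (simp add: diff_divide_distrib right_diff_distrib power_mult_distrib mult.commute)
qed

text \<open>Shifting \<phi> to vanish at \<open>lo w\<close> changes no gap, since equally many
  edges are compared. The value at \<open>hi w\<close> may remain nonzero: the part clipped between
  0 and \<open>b - a\<close> has l2 norm at most \<open>k^n\<close> times the modulus of
  \<open>b - a\<close>, which \<open>variation_ge\<close> absorbs, and \<open>sobolev\<close>
  applies to the rest. This is the origin of \<open>1 + k\<close>.\<close>

lemma gaps_le_variation: "gaps \<phi> n w \<le> 2 * ((1 + real k) * variation \<phi> n w)\<^sup>2"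
proof -
  define a b where "a = \<phi> (lo w)" and "b = \<phi> (hi w)"
  define \<psi> where "\<psi> x = \<phi> x - a" for x
  define cl where "cl = clip 0 (b - a)"
  have V: "variation \<psi> n w = variation \<phi> n w"
    by (simp add: variation_def \<psi>_def)
  have gap: "gap \<psi> m v = gap \<phi> m v" for m v
    by (simp add: gap_def total_def esum_def \<psi>_def sum_subtractf)
  then have "gaps \<phi> n w = gaps \<psi> n w"
    by (simp add: gaps_def)
  also have "\<dots> \<le> 2 * (l2 \<psi> n w)\<^sup>2"
    using gaps_le_variance[of \<psi> n w] zero_le_divide_iff[of "(total \<psi> n w)\<^sup>2" "(real k ^ n)\<^sup>2"]
    by (smt (verit) zero_le_power2)
  also have "(l2 \<psi> n w)\<^sup>2 \<le> ((1 + real k) * variation \<phi> n w)\<^sup>2"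
  proof (rule power_mono)
    have "l2 \<psi> n w = l2 (\<lambda>x. cl (\<psi> x) + (\<psi> x - cl (\<psi> x))) n w"
      by simp
    also have "\<dots> \<le> l2 (\<lambda>x. cl (\<psi> x)) n w + l2 (\<lambda>x. \<psi> x - cl (\<psi> x)) n w"
      unfolding l2_def by (rule L2_set_triangle_ineq)
    also have "l2 (\<lambda>x. cl (\<psi> x)) n w \<le> L2_set (\<lambda>u. \<bar>b - a\<bar>) (words n)"
      unfolding l2_def L2_set_def
    proof (intro real_sqrt_le_mono sum_mono)
      fix u
      have "\<bar>cl (\<psi> (hi (u @ w)))\<bar> \<le> \<bar>b - a\<bar>"
        unfolding cl_def by (rule abs_clip_le) auto
      then show "(cl (\<psi> (hi (u @ w))))\<^sup>2 \<le> \<bar>b - a\<bar>\<^sup>2"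
        by (simp add: abs_le_square_iff)
    qed
    also have "\<dots> = real k ^ n * \<bar>b - a\<bar>"
      by (simp add: L2_set_constant card_words)
    also have "\<dots> \<le> variation \<phi> n w"
      unfolding a_def b_def by (rule variation_ge)
    also have "l2 (\<lambda>x. \<psi> x - cl (\<psi> x)) n w \<le> real k * variation (\<lambda>x. \<psi> x - cl (\<psi> x)) n w"
      by (rule sobolev) (auto simp: \<psi>_def a_def b_def cl_def)
    also have "variation (\<lambda>x. \<psi> x - cl (\<psi> x)) n w \<le> variation \<psi> n w"
      using variation_clip[of \<psi> n w 0 "b - a"] esum_nonneg[of "\<lambda>v. \<bar>cl (\<psi> (hi v)) - cl (\<psi> (lo v))\<bar>" n w]
      by (simp add: cl_def variation_def)
    finally show "l2 \<psi> n w \<le> (1 + real k) * variation \<phi> n w"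
      by (simp add: V mult_left_mono distrib_right)
  qed (simp add: l2_def)
  finally show ?thesis by simp
qed

end

section \<open>Random signs and tent functions\<close>

text \<open>A choice of signs is encoded by the set where it is positive, so that averages over
  signs are finite sums over a power set.\<close>

definition sgn_of :: "'a set \<Rightarrow> 'a \<Rightarrow> real" where
  "sgn_of Z x = (if x \<in> Z then 1 else - 1)"

text \<open>The offset \<open>c\<close> carries the induction: splitting on the sign of a new point
  replaces \<open>c\<close> by \<open>c - y x\<close> and \<open>c + y x\<close>, and the cross
  terms cancel.\<close>

lemma sum_signs_sq:
  assumes "finite X"
  shows "(\<Sum>Z\<in>Pow X. (c + (\<Sum>x\<in>X. sgn_of Z x * y x))\<^sup>2) = 2 ^ card X * (c\<^sup>2 + (\<Sum>x\<in>X. (y x)\<^sup>2))"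
  using assms
proof (induction X arbitrary: c rule: finite_induct)
  case empty
  then show ?case by simp
next
  case (insert x X)
  have inj: "inj_on (insert x) (Pow X)"
    using insert.hyps by (auto simp: inj_on_def)
  have disj: "Pow X \<inter> insert x ` Pow X = {}"
    using insert.hyps by auto
  have A: "(c + (\<Sum>u\<in>insert x X. sgn_of Z u * y u)) = (c - y x) + (\<Sum>u\<in>X. sgn_of Z u * y u)"
    if "Z \<in> Pow X" for Z
    using insert.hyps that by (auto simp: sgn_of_def)
  have B: "(c + (\<Sum>u\<in>insert x X. sgn_of (insert x Z) u * y u)) = (c + y x) + (\<Sum>u\<in>X. sgn_of Z u * y u)"
    for Z
  proof -
    have "(\<Sum>u\<in>X. sgn_of (insert x Z) u * y u) = (\<Sum>u\<in>X. sgn_of Z u * y u)"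
      using insert.hyps by (intro sum.cong) (auto simp: sgn_of_def)
    then show ?thesis
      using insert.hyps by (simp add: sgn_of_def)
  qed
  have "(\<Sum>Z\<in>Pow (insert x X). (c + (\<Sum>u\<in>insert x X. sgn_of Z u * y u))\<^sup>2)
      = (\<Sum>Z\<in>Pow X. ((c - y x) + (\<Sum>u\<in>X. sgn_of Z u * y u))\<^sup>2)
      + (\<Sum>Z\<in>Pow X. ((c + y x) + (\<Sum>u\<in>X. sgn_of Z u * y u))\<^sup>2)"
    unfolding Pow_insert using insert.hyps disj
    by (subst sum.union_disjoint) (simp_all add: sum.reindex[OF inj] A B del: sum.insert)
  also have "\<dots> = 2 ^ card X * ((c - y x)\<^sup>2 + (\<Sum>x\<in>X. (y x)\<^sup>2) + ((c + y x)\<^sup>2 + (\<Sum>x\<in>X. (y x)\<^sup>2)))"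
    unfolding insert.IH by (simp add: distrib_left)
  also have "\<dots> = 2 ^ card (insert x X) * (c\<^sup>2 + (\<Sum>x\<in>insert x X. (y x)\<^sup>2))"
    using insert.hyps by (simp add: power2_eq_square algebra_simps)
  finally show ?case .
qed

text \<open>The easy upper half of Khintchine's inequality: Cauchy-Schwarz compares the first moment
  with the second.\<close>

lemma sum_signs_abs:
  assumes "finite X"
  shows "(\<Sum>Z\<in>Pow X. \<bar>\<Sum>x\<in>X. sgn_of Z x * y x\<bar>) \<le> 2 ^ card X * sqrt (\<Sum>x\<in>X. (y x)\<^sup>2)"
proof -
  have "(\<Sum>Z\<in>Pow X. \<bar>\<Sum>x\<in>X. sgn_of Z x * y x\<bar>)
      = (\<Sum>Z\<in>Pow X. \<bar>1 :: real\<bar> * \<bar>\<Sum>x\<in>X. sgn_of Z x * y x\<bar>)"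
    by simp
  also have "\<dots> \<le> L2_set (\<lambda>_. 1) (Pow X) * L2_set (\<lambda>Z. \<Sum>x\<in>X. sgn_of Z x * y x) (Pow X)"
    by (rule L2_set_mult_ineq)
  also have "L2_set (\<lambda>Z. \<Sum>x\<in>X. sgn_of Z x * y x) (Pow X) = sqrt (2 ^ card X * (\<Sum>x\<in>X. (y x)\<^sup>2))"
    using sum_signs_sq[OF assms, of 0 y] by (simp add: L2_set_def)
  also have "L2_set (\<lambda>_. 1) (Pow X) = sqrt (2 ^ card X)"
    using assms by (simp add: L2_set_constant card_Pow)
  finally show ?thesis
    by (simp add: real_sqrt_mult mult.assoc[symmetric])
qed

context diamond_words
begin

definition pairing :: "(vert \<Rightarrow> real) \<Rightarrow> nat \<Rightarrow> nat \<Rightarrow> (nat \<times> nat) list set \<Rightarrow> real" where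
  "pairing \<phi> n j Z = (\<Sum>w\<in>words j. sgn_of Z w * gap \<phi> (n - 1 - j) w)"

text \<open>The scalar inequality behind the theorem. At each level the sign average is at most the
  l2 norm of the gaps. The normalised squares of these norms sum over all levels to
  \<open>gaps\<close>, whose bound is independent of \<open>n\<close>, so Cauchy-Schwarz over the
  levels costs \<open>sqrt n\<close> where a level-by-level estimate would cost
  \<open>n\<close>.\<close>

lemma sum_pairing_le:
  "(\<Sum>j<n. \<Sum>Z\<in>Pow (words j). \<bar>pairing \<phi> n j Z\<bar> / (real k ^ (n - 1 - j) * 2 ^ card (words j)))
     \<le> sqrt (real n) * (sqrt 2 * (1 + real k)) * variation \<phi> n []"
proof -
  have kpos: "real k > 0" using k2 by simp
  define Y where "Y j = (\<Sum>w\<in>words j. (gap \<phi> (n - 1 - j) w)\<^sup>2)" for j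
  have "(\<Sum>j<n. \<Sum>Z\<in>Pow (words j). \<bar>pairing \<phi> n j Z\<bar> / (real k ^ (n - 1 - j) * 2 ^ card (words j)))
      \<le> (\<Sum>j<n. sqrt (Y j) / real k ^ (n - 1 - j))"
  proof (rule sum_mono)
    fix j
    have "(\<Sum>Z\<in>Pow (words j). \<bar>pairing \<phi> n j Z\<bar> / (real k ^ (n - 1 - j) * 2 ^ card (words j)))
        = (\<Sum>Z\<in>Pow (words j). \<bar>pairing \<phi> n j Z\<bar>) / (real k ^ (n - 1 - j) * 2 ^ card (words j))"
      by (simp add: sum_divide_distrib)
    also have "\<dots> \<le> 2 ^ card (words j) * sqrt (Y j) / (real k ^ (n - 1 - j) * 2 ^ card (words j))"
      unfolding pairing_def Y_def using kpos by (intro divide_right_mono sum_signs_abs) auto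
    finally show "(\<Sum>Z\<in>Pow (words j). \<bar>pairing \<phi> n j Z\<bar> / (real k ^ (n - 1 - j) * 2 ^ card (words j)))
        \<le> sqrt (Y j) / real k ^ (n - 1 - j)"
      by simp
  qed
  also have "\<dots> = (\<Sum>j<n. \<bar>1 :: real\<bar> * \<bar>sqrt (Y j) / real k ^ (n - 1 - j)\<bar>)"
    by (simp add: Y_def sum_nonneg)
  also have "\<dots> \<le> L2_set (\<lambda>_. 1) {..<n} * L2_set (\<lambda>j. sqrt (Y j) / real k ^ (n - 1 - j)) {..<n}"
    by (rule L2_set_mult_ineq)
  also have "L2_set (\<lambda>j. sqrt (Y j) / real k ^ (n - 1 - j)) {..<n} = sqrt (gaps \<phi> n [])"
    by (simp add: L2_set_def gaps_def Y_def power_divide sum_nonneg)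
  also have "sqrt (gaps \<phi> n []) \<le> sqrt (2 * ((1 + real k) * variation \<phi> n [])\<^sup>2)"
    by (intro real_sqrt_le_mono gaps_le_variation)
  also have "\<dots> = sqrt 2 * (1 + real k) * variation \<phi> n []"
    by (simp add: real_sqrt_mult variation_def esum_nonneg)
  finally show ?thesis
    by (simp add: L2_set_constant mult.assoc mult_left_mono)
qed

text \<open>The witness for level \<open>j\<close> and signs \<open>s\<close>: zero outside the copies of level \<open>j\<close>, a tent of
  slope \<open>\<plusminus>1\<close> on the first two branches of each such copy, and interpolated linearly further down.
  The formula also covers the end points \<open>i = 0\<close> and \<open>i = k\<close>.\<close>

definition interp ::
  "nat \<Rightarrow> nat \<Rightarrow> ((nat \<times> nat) list \<Rightarrow> real) \<Rightarrow> (nat \<times> nat) list \<Rightarrow> real \<times> real \<Rightarrow> nat \<Rightarrow> nat \<Rightarrow> real" where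
  "interp m j s w xy i b =
    (if length w < j then 0
     else if length w = j then s w * (if b = 1 then 1 else if b = 2 then - 1 else 0) * real (min i (k - i)) * real k ^ m
     else fst xy + real i * (snd xy - fst xy) / real k)"

text \<open>Holds the values of the witness at the two ends of an edge (see
  \<open>witness_ends\<close>); recursion along the word provides them before the witness itself is
  defined on vertices.\<close>

primrec ev :: "nat \<Rightarrow> nat \<Rightarrow> ((nat \<times> nat) list \<Rightarrow> real) \<Rightarrow> (nat \<times> nat) list \<Rightarrow> real \<times> real" where
  "ev m j s [] = (0, 0)"
| "ev m j s (c # w) = (interp m j s w (ev m j s w) (fst c) (snd c), interp m j s w (ev m j s w) (Suc (fst c)) (snd c))"

definition witness :: "nat \<Rightarrow> nat \<Rightarrow> ((nat \<times> nat) list \<Rightarrow> real) \<Rightarrow> vert \<Rightarrow> real" where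
  "witness m j s v = (case v of Mid w i b \<Rightarrow> interp m j s w (ev m j s w) i b | _ \<Rightarrow> 0)"

lemma ev_short: "length w \<le> j \<Longrightarrow> ev m j s w = (0, 0)"
  by (cases w) (auto simp: interp_def)

lemma interp_ends:
  "interp m j s w (ev m j s w) 0 b = fst (ev m j s w)"
  "interp m j s w (ev m j s w) k b = snd (ev m j s w)"
  using k2 by (auto simp: interp_def ev_short)

lemma witness_ends: "witness m j s (lo w) = fst (ev m j s w)" "witness m j s (hi w) = snd (ev m j s w)"
proof (induction w)
  case Nil
  { case 1 show ?case by (simp add: witness_def) }
  { case 2 show ?case by (simp add: witness_def) }
next
  case (Cons c w)
  { case 1 show ?case
      using Cons.IH interp_ends by (auto simp: lo.simps witness_def) }
  { case 2 show ?case
      using Cons.IH interp_ends(2)[of m j s w] by (auto simp: hi.simps witness_def) }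
qed

text \<open>Across an edge of the tent level the witness changes by at most \<open>k^m\<close>,
  since the tent is 1-Lipschitz in the index before scaling. Each further level of interpolation
  divides the change by \<open>k\<close>; choosing \<open>m = l\<close> yields slope at most 1 on
  the finest edges.\<close>

lemma witness_slope:
  assumes "\<And>w. \<bar>s w\<bar> = 1" "length w = Suc (j + l)" "set w \<subseteq> sym"
  shows "\<bar>witness m j s (hi w) - witness m j s (lo w)\<bar> \<le> real k ^ m / real k ^ l"
  using assms(2,3)
proof (induction l arbitrary: w)
  case 0
  then obtain c v where w: "w = c # v" "length v = j" "fst c < k"
    by (cases w) (auto simp: sym_def)
  have "\<bar>real (min (Suc (fst c)) (k - Suc (fst c))) - real (min (fst c) (k - fst c))\<bar> \<le> 1"
    using w by auto
  then have "\<bar>real (min (Suc (fst c)) (k - Suc (fst c))) - real (min (fst c) (k - fst c))\<bar> * real k ^ m \<le> 1 * real k ^ m"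
    by (rule mult_right_mono) simp
  moreover have "\<bar>s v * t * x * K - s v * t * y * K\<bar> = \<bar>t\<bar> * (\<bar>x - y\<bar> * \<bar>K\<bar>)" for t x y K
  proof -
    have "s v * t * x * K - s v * t * y * K = s v * (t * ((x - y) * K))"
      by (simp add: algebra_simps)
    then show ?thesis by (simp add: abs_mult assms(1))
  qed
  ultimately show ?case
    using w unfolding witness_ends by (simp add: interp_def)
next
  case (Suc l)
  then obtain c v where w: "w = c # v" "length v = Suc (j + l)" "set v \<subseteq> sym"
    by (cases w) auto
  have "snd (ev m j s w) - fst (ev m j s w) = (snd (ev m j s v) - fst (ev m j s v)) / real k"
    using w by (simp add: interp_def add_divide_distrib distrib_right)
  then have "\<bar>witness m j s (hi w) - witness m j s (lo w)\<bar>
      = \<bar>witness m j s (hi v) - witness m j s (lo v)\<bar> / real k"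
    by (simp add: witness_ends)
  also have "\<dots> \<le> (real k ^ m / real k ^ l) / real k"
    by (intro divide_right_mono Suc.IH w) simp
  finally show ?case by (simp add: mult.commute)
qed

lemma witness_lipschitz:
  assumes "\<And>w. \<bar>s w\<bar> = 1" "j < n" "w \<in> words n"
  shows "\<bar>witness (n - 1 - j) j s (hi w) - witness (n - 1 - j) j s (lo w)\<bar> \<le> 1"
  using witness_slope[OF assms(1), where l = "n - 1 - j" and m = "n - 1 - j" and w = w and j = j] assms(2,3) k2
  by (simp add: words_def)

lemma witness_child:
  assumes "length w > j" "c \<in> sym"
  shows "witness m j s (lo (c # w)) = fst (ev m j s w) + real (fst c) * (snd (ev m j s w) - fst (ev m j s w)) / real k"
    "witness m j s (hi (c # w)) = fst (ev m j s w) + real (Suc (fst c)) * (snd (ev m j s w) - fst (ev m j s w)) / real k"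
  using assms unfolding witness_ends by (auto simp: interp_def)

text \<open>Write the value at \<open>hi\<close> as half of (lo + hi) + (hi - lo). Interpolation
  preserves the mean of the first sum, which so grows by the number \<open>k^2\<close> of children
  per level; it divides increments by \<open>k\<close>, so the second sum grows only by
  \<open>k\<close>. The second term appears because edges are weighted by their \<open>hi\<close>
  end.\<close>

lemma total_witness:
  assumes "length w > j"
  shows "total (witness m j s) l w =
    ((real k ^ l) ^ 2 * (fst (ev m j s w) + snd (ev m j s w)) + real k ^ l * (snd (ev m j s w) - fst (ev m j s w))) / 2"
proof -
  define g where "g = witness m j s"
  have kpos: "real k > 0" using k2 by simp
  \<comment> \<open>Along a branch the sums of the two end values form an arithmetic
    progression.\<close>
  have gauss: "(\<Sum>i<K. 2 * x + (2 * real i + 1) * r) = real K * (2 * x) + real K * real K * r" for K x r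
    by (induction K) (auto simp: algebra_simps)
  have 1: "esum (\<lambda>v. g (lo v) + g (hi v)) l w = (real k ^ l) ^ 2 * (fst (ev m j s w) + snd (ev m j s w))"
    using assms
  proof (induction l arbitrary: w)
    case 0
    then show ?case by (simp add: g_def witness_ends)
  next
    case (Suc l)
    define x y where "x = fst (ev m j s w)" and "y = snd (ev m j s w)"
    have "esum (\<lambda>v. g (lo v) + g (hi v)) (Suc l) w = (\<Sum>c\<in>sym. (real k ^ l) ^ 2 * (g (lo (c # w)) + g (hi (c # w))))"
      unfolding esum_Suc using Suc by (intro sum.cong) (auto simp: g_def witness_ends)
    also have "\<dots> = (\<Sum>c\<in>sym. (real k ^ l) ^ 2 * (2 * x + (2 * real (fst c) + 1) * ((y - x) / real k)))"
    proof (intro sum.cong refl arg_cong[where f = "(*) ((real k ^ l)\<^sup>2)"])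
      fix c assume "c \<in> sym"
      then show "g (lo (c # w)) + g (hi (c # w)) = 2 * x + (2 * real (fst c) + 1) * ((y - x) / real k)"
        unfolding g_def witness_child[OF Suc.prems \<open>c \<in> sym\<close>] x_def[symmetric] y_def[symmetric]
          times_divide_eq_right[symmetric] by (simp add: distrib_right del: times_divide_eq_right)
    qed
    also have "\<dots> = real k * (real k ^ l) ^ 2 * (\<Sum>i<k. 2 * x + (2 * real i + 1) * ((y - x) / real k))"
      by (simp add: sum_sym sum_distrib_left[symmetric])
    also have "(\<Sum>i<k. 2 * x + (2 * real i + 1) * ((y - x) / real k)) = real k * (2 * x) + real k * real k * ((y - x) / real k)"
      by (rule gauss)
    also have "\<dots> = real k * (x + y)"
      using kpos by (simp add: field_simps)
    finally show ?case
      by (simp add: x_def y_def power2_eq_square mult_ac)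
  qed
  have 2: "esum (\<lambda>v. g (hi v) - g (lo v)) l w = real k ^ l * (snd (ev m j s w) - fst (ev m j s w))"
    using assms
  proof (induction l arbitrary: w)
    case 0
    then show ?case by (simp add: g_def witness_ends)
  next
    case (Suc l)
    have "esum (\<lambda>v. g (hi v) - g (lo v)) (Suc l) w = (\<Sum>c\<in>sym. real k ^ l * (g (hi (c # w)) - g (lo (c # w))))"
      unfolding esum_Suc using Suc by (intro sum.cong) (auto simp: g_def witness_ends)
    also have "\<dots> = (\<Sum>c\<in>sym. real k ^ l * ((snd (ev m j s w) - fst (ev m j s w)) / real k))"
    proof (intro sum.cong refl arg_cong[where f = "(*) (real k ^ l)"])
      fix c assume "c \<in> sym"
      then show "g (hi (c # w)) - g (lo (c # w)) = (snd (ev m j s w) - fst (ev m j s w)) / real k"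
        using witness_child[OF Suc.prems, of c m s]
        by (simp add: g_def diff_divide_distrib add_divide_distrib algebra_simps)
    qed
    finally show ?case
      using kpos by (simp add: card_sym power2_eq_square)
  qed
  have "esum (\<lambda>v. g (lo v) + g (hi v)) l w + esum (\<lambda>v. g (hi v) - g (lo v)) l w = 2 * total g l w"
    unfolding total_def esum_def sum.distrib[symmetric] sum_distrib_left by (intro sum.cong) auto
  then show ?thesis
    unfolding 1 2 by (simp add: g_def)
qed

text \<open>The witness carries the same signs as the measure, so all \<open>k^(2j)\<close> copies
  contribute positively. On the two compared edges it has opposite slopes, and the leading term per
  copy, after normalisation, is \<open>k^(2m)\<close> with \<open>m = n - 1 - j\<close>. The product
  is independent of \<open>j\<close>, so every level counts equally.\<close>

lemma pairing_witness:
  assumes "j < n"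
  shows "pairing (witness (n - 1 - j) j (sgn_of Z)) n j Z / real k ^ (n - 1 - j) \<ge> (real k ^ (n - 1)) ^ 2"
proof -
  define m where "m = n - 1 - j"
  define g where "g = witness m j (sgn_of Z)"
  have gap: "gap g m w = sgn_of Z w * ((real k ^ m) ^ 2 * real k ^ m + real k ^ m * real k ^ m)"
    if "length w = j" for w
    using that k2 unfolding gap_def g_def
    by (simp add: total_witness interp_def ev_short field_simps)
  have "pairing g n j Z = (\<Sum>w\<in>words j. (real k ^ m) ^ 2 * real k ^ m + real k ^ m * real k ^ m)"
    unfolding pairing_def m_def[symmetric]
    by (intro sum.cong refl, subst gap) (auto simp: words_def sgn_of_def)
  also have "\<dots> = (real k ^ j)^2 * ((real k ^ m) ^ 2 * real k ^ m + real k ^ m * real k ^ m)"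
    by (simp add: card_words)
  also have "\<dots> \<ge> (real k ^ j)^2 * ((real k ^ m) ^ 2 * real k ^ m)"
    by (intro mult_left_mono) auto
  also have "(real k ^ j)^2 * ((real k ^ m) ^ 2 * real k ^ m) = (real k ^ (n - 1)) ^ 2 * real k ^ m"
  proof -
    have "n - 1 = j + m" using assms by (simp add: m_def)
    then show ?thesis by (simp add: power_add power_mult_distrib)
  qed
  finally show ?thesis
    using k2 by (simp add: g_def m_def pos_le_divide_eq)
qed

end

section \<open>Almost affine approximation of Lipschitz maps from a lattice to \<open>L\<^sub>1\<close>\<close>

definition unit_vec :: "'v \<Rightarrow> 'v \<Rightarrow> int" where
  "unit_vec v = (\<lambda>u. if u = v then 1 else 0)"

definition mul :: "nat \<Rightarrow> ('v \<Rightarrow> int) \<Rightarrow> 'v \<Rightarrow> int" where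
  "mul s a = (\<lambda>v. int s * a v)"

lemma mul_0 [simp]: "mul 0 a = 0"
  by (auto simp: mul_def)

lemma mul_Suc: "mul (Suc s) a = a + mul s a"
  by (auto simp: mul_def algebra_simps)

definition bnd :: "nat \<Rightarrow> ('v \<Rightarrow> int) \<Rightarrow> bool" where
  "bnd l x \<longleftrightarrow> (\<forall>v. \<bar>x v\<bar> \<le> int l)"

lemma bnd_add: "bnd l x \<Longrightarrow> bnd l' y \<Longrightarrow> bnd (l + l') (x + y)"
  unfolding bnd_def
proof
  fix v assume "\<forall>v. \<bar>x v\<bar> \<le> int l" "\<forall>v. \<bar>y v\<bar> \<le> int l'"
  then have "\<bar>x v\<bar> \<le> int l" "\<bar>y v\<bar> \<le> int l'" by auto
  then show "\<bar>(x + y) v\<bar> \<le> int (l + l')" by simp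
qed

lemma bnd_mono: "bnd l x \<Longrightarrow> l \<le> l' \<Longrightarrow> bnd l' x"
  unfolding bnd_def by (auto intro: order_trans[where y = "int l"])

lemma bnd_mul: "bnd C a \<Longrightarrow> s \<le> M \<Longrightarrow> bnd (M * C) (mul s a)"
  unfolding bnd_def mul_def abs_mult of_nat_mult by (intro allI mult_mono) auto

lemma bnd_0 [simp]: "bnd l 0"
  by (simp add: bnd_def)

section \<open>Averages along lattice directions\<close>

definition avg :: "nat \<Rightarrow> ('v \<Rightarrow> int) \<Rightarrow> (('v \<Rightarrow> int) \<Rightarrow> real) \<Rightarrow> ('v \<Rightarrow> int) \<Rightarrow> real" where
  "avg R a \<Psi> x = (\<Sum>s<R. \<Psi> (x + mul s a)) / real R"

definition avgs :: "nat \<Rightarrow> ('v \<Rightarrow> int) list \<Rightarrow> (('v \<Rightarrow> int) \<Rightarrow> real) \<Rightarrow> ('v \<Rightarrow> int) \<Rightarrow> real" where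
  "avgs R as = foldr (avg R) as"

lemma avgs_Nil [simp]: "avgs R [] \<Psi> = \<Psi>"
  and avgs_Cons [simp]: "avgs R (a # as) \<Psi> = avg R a (avgs R as \<Psi>)"
  by (simp_all add: avgs_def)

lemma avg_commute: "avg R a (avg R b \<Psi>) = avg R b (avg R a \<Psi>)"
proof
  fix x
  have "(\<Sum>s<R. \<Sum>t<R. \<Psi> (x + mul s a + mul t b)) = (\<Sum>t<R. \<Sum>s<R. \<Psi> (x + mul t b + mul s a))"
    by (subst sum.swap) (simp add: add.assoc add.commute[of "mul _ a"])
  then show "avg R a (avg R b \<Psi>) x = avg R b (avg R a \<Psi>) x"
    by (simp add: avg_def sum_divide_distrib[symmetric])
qed

lemma avgs_avg: "avgs R as (avg R a \<Psi>) = avg R a (avgs R as \<Psi>)"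
  by (induction as) (simp_all add: avg_commute)

text \<open>Averages along different directions commute, so any direction of the list can be brought
  to the front, where \<open>avg_telescope\<close> applies.\<close>

lemma avgs_remove1: "a \<in> set as \<Longrightarrow> avgs R as \<Psi> = avg R a (avgs R (remove1 a as) \<Psi>)"
  by (induction as) (auto simp: avg_commute)

lemma avgs_shift: "avgs R as (\<lambda>y. \<Psi> (y + b)) x = avgs R as \<Psi> (x + b)"
  by (induction as arbitrary: x) (simp_all add: avg_def add_ac)

lemma avgs_diff: "avgs R as (\<lambda>y. \<Psi> y - \<Phi> y) x = avgs R as \<Psi> x - avgs R as \<Phi> x"
  by (induction as arbitrary: x) (simp_all add: avg_def sum_subtractf diff_divide_distrib)

lemma avgs_sum:
  "avgs R as (\<lambda>y. \<Sum>i\<in>I. c i * \<Psi> i y) x = (\<Sum>i\<in>I. c i * avgs R as (\<Psi> i) x)"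
proof (induction as arbitrary: x)
  case (Cons a as)
  have "(\<Sum>s<R. \<Sum>i\<in>I. c i * avgs R as (\<Psi> i) (x + mul s a))
      = (\<Sum>i\<in>I. c i * (\<Sum>s<R. avgs R as (\<Psi> i) (x + mul s a)))"
    by (subst sum.swap) (simp add: sum_distrib_left)
  then show ?case
    unfolding avgs_Cons avg_def Cons.IH times_divide_eq_right sum_divide_distrib[symmetric] by simp
qed simp

lemma avgs_const: "R > 0 \<Longrightarrow> avgs R as (\<lambda>_. c) x = c"
  by (induction as arbitrary: x) (simp_all add: avg_def)

text \<open>The average at \<open>x\<close> only samples points within
  \<open>length as * (R * C)\<close> of it, so a comparison on a bounded box suffices.\<close>

lemma avgs_mono:
  assumes "bnd l x" "\<And>a. a \<in> set as \<Longrightarrow> bnd C a"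
    and "\<And>y. bnd (l + length as * (R * C)) y \<Longrightarrow> \<Psi> y \<le> \<Phi> y"
  shows "avgs R as \<Psi> x \<le> avgs R as \<Phi> x"
  using assms
proof (induction as arbitrary: l x)
  case (Cons a as)
  have "avgs R as \<Psi> (x + mul s a) \<le> avgs R as \<Phi> (x + mul s a)" if "s < R" for s
  proof (rule Cons.IH)
    show "bnd (l + R * C) (x + mul s a)"
      using Cons.prems that by (intro bnd_add bnd_mul) auto
  qed (use Cons.prems in \<open>auto simp: add.assoc\<close>)
  then show ?case
    by (auto simp: avg_def intro!: divide_right_mono sum_mono)
qed simp

lemma avgs_mono_all: "(\<And>y. \<Psi> y \<le> \<Phi> y) \<Longrightarrow> avgs R as \<Psi> x \<le> avgs R as \<Phi> x"
  by (induction as arbitrary: x) (auto simp: avg_def intro!: divide_right_mono sum_mono)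

text \<open>The source of every gain \<open>1/R\<close>: differencing an average along its own
  direction leaves only the two extreme terms.\<close>

lemma avg_telescope: "avg R a \<Psi> (x + a) - avg R a \<Psi> x = (\<Psi> (x + mul R a) - \<Psi> x) / real R"
proof -
  have "(\<Sum>s<R. \<Psi> (x + mul (Suc s) a) - \<Psi> (x + mul s a)) = \<Psi> (x + mul R a) - \<Psi> (x + mul 0 a)"
    by (rule sum_lessThan_telescope)
  then show ?thesis
    by (simp add: avg_def diff_divide_distrib[symmetric] sum_subtractf mul_Suc add.assoc)
qed

text \<open>The integral of a non-integrable function is 0 by convention; for this reason the
  triangle inequalities below carry integrability hypotheses.\<close>

definition l1 :: "'w measure \<Rightarrow> ('w \<Rightarrow> real) \<Rightarrow> real" where
  "l1 M f = (\<integral>\<omega>. \<bar>f \<omega>\<bar> \<partial>M)"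

lemma l1_nonneg [simp]: "l1 M f \<ge> 0"
  by (simp add: l1_def)

lemma l1_add: "integrable M f \<Longrightarrow> integrable M g \<Longrightarrow> l1 M (\<lambda>\<omega>. f \<omega> + g \<omega>) \<le> l1 M f + l1 M g"
  unfolding l1_def
  by (subst Bochner_Integration.integral_add[symmetric]) (auto simp del: Bochner_Integration.integral_add intro!: integral_mono)

lemma l1_diff: "integrable M f \<Longrightarrow> integrable M g \<Longrightarrow> l1 M (\<lambda>\<omega>. f \<omega> - g \<omega>) \<le> l1 M f + l1 M g"
  unfolding l1_def
  by (subst Bochner_Integration.integral_add[symmetric]) (auto simp del: Bochner_Integration.integral_add intro!: integral_mono)

lemma l1_triangle:
  "integrable M f \<Longrightarrow> integrable M g \<Longrightarrow> integrable M h \<Longrightarrow>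
    l1 M (\<lambda>\<omega>. f \<omega> - h \<omega>) \<le> l1 M (\<lambda>\<omega>. f \<omega> - g \<omega>) + l1 M (\<lambda>\<omega>. g \<omega> - h \<omega>)"
  using l1_add[of M "\<lambda>\<omega>. f \<omega> - g \<omega>" "\<lambda>\<omega>. g \<omega> - h \<omega>"] by simp

lemma l1_minus_commute: "l1 M (\<lambda>\<omega>. f \<omega> - g \<omega>) = l1 M (\<lambda>\<omega>. g \<omega> - f \<omega>)"
  by (simp add: l1_def abs_minus_commute)

lemma l1_sum: "(\<And>i. i \<in> I \<Longrightarrow> integrable M (f i)) \<Longrightarrow> l1 M (\<lambda>\<omega>. \<Sum>i\<in>I. f i \<omega>) \<le> (\<Sum>i\<in>I. l1 M (f i))"
  unfolding l1_def
  by (subst Bochner_Integration.integral_sum[symmetric])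
    (auto simp del: Bochner_Integration.integral_sum Bochner_Integration.integral_sum' intro!: integral_mono sum_abs)

lemma l1_divide: "l1 M (\<lambda>\<omega>. f \<omega> / c) = l1 M f / \<bar>c\<bar>"
  by (simp add: l1_def)

lemma integrable_avgs:
  assumes "\<And>y. integrable M (D y)"
  shows "integrable M (\<lambda>\<omega>. avgs R as (\<lambda>y. D y \<omega>) x)"
  using assms by (induction as arbitrary: x) (auto simp: avg_def)

lemma l1_avgs:
  assumes "\<And>y. integrable M (D y)"
  shows "l1 M (\<lambda>\<omega>. avgs R as (\<lambda>y. D y \<omega>) x) \<le> avgs R as (\<lambda>y. l1 M (D y)) x"
proof (induction as arbitrary: x)
  case (Cons a as)
  have "l1 M (\<lambda>\<omega>. avgs R (a # as) (\<lambda>y. D y \<omega>) x)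
      = l1 M (\<lambda>\<omega>. \<Sum>s<R. avgs R as (\<lambda>y. D y \<omega>) (x + mul s a)) / real R"
    by (simp add: avg_def l1_divide)
  also have "\<dots> \<le> (\<Sum>s<R. l1 M (\<lambda>\<omega>. avgs R as (\<lambda>y. D y \<omega>) (x + mul s a))) / real R"
    using assms by (intro divide_right_mono l1_sum integrable_avgs) auto
  also have "\<dots> \<le> (\<Sum>s<R. avgs R as (\<lambda>y. l1 M (D y)) (x + mul s a)) / real R"
    by (intro divide_right_mono sum_mono Cons.IH) auto
  finally show ?case by (simp add: avg_def)
qed simp

definition nrm :: "'v set \<Rightarrow> ('v \<Rightarrow> int) \<Rightarrow> nat" where
  "nrm V b = (\<Sum>v\<in>V. nat \<bar>b v\<bar>)"

lemma nrm_add_unit: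
  assumes "finite V" "v \<in> V" "b v < 0"
  shows "nrm V b = Suc (nrm V (b + unit_vec v))"
proof -
  have "nrm V b = nat \<bar>b v\<bar> + (\<Sum>u\<in>V-{v}. nat \<bar>b u\<bar>)"
    unfolding nrm_def using assms by (simp add: sum.remove)
  moreover have "nrm V (b + unit_vec v) = nat \<bar>b v + 1\<bar> + (\<Sum>u\<in>V-{v}. nat \<bar>b u\<bar>)"
    unfolding nrm_def using assms by (simp add: sum.remove unit_vec_def)
  ultimately show ?thesis using assms by simp
qed

lemma nrm_diff_unit:
  assumes "finite V" "v \<in> V" "b v > 0"
  shows "nrm V b = Suc (nrm V (b - unit_vec v))"
proof -
  have "nrm V b = nat \<bar>b v\<bar> + (\<Sum>u\<in>V-{v}. nat \<bar>b u\<bar>)"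
    unfolding nrm_def using assms by (simp add: sum.remove)
  moreover have "nrm V (b - unit_vec v) = nat \<bar>b v - 1\<bar> + (\<Sum>u\<in>V-{v}. nat \<bar>b u\<bar>)"
    unfolding nrm_def using assms by (simp add: sum.remove unit_vec_def)
  ultimately show ?thesis using assms by simp
qed

text \<open>Walk from \<open>x\<close> to \<open>x + b\<close> in \<open>nrm V b\<close> unit steps.
  The intermediate offsets have norm at most that of \<open>b\<close>, so the step bound is required
  only within radius \<open>s\<close>; \<open>linearize\<close> depends on this restriction.\<close>

lemma lattice_lipschitz:
  assumes "finite V" and int: "\<And>y. integrable M (\<Phi> y)"
    and step: "\<And>b u. (\<forall>v. v \<notin> V \<longrightarrow> b v = 0) \<Longrightarrow> nrm V b \<le> s \<Longrightarrow> u \<in> V \<Longrightarrow>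
      l1 M (\<lambda>\<omega>. \<Phi> (x + b + unit_vec u) \<omega> - \<Phi> (x + b) \<omega>) \<le> c"
    and "\<forall>v. v \<notin> V \<longrightarrow> b v = 0" "nrm V b \<le> s"
  shows "l1 M (\<lambda>\<omega>. \<Phi> (x + b) \<omega> - \<Phi> x \<omega>) \<le> c * real (nrm V b)"
  using assms(4,5)
proof (induction "nrm V b" arbitrary: b)
  case 0
  then have "b v = 0" for v
    using \<open>finite V\<close> by (cases "v \<in> V") (auto simp: nrm_def)
  then have "b = 0" by auto
  then show ?case by (simp add: l1_def nrm_def)
next
  case (Suc m)
  have "\<exists>v\<in>V. b v \<noteq> 0"
  proof (rule ccontr)
    assume "\<not> ?thesis"
    then have "nrm V b = 0" by (simp add: nrm_def)
    with Suc show False by simp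
  qed
  then obtain v where v: "v \<in> V" "b v \<noteq> 0" by auto
  show ?case
  proof (cases "b v > 0")
    case True
    define b' where "b' = b - unit_vec v"
    have b: "x + b = x + b' + unit_vec v" by (simp add: b'_def)
    have n: "nrm V b = Suc (nrm V b')"
      unfolding b'_def using \<open>finite V\<close> v True by (intro nrm_diff_unit)
    have s: "\<forall>v. v \<notin> V \<longrightarrow> b' v = 0"
      using Suc.prems(1) v by (auto simp: b'_def unit_vec_def)
    have "l1 M (\<lambda>\<omega>. \<Phi> (x + b) \<omega> - \<Phi> x \<omega>)
        \<le> l1 M (\<lambda>\<omega>. \<Phi> (x + b) \<omega> - \<Phi> (x + b') \<omega>) + l1 M (\<lambda>\<omega>. \<Phi> (x + b') \<omega> - \<Phi> x \<omega>)"
      by (intro l1_triangle int)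
    also have "\<dots> \<le> c + c * real (nrm V b')"
      unfolding b using Suc n s v by (intro add_mono step Suc.hyps) auto
    finally show ?thesis by (simp add: n algebra_simps)
  next
    case False
    define b' where "b' = b + unit_vec v"
    have b: "x + b' = x + b + unit_vec v" by (simp add: b'_def add.assoc)
    have n: "nrm V b = Suc (nrm V b')"
      unfolding b'_def using \<open>finite V\<close> v False by (intro nrm_add_unit) auto
    have s: "\<forall>v. v \<notin> V \<longrightarrow> b' v = 0"
      using Suc.prems(1) v by (auto simp: b'_def unit_vec_def)
    have "l1 M (\<lambda>\<omega>. \<Phi> (x + b) \<omega> - \<Phi> (x + b') \<omega>) = l1 M (\<lambda>\<omega>. \<Phi> (x + b') \<omega> - \<Phi> (x + b) \<omega>)"
      by (rule l1_minus_commute)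
    also have "\<dots> \<le> c"
      unfolding b using Suc.prems v(1) by (rule step)
    finally have le1: "l1 M (\<lambda>\<omega>. \<Phi> (x + b) \<omega> - \<Phi> (x + b') \<omega>) \<le> c" .
    have le2: "l1 M (\<lambda>\<omega>. \<Phi> (x + b') \<omega> - \<Phi> x \<omega>) \<le> c * real (nrm V b')"
    proof (rule Suc.hyps(1))
      show "m = nrm V b'" "nrm V b' \<le> s"
        using Suc.hyps(2) Suc.prems(2) n by linarith+
    qed (rule s)
    have "l1 M (\<lambda>\<omega>. \<Phi> (x + b) \<omega> - \<Phi> x \<omega>)
        \<le> l1 M (\<lambda>\<omega>. \<Phi> (x + b) \<omega> - \<Phi> (x + b') \<omega>) + l1 M (\<lambda>\<omega>. \<Phi> (x + b') \<omega> - \<Phi> x \<omega>)"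
      by (intro l1_triangle int)
    with le1 le2 have "l1 M (\<lambda>\<omega>. \<Phi> (x + b) \<omega> - \<Phi> x \<omega>) \<le> c + c * real (nrm V b')"
      by linarith
    then show ?thesis
      unfolding n of_nat_Suc distrib_left by linarith
  qed
qed

section \<open>Smoothing and linearising a Lipschitz family\<close>

locale lattice_L1 =
  fixes M :: "'w measure" and V :: "'v set" and H :: "('v \<Rightarrow> int) \<Rightarrow> 'w \<Rightarrow> real" and K :: real
  assumes fin: "finite V"
    and int: "\<And>x. integrable M (H x)"
    and lip: "\<And>x u. u \<in> V \<Longrightarrow> l1 M (\<lambda>\<omega>. H (x + unit_vec u) \<omega> - H x \<omega>) \<le> K"
begin

text \<open>Averaging over a box of side \<open>R\<close> makes second differences \<open>O(1/R)\<close>, so that on bounded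
  scales the smoothed map is almost affine. This replaces differentiation, which is not available
  for Lipschitz maps into \<open>L\<^sub>1\<close>.\<close>

definition smooth :: "nat \<Rightarrow> 'v list \<Rightarrow> ('v \<Rightarrow> int) \<Rightarrow> 'w \<Rightarrow> real" where
  "smooth R vs x \<omega> = avgs R (map unit_vec vs) (\<lambda>y. H y \<omega>) x"

lemma integrable_smooth: "integrable M (smooth R vs x)"
  unfolding smooth_def by (intro integrable_avgs int)

lemma smooth_diff:
  "smooth R vs (x + a) \<omega> - smooth R vs (x + b) \<omega> = avgs R (map unit_vec vs) (\<lambda>y. H (y + a) \<omega> - H (y + b) \<omega>) x"
  unfolding smooth_def avgs_diff
  using avgs_shift[of R "map unit_vec vs" "\<lambda>y. H y \<omega>"] by simp

lemma bnd_unit_vec: "bnd (Suc 0) (unit_vec v)"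
  by (simp add: bnd_def unit_vec_def)

lemma l1_smooth_diff:
  assumes "R > 0" "bnd l x"
    and "\<And>y. bnd (l + length vs * R) y \<Longrightarrow> l1 M (\<lambda>\<omega>. H (y + a) \<omega> - H (y + b) \<omega>) \<le> c"
  shows "l1 M (\<lambda>\<omega>. smooth R vs (x + a) \<omega> - smooth R vs (x + b) \<omega>) \<le> c"
proof -
  have "l1 M (\<lambda>\<omega>. smooth R vs (x + a) \<omega> - smooth R vs (x + b) \<omega>)
      \<le> avgs R (map unit_vec vs) (\<lambda>y. l1 M (\<lambda>\<omega>. H (y + a) \<omega> - H (y + b) \<omega>)) x"
    unfolding smooth_diff by (intro l1_avgs Bochner_Integration.integrable_diff int)
  also have "\<dots> \<le> avgs R (map unit_vec vs) (\<lambda>_. c) x"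
    using assms by (intro avgs_mono[where C = "Suc 0" and l = l]) (auto intro: bnd_unit_vec)
  finally show ?thesis
    using assms by (simp add: avgs_const)
qed

text \<open>The average along \<open>v\<close> is pulled to the front and telescopes to a difference
  of two first differences, each of norm at most \<open>K\<close> because the other averages
  preserve that bound.\<close>

lemma l1_second_diff:
  assumes "R > 0" "u \<in> V" "v \<in> set vs"
  shows "l1 M (\<lambda>\<omega>. (smooth R vs (x + unit_vec v + unit_vec u) \<omega> - smooth R vs (x + unit_vec v) \<omega>)
      - (smooth R vs (x + unit_vec u) \<omega> - smooth R vs x \<omega>)) \<le> 2 * K / real R"
proof -
  define D where "D y \<omega> = H (y + unit_vec u) \<omega> - H y \<omega>" for y \<omega>
  define as where "as = remove1 (unit_vec v) (map unit_vec vs)"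
  have intD: "integrable M (D y)" for y
    unfolding D_def by (intro Bochner_Integration.integrable_diff int)
  have D: "smooth R vs (y + unit_vec u) \<omega> - smooth R vs y \<omega>
      = avg R (unit_vec v) (avgs R as (\<lambda>y. D y \<omega>)) y" for y \<omega>
    using smooth_diff[of R vs y "unit_vec u" \<omega> 0] assms
    by (simp add: D_def as_def flip: avgs_remove1)
  have le: "l1 M (\<lambda>\<omega>. avgs R as (\<lambda>y. D y \<omega>) y) \<le> K" for y
  proof -
    have "l1 M (\<lambda>\<omega>. avgs R as (\<lambda>y. D y \<omega>) y) \<le> avgs R as (\<lambda>y. l1 M (D y)) y"
      by (intro l1_avgs intD)
    also have "\<dots> \<le> avgs R as (\<lambda>_. K) y"
      unfolding D_def using assms by (intro avgs_mono_all lip)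
    finally show ?thesis using assms by (simp add: avgs_const)
  qed
  have "l1 M (\<lambda>\<omega>. (smooth R vs (x + unit_vec v + unit_vec u) \<omega> - smooth R vs (x + unit_vec v) \<omega>)
      - (smooth R vs (x + unit_vec u) \<omega> - smooth R vs x \<omega>))
      = l1 M (\<lambda>\<omega>. avgs R as (\<lambda>y. D y \<omega>) (x + mul R (unit_vec v)) - avgs R as (\<lambda>y. D y \<omega>) x) / real R"
    unfolding D avg_telescope l1_divide by simp
  also have "\<dots> \<le> (K + K) / real R"
    by (intro divide_right_mono order_trans[OF l1_diff] add_mono le integrable_avgs intD) auto
  finally show ?thesis by simp
qed

text \<open>Each averaging reaches fewer than \<open>R\<close> unit steps away, so it costs at most
  \<open>R * K\<close>; the costs add over the entries of \<open>vs\<close>.\<close>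

lemma l1_smooth_minus:
  assumes "R > 0" "set vs \<subseteq> V"
  shows "l1 M (\<lambda>\<omega>. smooth R vs x \<omega> - H x \<omega>) \<le> real (length vs) * (real R * K)"
  using assms(2)
proof (induction vs arbitrary: x)
  case Nil
  then show ?case by (simp add: smooth_def l1_def)
next
  case (Cons v vs)
  have Knn: "K \<ge> 0"
    using lip[of v 0] Cons.prems l1_nonneg[of M] order_trans by (metis list.set_intros(1) subsetD)
  have mul: "l1 M (\<lambda>\<omega>. H (x + mul s (unit_vec v)) \<omega> - H x \<omega>) \<le> real s * K" for s
  proof (induction s)
    case 0
    then show ?case by (simp add: l1_def)
  next
    case (Suc s)
    have eq: "x + mul (Suc s) (unit_vec v) = x + mul s (unit_vec v) + unit_vec v"
      by (simp add: mul_Suc add_ac)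
    have "l1 M (\<lambda>\<omega>. H (x + mul s (unit_vec v) + unit_vec v) \<omega> - H x \<omega>)
        \<le> l1 M (\<lambda>\<omega>. H (x + mul s (unit_vec v) + unit_vec v) \<omega> - H (x + mul s (unit_vec v)) \<omega>)
          + l1 M (\<lambda>\<omega>. H (x + mul s (unit_vec v)) \<omega> - H x \<omega>)"
      by (intro l1_triangle int)
    also have "l1 M (\<lambda>\<omega>. H (x + mul s (unit_vec v) + unit_vec v) \<omega> - H (x + mul s (unit_vec v)) \<omega>) \<le> K"
      using Cons.prems by (intro lip) auto
    also note Suc
    finally show ?case
      unfolding eq by (simp only: of_nat_Suc distrib_right mult_1)
  qed
  have "l1 M (\<lambda>\<omega>. smooth R (v # vs) x \<omega> - H x \<omega>)
      = l1 M (\<lambda>\<omega>. \<Sum>s<R. smooth R vs (x + mul s (unit_vec v)) \<omega> - H x \<omega>) / real R"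
    unfolding smooth_def using assms(1)
    by (subst abs_of_nat[symmetric], subst l1_divide[symmetric])
       (simp add: avg_def sum_subtractf diff_divide_distrib)
  also have "\<dots> \<le> (\<Sum>s<R. l1 M (\<lambda>\<omega>. smooth R vs (x + mul s (unit_vec v)) \<omega> - H x \<omega>)) / real R"
    by (intro divide_right_mono l1_sum Bochner_Integration.integrable_diff int integrable_smooth) auto
  also have "\<dots> \<le> (\<Sum>s<R. real (length vs) * (real R * K) + real R * K) / real R"
  proof (intro divide_right_mono sum_mono)
    fix s assume "s \<in> {..<R}"
    have "l1 M (\<lambda>\<omega>. smooth R vs (x + mul s (unit_vec v)) \<omega> - H x \<omega>)
        \<le> l1 M (\<lambda>\<omega>. smooth R vs (x + mul s (unit_vec v)) \<omega> - H (x + mul s (unit_vec v)) \<omega>)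
          + l1 M (\<lambda>\<omega>. H (x + mul s (unit_vec v)) \<omega> - H x \<omega>)"
      by (intro l1_triangle int integrable_smooth)
    also have "\<dots> \<le> real (length vs) * (real R * K) + real s * K"
      using Cons.prems by (intro add_mono Cons.IH mul) auto
    also have "real s * K \<le> real R * K"
      using \<open>s \<in> {..<R}\<close> Knn by (intro mult_right_mono) auto
    finally show "l1 M (\<lambda>\<omega>. smooth R vs (x + mul s (unit_vec v)) \<omega> - H x \<omega>)
        \<le> real (length vs) * (real R * K) + real R * K" by simp
  qed simp
  also have "\<dots> = real (length (v # vs)) * (real R * K)"
    using assms(1) by (simp add: distrib_right)
  finally show ?case .
qed

definition deriv :: "nat \<Rightarrow> 'v list \<Rightarrow> ('v \<Rightarrow> int) \<Rightarrow> 'v \<Rightarrow> 'w \<Rightarrow> real" where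
  "deriv R vs x v \<omega> = smooth R vs (x + unit_vec v) \<omega> - smooth R vs x \<omega>"

lemma integrable_deriv: "integrable M (deriv R vs x v)"
  unfolding deriv_def by (intro Bochner_Integration.integrable_diff integrable_smooth)

text \<open>A first order Taylor estimate. Subtracting the affine approximation at \<open>x\<close>
  leaves \<Phi>, whose increment at \<open>x + b\<close> is a difference of two values of
  \<open>deriv\<close>, of order \<open>nrm V b / R\<close>. Summing over the \<open>nrm V a\<close>
  steps of a path to \<open>x + a\<close> produces the square.\<close>

lemma linearize:
  assumes "R > 0" "set vs = V" and a: "\<forall>v. v \<notin> V \<longrightarrow> a v = 0"
  shows "l1 M (\<lambda>\<omega>. smooth R vs (x + a) \<omega> - smooth R vs x \<omega> - (\<Sum>v\<in>V. real_of_int (a v) * deriv R vs x v \<omega>))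
    \<le> 2 * K * (real (nrm V a))\<^sup>2 / real R"
proof -
  define s where "s = nrm V a"
  define \<Phi> where "\<Phi> y \<omega> = smooth R vs y \<omega> - (\<Sum>v\<in>V. real_of_int ((y - x) v) * deriv R vs x v \<omega>)" for y \<omega>
  \<comment> \<open>The Lipschitz bound forces \<open>K\<close> to be nonnegative only if there is a
    direction to step in.\<close>
  have "V = {} \<or> K \<ge> 0"
    using lip[of _ 0] l1_nonneg[of M] order_trans by (metis ex_in_conv)
  have \<Phi>: "\<Phi> (y + unit_vec u) \<omega> - \<Phi> y \<omega> = deriv R vs y u \<omega> - deriv R vs x u \<omega>" if "u \<in> V" for y u \<omega>
  proof -
    have "(\<Sum>v\<in>V. real_of_int ((y + unit_vec u - x) v) * deriv R vs x v \<omega>)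
        = (\<Sum>v\<in>V. real_of_int ((y - x) v) * deriv R vs x v \<omega> + (if v = u then deriv R vs x v \<omega> else 0))"
      by (intro sum.cong) (auto simp: unit_vec_def algebra_simps)
    also have "\<dots> = (\<Sum>v\<in>V. real_of_int ((y - x) v) * deriv R vs x v \<omega>) + deriv R vs x u \<omega>"
      using that fin by (simp add: sum.distrib)
    finally show ?thesis
      by (simp add: \<Phi>_def deriv_def)
  qed
  have D: "l1 M (\<lambda>\<omega>. deriv R vs (x + b) u \<omega> - deriv R vs x u \<omega>) \<le> 2 * K / real R * real (nrm V b)"
    if "\<forall>v. v \<notin> V \<longrightarrow> b v = 0" "u \<in> V" for b u
    using fin integrable_deriv _ that(1) order_refl
  proof (rule lattice_lipschitz)
    fix b v assume "v \<in> V"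
    then show "l1 M (\<lambda>\<omega>. deriv R vs (x + b + unit_vec v) u \<omega> - deriv R vs (x + b) u \<omega>) \<le> 2 * K / real R"
      unfolding deriv_def using assms that by (intro l1_second_diff) auto
  qed
  have "l1 M (\<lambda>\<omega>. \<Phi> (x + a) \<omega> - \<Phi> x \<omega>) \<le> (2 * K / real R * real s) * real (nrm V a)"
    using fin _ _ a order_refl
  proof (rule lattice_lipschitz)
    show "integrable M (\<Phi> y)" for y
      unfolding \<Phi>_def
      by (intro Bochner_Integration.integrable_diff Bochner_Integration.integrable_sum
          integrable_mult_right integrable_smooth integrable_deriv)
  next
    fix b u assume *: "\<forall>v. v \<notin> V \<longrightarrow> b v = 0" "nrm V b \<le> nrm V a" "u \<in> V"
    have "l1 M (\<lambda>\<omega>. \<Phi> (x + b + unit_vec u) \<omega> - \<Phi> (x + b) \<omega>) \<le> 2 * K / real R * real (nrm V b)"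
      using D[OF *(1,3)] by (simp only: \<Phi>[OF *(3)])
    also have "\<dots> \<le> 2 * K / real R * real s"
      using * \<open>V = {} \<or> K \<ge> 0\<close> by (intro mult_left_mono) (auto simp: s_def)
    finally show "l1 M (\<lambda>\<omega>. \<Phi> (x + b + unit_vec u) \<omega> - \<Phi> (x + b) \<omega>) \<le> 2 * K / real R * real s" .
  qed
  moreover have "\<Phi> (x + a) \<omega> - \<Phi> x \<omega>
      = smooth R vs (x + a) \<omega> - smooth R vs x \<omega> - (\<Sum>v\<in>V. real_of_int (a v) * deriv R vs x v \<omega>)" for \<omega>
    by (simp add: \<Phi>_def)
  ultimately show ?thesis
    by (simp add: s_def power2_eq_square mult_ac)
qed

end

context lattice_L1
begin

lemma l1_steps:
  "l1 M (\<lambda>\<omega>. smooth R vs (x + mul N a) \<omega> - smooth R vs x \<omega>)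
    \<le> (\<Sum>s<N. l1 M (\<lambda>\<omega>. smooth R vs (x + mul s a + a) \<omega> - smooth R vs (x + mul s a) \<omega>))"
proof (induction N)
  case 0
  then show ?case by (simp add: l1_def)
next
  case (Suc N)
  have eq: "x + mul (Suc N) a = x + mul N a + a"
    by (simp add: mul_Suc add_ac)
  have "l1 M (\<lambda>\<omega>. smooth R vs (x + mul N a + a) \<omega> - smooth R vs x \<omega>)
      \<le> l1 M (\<lambda>\<omega>. smooth R vs (x + mul N a + a) \<omega> - smooth R vs (x + mul N a) \<omega>)
        + l1 M (\<lambda>\<omega>. smooth R vs (x + mul N a) \<omega> - smooth R vs x \<omega>)"
    by (intro l1_triangle integrable_smooth)
  with Suc.IH show ?case
    unfolding eq sum.lessThan_Suc by linarith
qed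

text \<open>The upper bound from \<open>key\<close> concerns the increments of all
  \<open>a i\<close> at one common base point. The lower bound holds only on average over
  \<open>N\<close> steps along the individual \<open>a i\<close>, because smoothing perturbs
  \<open>H\<close> by a multiple of \<open>R\<close>. Averaging the base point along all the
  directions \<open>a i\<close> reconciles them: averages are monotone and commute, so for each
  \<open>i\<close> its own direction can be taken innermost.\<close>

lemma smoothed_bound:
  fixes a :: "'i \<Rightarrow> 'v \<Rightarrow> int" and g :: "'i \<Rightarrow> 'v \<Rightarrow> real"
  assumes "R > 0" "N > 0" "set vs = V" "set is = I" "finite J" "\<kappa> \<ge> 0"
    and a: "\<And>i v. i \<in> I \<Longrightarrow> v \<notin> V \<Longrightarrow> a i v = 0" "\<And>i. i \<in> I \<Longrightarrow> bnd C (a i)"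
    and \<beta>: "\<And>i. i \<in> I \<Longrightarrow> \<beta> i \<ge> 0"
    and pq: "\<And>e. e \<in> J \<Longrightarrow> p e \<in> V \<and> q e \<in> V"
    and upper: "\<And>x e. bnd L x \<Longrightarrow> e \<in> J \<Longrightarrow>
      l1 M (\<lambda>\<omega>. H (x + unit_vec (p e)) \<omega> - H (x + unit_vec (q e)) \<omega>) \<le> A"
    and lower: "\<And>x y i. bnd L x \<Longrightarrow> bnd L y \<Longrightarrow> i \<in> I \<Longrightarrow>
      (\<Sum>v\<in>V. g i v * real_of_int (x v - y v)) \<le> l1 M (\<lambda>\<omega>. H x \<omega> - H y \<omega>)"
    and key: "\<And>\<phi>. (\<Sum>i\<in>I. \<beta> i * \<bar>\<Sum>v\<in>V. real_of_int (a i v) * \<phi> v\<bar>) \<le> \<kappa> * (\<Sum>e\<in>J. \<bar>\<phi> (p e) - \<phi> (q e)\<bar>)"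
    and L: "L \<ge> length is * (N * C) + length vs * R + N * C"
  shows "(\<Sum>i\<in>I. \<beta> i * (\<Sum>v\<in>V. g i v * real_of_int (a i v)))
    \<le> \<kappa> * (real (card J) * A) + (\<Sum>i\<in>I. \<beta> i * (2 * K * (real (nrm V (a i)))\<^sup>2 / real R))
      + (\<Sum>i\<in>I. \<beta> i * (2 * (real (length vs) * (real R * K)) / real N))"
proof -
  \<comment> \<open>The reach of the averages along \<open>as\<close>. The bound \<open>L\<close>
    leaves room beyond it for the smoothing box, or for \<open>N\<close> further steps along one
    direction.\<close>
  define r where "r = length is * (N * C)"
  define \<Theta> where "\<Theta> i x = l1 M (\<lambda>\<omega>. smooth R vs (x + a i) \<omega> - smooth R vs x \<omega>)" for i x
  define as where "as = map a is"
  have C: "bnd C b" if "b \<in> set as" for b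
    using that a assms(4) by (auto simp: as_def)
  have up: "(\<Sum>i\<in>I. \<beta> i * \<Theta> i x)
      \<le> \<kappa> * (real (card J) * A) + (\<Sum>i\<in>I. \<beta> i * (2 * K * (real (nrm V (a i)))\<^sup>2 / real R))"
    if x: "bnd r x" for x
  proof -
    define X where "X i \<omega> = (\<Sum>v\<in>V. real_of_int (a i v) * deriv R vs x v \<omega>)" for i \<omega>
    have intX: "integrable M (X i)" for i
      unfolding X_def by (intro Bochner_Integration.integrable_sum integrable_mult_right integrable_deriv)
    have intdd: "integrable M (\<lambda>\<omega>. \<bar>deriv R vs x (p e) \<omega> - deriv R vs x (q e) \<omega>\<bar>)" for e
      by (intro integrable_abs Bochner_Integration.integrable_diff integrable_deriv)
    have \<Theta>: "\<Theta> i x \<le> l1 M (X i) + 2 * K * (real (nrm V (a i)))\<^sup>2 / real R" if "i \<in> I" for i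
    proof -
      have "\<Theta> i x = l1 M (\<lambda>\<omega>. X i \<omega> + (smooth R vs (x + a i) \<omega> - smooth R vs x \<omega> - X i \<omega>))"
        by (simp add: \<Theta>_def)
      also have "\<dots> \<le> l1 M (X i) + l1 M (\<lambda>\<omega>. smooth R vs (x + a i) \<omega> - smooth R vs x \<omega> - X i \<omega>)"
        by (intro l1_add intX Bochner_Integration.integrable_diff integrable_smooth)
      also have "l1 M (\<lambda>\<omega>. smooth R vs (x + a i) \<omega> - smooth R vs x \<omega> - X i \<omega>)
          \<le> 2 * K * (real (nrm V (a i)))\<^sup>2 / real R"
        unfolding X_def using assms a that by (intro linearize) auto
      finally show ?thesis by simp
    qed
    have "(\<Sum>i\<in>I. \<beta> i * l1 M (X i)) = (\<integral>\<omega>. (\<Sum>i\<in>I. \<beta> i * \<bar>X i \<omega>\<bar>) \<partial>M)"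
      unfolding l1_def using intX by (subst Bochner_Integration.integral_sum) auto
    \<comment> \<open>For each \<omega> the scalar inequality is applied to the derivatives at
      \<open>x\<close>, which are the coefficients of a linear map.\<close>
    also have "\<dots> \<le> (\<integral>\<omega>. \<kappa> * (\<Sum>e\<in>J. \<bar>deriv R vs x (p e) \<omega> - deriv R vs x (q e) \<omega>\<bar>) \<partial>M)"
    proof (rule integral_mono)
      show "integrable M (\<lambda>\<omega>. \<Sum>i\<in>I. \<beta> i * \<bar>X i \<omega>\<bar>)"
        by (intro Bochner_Integration.integrable_sum integrable_mult_right integrable_abs intX)
      show "integrable M (\<lambda>\<omega>. \<kappa> * (\<Sum>e\<in>J. \<bar>deriv R vs x (p e) \<omega> - deriv R vs x (q e) \<omega>\<bar>))"
        by (intro Bochner_Integration.integrable_sum integrable_mult_right intdd)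
    qed (unfold X_def, rule key)
    also have "\<dots> = \<kappa> * (\<Sum>e\<in>J. l1 M (\<lambda>\<omega>. deriv R vs x (p e) \<omega> - deriv R vs x (q e) \<omega>))"
      unfolding l1_def using intdd by (simp add: Bochner_Integration.integral_sum)
    also have "\<dots> \<le> \<kappa> * (\<Sum>e\<in>J. A)"
    proof (intro mult_left_mono sum_mono)
      fix e assume e: "e \<in> J"
      have "l1 M (\<lambda>\<omega>. smooth R vs (x + unit_vec (p e)) \<omega> - smooth R vs (x + unit_vec (q e)) \<omega>) \<le> A"
        using x L e \<open>R > 0\<close> by (intro l1_smooth_diff[where l = r] upper) (auto elim!: bnd_mono simp: r_def)
      then show "l1 M (\<lambda>\<omega>. deriv R vs x (p e) \<omega> - deriv R vs x (q e) \<omega>) \<le> A"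
        by (simp add: deriv_def)
    qed (use \<open>\<kappa> \<ge> 0\<close> in simp)
    finally have "(\<Sum>i\<in>I. \<beta> i * l1 M (X i)) \<le> \<kappa> * (real (card J) * A)"
      by simp
    moreover have "(\<Sum>i\<in>I. \<beta> i * \<Theta> i x)
        \<le> (\<Sum>i\<in>I. \<beta> i * (l1 M (X i) + 2 * K * (real (nrm V (a i)))\<^sup>2 / real R))"
      using \<beta> \<Theta> by (intro sum_mono mult_left_mono) auto
    ultimately show ?thesis
      by (simp add: distrib_left sum.distrib)
  qed
  \<comment> \<open>A single step may be short, but \<open>N\<close> steps together cover at least
    \<open>N * ?w\<close> up to the displacement caused by smoothing at the two ends; the triangle
    inequality passes this on to the average step.\<close>
  have low: "(\<Sum>v\<in>V. g i v * real_of_int (a i v)) - 2 * (real (length vs) * (real R * K)) / real N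
      \<le> avgs N as (\<Theta> i) 0" (is "?w - ?err \<le> _") if i: "i \<in> I" for i
  proof -
    define as' where "as' = remove1 (a i) as"
    have "a i \<in> set as"
      using i assms(4) by (auto simp: as_def)
    then have len: "length as' \<le> length is"
      by (simp add: as'_def as_def length_remove1)
    have "?w - ?err = avgs N as' (\<lambda>_. ?w - ?err) 0"
      using \<open>N > 0\<close> by (simp add: avgs_const)
    also have "\<dots> \<le> avgs N as' (avg N (a i) (\<Theta> i)) 0"
    proof (rule avgs_mono[where C = C and l = 0])
      show "bnd C b" if "b \<in> set as'" for b
        using that set_remove1_subset[of "a i" as] by (intro C) (auto simp: as'_def)
    next
      fix y :: "'v \<Rightarrow> int" assume "bnd (0 + length as' * (N * C)) y"
      then have y: "bnd r y"
        by (rule bnd_mono) (simp add: r_def mult_right_mono len)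
      then have yL: "bnd L y"
        by (rule bnd_mono) (use L in \<open>simp add: r_def\<close>)
      have "bnd (r + N * C) (y + mul N (a i))"
        using y a i by (intro bnd_add bnd_mul) auto
      then have yL': "bnd L (y + mul N (a i))"
        by (rule bnd_mono) (use L in \<open>simp add: r_def\<close>)
      have "real N * ?w = (\<Sum>v\<in>V. g i v * real_of_int ((y + mul N (a i)) v - y v))"
        by (simp add: mul_def sum_distrib_left mult_ac)
      also have "\<dots> \<le> l1 M (\<lambda>\<omega>. H (y + mul N (a i)) \<omega> - H y \<omega>)"
        using yL yL' i by (intro lower)
      also have "\<dots> \<le> l1 M (\<lambda>\<omega>. H (y + mul N (a i)) \<omega> - smooth R vs (y + mul N (a i)) \<omega>)
          + (l1 M (\<lambda>\<omega>. smooth R vs (y + mul N (a i)) \<omega> - smooth R vs y \<omega>)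
          + l1 M (\<lambda>\<omega>. smooth R vs y \<omega> - H y \<omega>))"
        by (intro order_trans[OF l1_triangle[where g = "smooth R vs (y + mul N (a i))"]] add_left_mono
            l1_triangle int integrable_smooth)
      also have "l1 M (\<lambda>\<omega>. H (y + mul N (a i)) \<omega> - smooth R vs (y + mul N (a i)) \<omega>)
          \<le> real (length vs) * (real R * K)"
        by (subst l1_minus_commute) (use assms in \<open>auto intro: l1_smooth_minus\<close>)
      also have "l1 M (\<lambda>\<omega>. smooth R vs y \<omega> - H y \<omega>) \<le> real (length vs) * (real R * K)"
        using assms by (auto intro: l1_smooth_minus)
      also have "l1 M (\<lambda>\<omega>. smooth R vs (y + mul N (a i)) \<omega> - smooth R vs y \<omega>) \<le> (\<Sum>s<N. \<Theta> i (y + mul s (a i)))"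
        unfolding \<Theta>_def by (rule l1_steps)
      finally have "real N * ?w - 2 * (real (length vs) * (real R * K)) \<le> (\<Sum>s<N. \<Theta> i (y + mul s (a i)))"
        by (simp add: mult_ac)
      then have "(real N * ?w - 2 * (real (length vs) * (real R * K))) / real N \<le> avg N (a i) (\<Theta> i) y"
        unfolding avg_def by (rule divide_right_mono) simp
      then show "?w - ?err \<le> avg N (a i) (\<Theta> i) y"
        using \<open>N > 0\<close> by (simp add: diff_divide_distrib)
    qed simp
    also have "\<dots> = avgs N as (\<Theta> i) 0"
      using \<open>a i \<in> set as\<close> by (simp add: as'_def avgs_avg flip: avgs_remove1)
    finally show ?thesis .
  qed
  have "(\<Sum>i\<in>I. \<beta> i * ((\<Sum>v\<in>V. g i v * real_of_int (a i v)) - 2 * (real (length vs) * (real R * K)) / real N))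
      \<le> (\<Sum>i\<in>I. \<beta> i * avgs N as (\<Theta> i) 0)"
    using \<beta> low by (intro sum_mono mult_left_mono) auto
  also have "\<dots> = avgs N as (\<lambda>x. \<Sum>i\<in>I. \<beta> i * \<Theta> i x) 0"
    by (rule avgs_sum[symmetric])
  also have "\<dots> \<le> avgs N as (\<lambda>_. \<kappa> * (real (card J) * A)
      + (\<Sum>i\<in>I. \<beta> i * (2 * K * (real (nrm V (a i)))\<^sup>2 / real R))) 0"
    using C by (intro avgs_mono[where C = C and l = 0] up) (auto simp: r_def as_def)
  also have "\<dots> = \<kappa> * (real (card J) * A) + (\<Sum>i\<in>I. \<beta> i * (2 * K * (real (nrm V (a i)))\<^sup>2 / real R))"
    using \<open>N > 0\<close> by (rule avgs_const)
  finally show ?thesis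
    by (simp add: right_diff_distrib sum_subtractf)
qed

end

text \<open>Take \<open>N = R * R\<close> in \<open>smoothed_bound\<close>: the bend contributes
  \<open>1/R\<close> and the displacement \<open>R/N = 1/R\<close>, so both vanish as
  \<open>R\<close> grows. The map \<open>H\<close> may depend on the range \<open>L\<close>, which
  allows finer lattices for larger \<open>R\<close>, but \<open>K\<close>, \<open>A\<close> and
  \<open>g\<close> must not.\<close>

lemma lattice_obstruction:
  fixes a :: "'i \<Rightarrow> 'v \<Rightarrow> int" and g :: "'i \<Rightarrow> 'v \<Rightarrow> real"
  assumes "finite V" "finite I" "finite J" "\<kappa> \<ge> 0"
    and a: "\<And>i v. i \<in> I \<Longrightarrow> v \<notin> V \<Longrightarrow> a i v = 0"
    and \<beta>: "\<And>i. i \<in> I \<Longrightarrow> \<beta> i \<ge> 0"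
    and pq: "\<And>e. e \<in> J \<Longrightarrow> p e \<in> V \<and> q e \<in> V"
    and key: "\<And>\<phi>. (\<Sum>i\<in>I. \<beta> i * \<bar>\<Sum>v\<in>V. real_of_int (a i v) * \<phi> v\<bar>) \<le> \<kappa> * (\<Sum>e\<in>J. \<bar>\<phi> (p e) - \<phi> (q e)\<bar>)"
    and H: "\<And>L. \<exists>H. lattice_L1 M V H K \<and>
      (\<forall>x e. bnd L x \<longrightarrow> e \<in> J \<longrightarrow> l1 M (\<lambda>\<omega>. H (x + unit_vec (p e)) \<omega> - H (x + unit_vec (q e)) \<omega>) \<le> A) \<and>
      (\<forall>x y i. bnd L x \<longrightarrow> bnd L y \<longrightarrow> i \<in> I \<longrightarrow>
        (\<Sum>v\<in>V. g i v * real_of_int (x v - y v)) \<le> l1 M (\<lambda>\<omega>. H x \<omega> - H y \<omega>))"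
  shows "(\<Sum>i\<in>I. \<beta> i * (\<Sum>v\<in>V. g i v * real_of_int (a i v))) \<le> \<kappa> * (real (card J) * A)"
proof -
  obtain vs where vs: "set vs = V"
    using finite_list[OF \<open>finite V\<close>] by auto
  obtain "is" where "is": "set is = I"
    using finite_list[OF \<open>finite I\<close>] by auto
  define C where "C = nat (\<Sum>i\<in>I. \<Sum>v\<in>V. \<bar>a i v\<bar>)"
  have C: "bnd C (a i)" if "i \<in> I" for i
    unfolding bnd_def
  proof
    fix v
    have "\<bar>a i v\<bar> \<le> (\<Sum>v\<in>V. \<bar>a i v\<bar>)"
      using a[OF that, of v] \<open>finite V\<close>
      by (cases "v \<in> V") (auto intro: member_le_sum[of v V "\<lambda>v. \<bar>a i v\<bar>"] sum_nonneg)
    also have "\<dots> \<le> (\<Sum>i\<in>I. \<Sum>v\<in>V. \<bar>a i v\<bar>)"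
      using that \<open>finite I\<close> by (intro member_le_sum[of i I "\<lambda>i. \<Sum>v\<in>V. \<bar>a i v\<bar>"]) (auto intro: sum_nonneg)
    moreover have "0 \<le> (\<Sum>i\<in>I. \<Sum>v\<in>V. \<bar>a i v\<bar>)"
      by (intro sum_nonneg) auto
    ultimately show "\<bar>a i v\<bar> \<le> int C"
      by (simp add: C_def)
  qed
  define E where "E = (\<Sum>i\<in>I. \<beta> i * (2 * K * (real (nrm V (a i)))\<^sup>2)) + (\<Sum>i\<in>I. \<beta> i * (2 * (real (length vs) * K)))"
  let ?S = "\<Sum>i\<in>I. \<beta> i * (\<Sum>v\<in>V. g i v * real_of_int (a i v))"
  have le: "?S \<le> \<kappa> * (real (card J) * A) + E / real R" if R: "R > 0" for R
  proof -
    obtain H where H: "lattice_L1 M V H K"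
      "\<And>x e. bnd (length is * (R * R * C) + length vs * R + R * R * C) x \<Longrightarrow> e \<in> J \<Longrightarrow>
        l1 M (\<lambda>\<omega>. H (x + unit_vec (p e)) \<omega> - H (x + unit_vec (q e)) \<omega>) \<le> A"
      "\<And>x y i. bnd (length is * (R * R * C) + length vs * R + R * R * C) x \<Longrightarrow>
        bnd (length is * (R * R * C) + length vs * R + R * R * C) y \<Longrightarrow> i \<in> I \<Longrightarrow>
        (\<Sum>v\<in>V. g i v * real_of_int (x v - y v)) \<le> l1 M (\<lambda>\<omega>. H x \<omega> - H y \<omega>)"
      using H[of "length is * (R * R * C) + length vs * R + R * R * C"] by blast
    interpret lattice_L1 M V H K by (rule H)
    have "?S \<le> \<kappa> * (real (card J) * A) + (\<Sum>i\<in>I. \<beta> i * (2 * K * (real (nrm V (a i)))\<^sup>2 / real R))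
        + (\<Sum>i\<in>I. \<beta> i * (2 * (real (length vs) * (real R * K)) / real (R * R)))"
      by (rule smoothed_bound[OF R _ vs "is" \<open>finite J\<close> \<open>\<kappa> \<ge> 0\<close> a C \<beta> pq H(2,3) key]) (use R in auto)
    also have "(\<Sum>i\<in>I. \<beta> i * (2 * (real (length vs) * (real R * K)) / real (R * R)))
        = (\<Sum>i\<in>I. \<beta> i * (2 * (real (length vs) * K))) / real R"
      using R by (simp add: sum_divide_distrib field_simps)
    also have "(\<Sum>i\<in>I. \<beta> i * (2 * K * (real (nrm V (a i)))\<^sup>2 / real R))
        = (\<Sum>i\<in>I. \<beta> i * (2 * K * (real (nrm V (a i)))\<^sup>2)) / real R"
      by (simp add: sum_divide_distrib)
    finally show ?thesis
      by (simp add: E_def add_divide_distrib)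
  qed
  have "(\<lambda>R. \<kappa> * (real (card J) * A) + E / real R) \<longlonglongrightarrow> \<kappa> * (real (card J) * A) + 0"
    by (intro tendsto_add tendsto_const lim_const_over_n)
  then show ?thesis
    using le by (intro LIMSEQ_le_const[where X = "\<lambda>R. \<kappa> * (real (card J) * A) + E / real R"])
      (auto intro!: exI[of _ 1])
qed

section \<open>Lattices in Wasserstein space\<close>

lemma Wa1I: "(\<And>x. x \<notin> V \<Longrightarrow> pmf p x = 0) \<Longrightarrow> p \<in> Wa1 V"
  unfolding Wa1_def set_pmf_eq by blast

lemma couplings_support:
  assumes "r \<in> couplings p q" "p \<in> Wa1 V" "q \<in> Wa1 V"
  shows "set_pmf r \<subseteq> V \<times> V"
proof
  fix z assume z: "z \<in> set_pmf r"
  have "fst z \<in> set_pmf (map_pmf fst r)" "snd z \<in> set_pmf (map_pmf snd r)"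
    using z by (auto simp del: fst_conv snd_conv)
  then have "fst z \<in> set_pmf p" "snd z \<in> set_pmf q"
    using assms(1) by (simp_all add: couplings_def del: set_map_pmf)
  then show "z \<in> V \<times> V"
    using assms(2,3) by (auto simp: Wa1_def mem_Times_iff)
qed

lemma expectation_finite:
  fixes f :: "'a \<Rightarrow> real"
  assumes "finite V" "set_pmf p \<subseteq> V"
  shows "measure_pmf.expectation p f = (\<Sum>v\<in>V. f v * pmf p v)"
  using assms by (intro integral_measure_pmf_real) auto

text \<open>The easy half of Kantorovich duality: integrate the Lipschitz inequality against any
  coupling. The independent coupling shows that the infimum is over a nonempty set.\<close>

lemma W1_dist_ge:
  assumes "finite V" "p \<in> Wa1 V" "q \<in> Wa1 V"
    and f: "\<And>x y. x \<in> V \<Longrightarrow> y \<in> V \<Longrightarrow> f x - f y \<le> d x y"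
  shows "(\<Sum>v\<in>V. f v * (pmf p v - pmf q v)) \<le> W1_dist d p q"
  unfolding W1_dist_def
proof (rule cINF_greatest)
  have "pair_pmf p q \<in> couplings p q"
    by (simp add: couplings_def map_fst_pair_pmf map_snd_pair_pmf)
  then show "couplings p q \<noteq> {}" by auto
next
  fix r assume r: "r \<in> couplings p q"
  have supp: "set_pmf r \<subseteq> V \<times> V"
    using couplings_support[OF r assms(2,3)] .
  have fin: "finite (set_pmf r)"
    using supp \<open>finite V\<close> by (meson finite_SigmaI finite_subset)
  have "(\<Sum>v\<in>V. f v * (pmf p v - pmf q v)) = measure_pmf.expectation p f - measure_pmf.expectation q f"
    using assms(1-3) by (simp add: expectation_finite Wa1_def right_diff_distrib sum_subtractf)
  also have "\<dots> = measure_pmf.expectation r (\<lambda>z. f (fst z)) - measure_pmf.expectation r (\<lambda>z. f (snd z))"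
    using r by (auto simp: couplings_def)
  also have "\<dots> = measure_pmf.expectation r (\<lambda>z. f (fst z) - f (snd z))"
    using fin by (intro Bochner_Integration.integral_diff[symmetric] integrable_measure_pmf_finite)
  also have "\<dots> \<le> measure_pmf.expectation r (\<lambda>(x, y). d x y)"
    using fin supp f
    by (intro integral_mono_AE integrable_measure_pmf_finite) (auto simp: AE_measure_pmf_iff)
  finally show "(\<Sum>v\<in>V. f v * (pmf p v - pmf q v)) \<le> measure_pmf.expectation r (\<lambda>(x, y). d x y)" .
qed

lemma W1_dist_le:
  assumes d: "\<And>x y. d x y \<ge> 0" and "r \<in> couplings p q"
  shows "W1_dist d p q \<le> measure_pmf.expectation r (\<lambda>(x, y). d x y)"
  unfolding W1_dist_def using assms(2)
proof (rule cINF_lower[rotated])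
  show "bdd_below ((\<lambda>r. measure_pmf.expectation r (\<lambda>(x, y). d x y)) ` couplings p q)"
    by (rule bdd_belowI[of _ 0]) (auto intro!: Bochner_Integration.integral_nonneg simp: d split_beta)
qed

lemma pmf_embed_finite:
  assumes "finite V" "\<And>x. f x \<ge> 0" "\<And>x. x \<notin> V \<Longrightarrow> f x = 0" "(\<Sum>x\<in>V. f x) = (1 :: real)"
  shows "pmf (embed_pmf f) x = f x"
proof (rule pmf_embed_pmf)
  have "(\<integral>\<^sup>+ x. ennreal (f x) \<partial>count_space UNIV) = (\<Sum>x\<in>V. ennreal (f x))"
    using assms by (intro nn_integral_count_space') auto
  also have "\<dots> = ennreal (\<Sum>x\<in>V. f x)"
    using assms by (intro sum_ennreal) auto
  finally show "(\<integral>\<^sup>+ x. ennreal (f x) \<partial>count_space UNIV) = 1"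
    using assms by simp
qed (rule assms)

text \<open>The coupling keeps the common part \<open>r\<close> on the diagonal and sends the mass
  \<eta> from \<open>u\<close> to \<open>v\<close>.\<close>

lemma W1_dist_move:
  assumes "finite V" "u \<in> V" "v \<in> V" "\<eta> \<ge> 0"
    and d: "\<And>x y. d x y \<ge> 0" "\<And>x. x \<in> V \<Longrightarrow> d x x = 0"
    and r: "\<And>x. r x \<ge> 0" "\<And>x. x \<notin> V \<Longrightarrow> r x = 0"
    and p: "\<And>x. pmf p x = r x + (if x = u then \<eta> else 0)"
    and q: "\<And>x. pmf q x = r x + (if x = v then \<eta> else 0)"
  shows "W1_dist d p q \<le> \<eta> * d u v"
proof -
  define c where "c z = (if fst z = snd z then r (fst z) else 0) + (if fst z = u then if snd z = v then \<eta> else 0 else 0)"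
    for z :: "'a \<times> 'a"
  define C where "C = embed_pmf c"
  have "p \<in> Wa1 V"
    using r(2) p \<open>u \<in> V\<close> by (intro Wa1I) auto
  have row: "(\<Sum>y\<in>V. c (x, y)) = pmf p x" if "x \<in> V" for x
    unfolding c_def p using that assms(1-3) by (simp add: sum.distrib)
  have col: "(\<Sum>x\<in>V. c (x, y)) = pmf q y" if "y \<in> V" for y
    unfolding c_def q using that assms(1-3) by (simp add: sum.distrib)
  have supp: "c z = 0" if "z \<notin> V \<times> V" for z
    using that r(2) assms(2,3) by (cases z) (auto simp: c_def)
  have "(\<Sum>z\<in>V \<times> V. c z) = (\<Sum>x\<in>V. pmf p x)"
    using row by (simp add: sum.cartesian_product')
  also have "\<dots> = 1"
    using \<open>p \<in> Wa1 V\<close> \<open>finite V\<close> by (intro sum_pmf_eq_1) (auto simp: Wa1_def)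
  finally have pmfC: "pmf C z = c z" for z
    unfolding C_def using assms(1,4) r(1) supp
    by (intro pmf_embed_finite[of "V \<times> V"]) (auto simp: c_def)
  have setC: "set_pmf C \<subseteq> V \<times> V"
    unfolding set_pmf_eq pmfC using supp by blast
  have E: "measure_pmf.expectation C f = (\<Sum>x\<in>V. \<Sum>y\<in>V. f (x, y) * c (x, y))" for f
    using expectation_finite[OF _ setC] \<open>finite V\<close> by (simp add: pmfC sum.cartesian_product')
  have "map_pmf fst C = p"
  proof (rule pmf_eqI)
    fix a
    have "pmf (map_pmf fst C) a = measure_pmf.expectation C (indicator (fst -` {a}))"
      by (simp add: pmf_map)
    also have "\<dots> = (\<Sum>x\<in>V. if x = a then \<Sum>y\<in>V. c (x, y) else 0)"
      unfolding E by (intro sum.cong) (auto simp: indicator_def)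
    also have "\<dots> = pmf p a"
      using assms(1,2) r(2) by (auto simp: row p)
    finally show "pmf (map_pmf fst C) a = pmf p a" .
  qed
  moreover have "map_pmf snd C = q"
  proof (rule pmf_eqI)
    fix a
    have "pmf (map_pmf snd C) a = measure_pmf.expectation C (indicator (snd -` {a}))"
      by (simp add: pmf_map)
    also have "\<dots> = (\<Sum>y\<in>V. if y = a then \<Sum>x\<in>V. c (x, y) else 0)"
      unfolding E by (subst sum.swap, intro sum.cong) (auto simp: indicator_def)
    also have "\<dots> = pmf q a"
      using assms(1,3) r(2) by (auto simp: col q)
    finally show "pmf (map_pmf snd C) a = pmf q a" .
  qed
  ultimately have "C \<in> couplings p q"
    by (simp add: couplings_def)
  then have "W1_dist d p q \<le> measure_pmf.expectation C (\<lambda>(x, y). d x y)"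
    by (intro W1_dist_le d)
  also have "\<dots> = (\<Sum>x\<in>V. \<Sum>y\<in>V. (if x = y then d x x * r x else 0) + (if x = u then if y = v then d u v * \<eta> else 0 else 0))"
    unfolding E by (intro sum.cong) (auto simp: c_def algebra_simps)
  also have "\<dots> = (\<Sum>x\<in>V. if x = u then d u v * \<eta> else 0)"
    using assms(1,3) d(2) by (intro sum.cong) (auto simp: sum.distrib)
  also have "\<dots> = \<eta> * d u v"
    using assms(1,2) by simp
  finally show ?thesis .
qed

text \<open>The mass \<open>\<eta> x v\<close> added at each vertex \<open>v\<close> is taken away again at \<open>v0\<close>, so that all of
  \<open>\<int>\<^sup>V\<close> parametrises measures of total mass \<open>1\<close>, and the coordinate \<open>x v0\<close> has no effect.\<close>

definition weight :: "'v set \<Rightarrow> 'v \<Rightarrow> real \<Rightarrow> ('v \<Rightarrow> int) \<Rightarrow> 'v \<Rightarrow> real" where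
  "weight V v0 \<eta> x v = (if v \<in> V then 1 / real (card V)
     + \<eta> * (real_of_int (x v) - (if v = v0 then real_of_int (\<Sum>u\<in>V. x u) else 0)) else 0)"

definition lattice_pmf :: "'v set \<Rightarrow> 'v \<Rightarrow> real \<Rightarrow> ('v \<Rightarrow> int) \<Rightarrow> 'v pmf" where
  "lattice_pmf V v0 \<eta> x = embed_pmf (weight V v0 \<eta> x)"

lemma sum_weight: "finite V \<Longrightarrow> v0 \<in> V \<Longrightarrow> (\<Sum>v\<in>V. weight V v0 \<eta> x v) = 1"
  by (auto simp: weight_def sum.distrib sum_subtractf right_diff_distrib sum_distrib_left[symmetric])

lemma weight_unit_vec:
  assumes "finite V" "u \<in> V" "v0 \<in> V"
  shows "weight V v0 \<eta> (x + unit_vec u) v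
    = weight V v0 \<eta> x v - (if v = v0 then \<eta> else 0) + (if v = u then \<eta> else 0)"
proof -
  have "(\<Sum>w\<in>V. (x + unit_vec u) w) = (\<Sum>w\<in>V. x w) + 1"
    using assms by (simp add: sum.distrib unit_vec_def)
  then show ?thesis
    using assms by (auto simp: weight_def unit_vec_def algebra_simps simp del: of_int_sum)
qed

text \<open>The worst case is at \<open>v0\<close>, where one coordinate and the sum of all of them
  are subtracted; this explains the factor \<open>card V + 1\<close>. The slack \<open>c\<close>
  leaves mass that can still be moved.\<close>

lemma weight_ge:
  assumes "finite V" "v \<in> V" "\<eta> \<ge> 0" "\<eta> * (real (card V + 1) * real l + c) \<le> 1 / real (card V)" "bnd l x"
  shows "weight V v0 \<eta> x v \<ge> \<eta> * c"
proof -
  have x: "\<bar>real_of_int (x u)\<bar> \<le> real l" for u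
    using assms(5) by (metis bnd_def of_int_abs of_int_le_iff of_int_of_nat_eq)
  have "\<bar>real_of_int (\<Sum>u\<in>V. x u)\<bar> \<le> (\<Sum>u\<in>V. \<bar>real_of_int (x u)\<bar>)"
    unfolding of_int_sum by (rule sum_abs)
  also have "\<dots> \<le> real (card V) * real l"
    using x by (intro sum_bounded_above)
  finally have "- (real (card V + 1) * real l) \<le> real_of_int (x v) - (if v = v0 then real_of_int (\<Sum>u\<in>V. x u) else 0)"
    using x[of v] by (auto simp: distrib_right)
  then have "\<eta> * (- (real (card V + 1) * real l)) \<le> \<eta> * (real_of_int (x v) - (if v = v0 then real_of_int (\<Sum>u\<in>V. x u) else 0))"
    using \<open>\<eta> \<ge> 0\<close> by (rule mult_left_mono)
  then show ?thesis
    using assms(2,4) by (simp add: weight_def distrib_left del: of_int_sum)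
qed

text \<open>\<open>lattice_L1\<close> asks for a family on the whole lattice, but only points of a
  box yield nonnegative weights. Clamping extends the family without increasing its Lipschitz
  constant, since by \<open>clamp_unit_vec\<close> a unit step becomes the same step or
  none.\<close>

definition clamp :: "nat \<Rightarrow> ('v \<Rightarrow> int) \<Rightarrow> 'v \<Rightarrow> int" where
  "clamp l x = (\<lambda>v. max (- int l) (min (int l) (x v)))"

lemma bnd_clamp: "bnd l (clamp l x)"
  by (auto simp: bnd_def clamp_def)

lemma clamp_id: "bnd l x \<Longrightarrow> clamp l x = x"
proof
  fix v assume "bnd l x"
  then have "\<bar>x v\<bar> \<le> int l" by (simp add: bnd_def)
  then show "clamp l x v = x v" by (auto simp: clamp_def)
qed

lemma clamp_unit_vec: "clamp l (x + unit_vec u) = clamp l x \<or> clamp l (x + unit_vec u) = clamp l x + unit_vec u"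
proof (cases "- int l \<le> x u \<and> x u < int l")
  case True
  then have "clamp l (x + unit_vec u) = clamp l x + unit_vec u"
    by (auto simp: clamp_def unit_vec_def)
  then show ?thesis ..
next
  case False
  then have "clamp l (x + unit_vec u) = clamp l x"
    by (auto simp: clamp_def unit_vec_def)
  then show ?thesis ..
qed

lemma wasserstein_obstruction:
  fixes a :: "'i \<Rightarrow> 'v \<Rightarrow> int" and g :: "'i \<Rightarrow> 'v \<Rightarrow> real" and F :: "'v pmf \<Rightarrow> 'w \<Rightarrow> real"
  assumes "finite V" "v0 \<in> V" "finite I" "finite J" "\<kappa> \<ge> 0" "A \<ge> 0" "B > 0"
    and d: "\<And>x y. d x y \<ge> 0" "\<And>x. x \<in> V \<Longrightarrow> d x x = 0"
    and F: "\<And>p. p \<in> Wa1 V \<Longrightarrow> integrable M (F p)"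
      "\<And>p q. p \<in> Wa1 V \<Longrightarrow> q \<in> Wa1 V \<Longrightarrow> l1 M (\<lambda>\<omega>. F p \<omega> - F q \<omega>) \<le> A * W1_dist d p q"
      "\<And>p q. p \<in> Wa1 V \<Longrightarrow> q \<in> Wa1 V \<Longrightarrow> W1_dist d p q \<le> B * l1 M (\<lambda>\<omega>. F p \<omega> - F q \<omega>)"
    and a: "\<And>i v. i \<in> I \<Longrightarrow> v \<notin> V \<Longrightarrow> a i v = 0"
    and \<beta>: "\<And>i. i \<in> I \<Longrightarrow> \<beta> i \<ge> 0"
    and pq: "\<And>e. e \<in> J \<Longrightarrow> p e \<in> V \<and> q e \<in> V" "\<And>e. e \<in> J \<Longrightarrow> d (p e) (q e) \<le> 1"
    and key: "\<And>\<phi>. (\<Sum>i\<in>I. \<beta> i * \<bar>\<Sum>v\<in>V. real_of_int (a i v) * \<phi> v\<bar>) \<le> \<kappa> * (\<Sum>e\<in>J. \<bar>\<phi> (p e) - \<phi> (q e)\<bar>)"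
    and g: "\<And>i x y. i \<in> I \<Longrightarrow> x \<in> V \<Longrightarrow> y \<in> V \<Longrightarrow> g i x - g i y \<le> d x y" "\<And>i. i \<in> I \<Longrightarrow> g i v0 = 0"
  shows "(\<Sum>i\<in>I. \<beta> i * (\<Sum>v\<in>V. g i v * real_of_int (a i v))) \<le> \<kappa> * real (card J) * (A * B)"
proof -
  \<comment> \<open>A unit step along \<open>u\<close> transports mass from \<open>v0\<close> to
    \<open>u\<close>, so \<Delta> bounds the cost of every direction per unit of mass. It enters
    only the constant \<open>K\<close>, hence only the vanishing errors.\<close>
  define \<Delta> where "\<Delta> = (\<Sum>v\<in>V. d v v0)"
  define n where "n = real (card V)"
  have "n > 0"
    using assms(1,2) by (auto simp: n_def card_gt_0_iff)
  have "(\<Sum>i\<in>I. \<beta> i * (\<Sum>v\<in>V. g i v / B * real_of_int (a i v))) \<le> \<kappa> * (real (card J) * A)"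
  proof (rule lattice_obstruction[OF \<open>finite V\<close> \<open>finite I\<close> \<open>finite J\<close> \<open>\<kappa> \<ge> 0\<close> a \<beta> pq(1) key, where M = M and K = "A * \<Delta>"])
    fix L :: nat
    \<comment> \<open>One more than \<open>L\<close>, so that clamping also fixes the points one
      unit step beyond the box.\<close>
    define l where "l = Suc L"
    \<comment> \<open>The mesh is so fine that on the box of size \<open>l\<close> every weight is
      at least \<eta>; division by \<eta> in \<open>H\<close> restores the scale.\<close>
    define \<eta> where "\<eta> = 1 / (n * ((n + 1) * real l + 1))"
    define w where "w = weight V v0 \<eta>"
    define P where "P = lattice_pmf V v0 \<eta>"
    define H where "H x \<omega> = F (P (clamp l x)) \<omega> / \<eta>" for x \<omega>
    have \<eta>: "\<eta> > 0"
      using \<open>n > 0\<close> by (simp add: \<eta>_def add_nonneg_pos)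
    have small: "\<eta> * (real (card V + 1) * real l + 1) \<le> 1 / real (card V)"
      using \<open>n > 0\<close> by (simp add: \<eta>_def n_def[symmetric] divide_simps add_nonneg_pos add.commute)
    have wge: "w x v \<ge> \<eta>" if "bnd l x" "v \<in> V" for x v
      using weight_ge[OF \<open>finite V\<close> that(2) _ small that(1), of v0] \<eta> by (simp add: w_def)
    have wout: "w x v = 0" if "v \<notin> V" for x v
      using that by (simp add: w_def weight_def)
    have wunit: "w (x + unit_vec u) v = w x v - (if v = v0 then \<eta> else 0) + (if v = u then \<eta> else 0)" if "u \<in> V" for x u v
      unfolding w_def using \<open>finite V\<close> that \<open>v0 \<in> V\<close> by (rule weight_unit_vec)
    \<comment> \<open>The step may leave the box, but it removes at most \<eta>, and only at
      \<open>v0\<close>, where at least \<eta> is present.\<close>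
    have wunit_nonneg: "w (x + unit_vec u) v \<ge> 0" if "bnd l x" "u \<in> V" for x u v
      using wge[OF that(1), of v] wout[of v] wunit[OF that(2), of x v] \<eta> \<open>v0 \<in> V\<close> that
      by (cases "v \<in> V") (auto split: if_splits)
    have pmfP: "pmf (P x) v = w x v" if "\<And>v. w x v \<ge> 0" for x v
      unfolding P_def lattice_pmf_def w_def[symmetric]
    proof (rule pmf_embed_finite[OF \<open>finite V\<close>])
      show "sum (w x) V = 1"
        unfolding w_def by (rule sum_weight) fact+
    qed (use that wout in auto)
    have wnonneg: "w x v \<ge> 0" if "bnd l x" for x v
      using wge[OF that, of v] wout[of v] \<eta> by (cases "v \<in> V") auto
    have P_Wa1: "P x \<in> Wa1 V" if "\<And>v. w x v \<ge> 0" for x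
      using pmfP[OF that] wout by (intro Wa1I) auto
    have move: "W1_dist d (P (x + unit_vec u)) (P (x + unit_vec v)) \<le> \<eta> * d u v"
      if x: "bnd l x" and uv: "u \<in> V" "v \<in> V" for x u v
    proof (rule W1_dist_move[OF \<open>finite V\<close> uv less_imp_le[OF \<eta>] d])
      \<comment> \<open>The common part of the two measures: the mass \<eta> is taken from
        \<open>v0\<close> once and then placed at \<open>u\<close> or at \<open>v\<close>.\<close>
      show "0 \<le> w x z - (if z = v0 then \<eta> else 0)" for z
        using wge[OF x, of z] wnonneg[OF x, of z] \<open>v0 \<in> V\<close> by auto
      show "w x z - (if z = v0 then \<eta> else 0) = 0" if "z \<notin> V" for z
        using that wout \<open>v0 \<in> V\<close> by auto
    qed (use x uv wunit wunit_nonneg in \<open>simp_all add: pmfP\<close>)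
    have H_diff: "l1 M (\<lambda>\<omega>. H x \<omega> - H y \<omega>) = l1 M (\<lambda>\<omega>. F (P (clamp l x)) \<omega> - F (P (clamp l y)) \<omega>) / \<eta>" for x y
      using \<eta> unfolding H_def diff_divide_distrib[symmetric] l1_divide by simp
    have H_move: "l1 M (\<lambda>\<omega>. F (P (x + unit_vec u)) \<omega> - F (P (x + unit_vec v)) \<omega>) / \<eta> \<le> A * d u v"
      if x: "bnd l x" and uv: "u \<in> V" "v \<in> V" for x u v
    proof -
      have "l1 M (\<lambda>\<omega>. F (P (x + unit_vec u)) \<omega> - F (P (x + unit_vec v)) \<omega>)
          \<le> A * W1_dist d (P (x + unit_vec u)) (P (x + unit_vec v))"
        using x uv wunit_nonneg by (intro F P_Wa1)
      also have "\<dots> \<le> A * (\<eta> * d u v)"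
        using move[OF x uv] \<open>A \<ge> 0\<close> by (rule mult_left_mono)
      finally show ?thesis
        using \<eta> by (simp add: divide_le_eq mult_ac)
    qed
    \<comment> \<open>This makes the step from \<open>x\<close> to \<open>x + unit_vec u\<close> a
      transport from \<open>v0\<close> to \<open>u\<close>, an instance of
      \<open>H_move\<close>.\<close>
    have P_v0: "P (x + unit_vec v0) = P x" for x
    proof -
      have "w (x + unit_vec v0) = w x"
        using wunit[OF \<open>v0 \<in> V\<close>] by auto
      then show ?thesis
        by (simp add: P_def lattice_pmf_def w_def)
    qed
    have \<Delta>: "d u v0 \<le> \<Delta>" if "u \<in> V" for u
      unfolding \<Delta>_def using that \<open>finite V\<close> d by (intro member_le_sum) auto
    show "\<exists>H. lattice_L1 M V H (A * \<Delta>) \<and>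
      (\<forall>x e. bnd L x \<longrightarrow> e \<in> J \<longrightarrow> l1 M (\<lambda>\<omega>. H (x + unit_vec (p e)) \<omega> - H (x + unit_vec (q e)) \<omega>) \<le> A) \<and>
      (\<forall>x y i. bnd L x \<longrightarrow> bnd L y \<longrightarrow> i \<in> I \<longrightarrow>
        (\<Sum>v\<in>V. g i v / B * real_of_int (x v - y v)) \<le> l1 M (\<lambda>\<omega>. H x \<omega> - H y \<omega>))"
    proof (intro exI[of _ H] conjI allI impI)
      show "lattice_L1 M V H (A * \<Delta>)"
      proof
        show "integrable M (H x)" for x
          unfolding H_def by (intro integrable_divide F P_Wa1 wnonneg bnd_clamp)
      next
        fix x u assume u: "u \<in> V"
        show "l1 M (\<lambda>\<omega>. H (x + unit_vec u) \<omega> - H x \<omega>) \<le> A * \<Delta>"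
          using clamp_unit_vec[of l x u]
        proof
          assume "clamp l (x + unit_vec u) = clamp l x"
          then show ?thesis
            using \<open>A \<ge> 0\<close> \<Delta>[OF u] d(1)[of u v0] by (simp add: H_def l1_def)
        next
          assume *: "clamp l (x + unit_vec u) = clamp l x + unit_vec u"
          have "l1 M (\<lambda>\<omega>. H (x + unit_vec u) \<omega> - H x \<omega>) \<le> A * d u v0"
            unfolding H_diff * using H_move[OF bnd_clamp u \<open>v0 \<in> V\<close>, of x] by (simp only: P_v0)
          also have "\<dots> \<le> A * \<Delta>"
            using \<Delta>[OF u] \<open>A \<ge> 0\<close> by (rule mult_left_mono)
          finally show ?thesis .
        qed
      qed (rule \<open>finite V\<close>)
    next
      fix x :: "'v \<Rightarrow> int" and e assume x: "bnd L x" and e: "e \<in> J"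
      have unit: "bnd l (x + unit_vec u)" for u
        using bnd_add[OF x, of "Suc 0" "unit_vec u"] by (simp add: l_def bnd_def unit_vec_def)
      have xl: "bnd l x"
        using x by (rule bnd_mono) (simp add: l_def)
      have "l1 M (\<lambda>\<omega>. H (x + unit_vec (p e)) \<omega> - H (x + unit_vec (q e)) \<omega>) \<le> A * d (p e) (q e)"
        unfolding H_diff using H_move[OF xl, of "p e" "q e"] pq(1)[OF e] unit by (simp add: clamp_id)
      also have "\<dots> \<le> A * 1"
        using pq(2)[OF e] \<open>A \<ge> 0\<close> by (rule mult_left_mono)
      finally show "l1 M (\<lambda>\<omega>. H (x + unit_vec (p e)) \<omega> - H (x + unit_vec (q e)) \<omega>) \<le> A" by simp
    next
      fix x y :: "'v \<Rightarrow> int" and i assume x: "bnd L x" and y: "bnd L y" and i: "i \<in> I"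
      have xl: "bnd l x" "bnd l y"
        using x y by (auto elim!: bnd_mono simp: l_def)
      \<comment> \<open>Since \<open>g i\<close> vanishes at \<open>v0\<close>, the compensating
        mass there is not seen.\<close>
      have "(\<Sum>v\<in>V. g i v * (w x v - w y v)) = (\<Sum>v\<in>V. \<eta> * (g i v * real_of_int (x v - y v)))"
        using g(2)[OF i] by (intro sum.cong) (auto simp: w_def weight_def algebra_simps)
      then have "\<eta> * (\<Sum>v\<in>V. g i v * real_of_int (x v - y v)) = (\<Sum>v\<in>V. g i v * (w x v - w y v))"
        by (simp add: sum_distrib_left)
      also have "\<dots> = (\<Sum>v\<in>V. g i v * (pmf (P x) v - pmf (P y) v))"
        using xl wnonneg by (simp add: pmfP)
      also have "\<dots> \<le> W1_dist d (P x) (P y)"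
        using \<open>finite V\<close> xl wnonneg g(1) i by (intro W1_dist_ge P_Wa1)
      also have "\<dots> \<le> B * l1 M (\<lambda>\<omega>. F (P x) \<omega> - F (P y) \<omega>)"
        using xl wnonneg by (intro F P_Wa1)
      also have "\<dots> = B * (\<eta> * l1 M (\<lambda>\<omega>. H x \<omega> - H y \<omega>))"
        unfolding H_diff using \<eta> xl by (simp add: clamp_id)
      finally have "(\<Sum>v\<in>V. g i v * real_of_int (x v - y v)) \<le> B * l1 M (\<lambda>\<omega>. H x \<omega> - H y \<omega>)"
        using \<eta> by (simp add: mult.left_commute[of B])
      then show "(\<Sum>v\<in>V. g i v / B * real_of_int (x v - y v)) \<le> l1 M (\<lambda>\<omega>. H x \<omega> - H y \<omega>)"
        using \<open>B > 0\<close> by (simp add: sum_divide_distrib[symmetric] divide_le_eq mult.commute)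
    qed
  qed
  moreover have "(\<Sum>i\<in>I. \<beta> i * (\<Sum>v\<in>V. g i v / B * real_of_int (a i v)))
      = (\<Sum>i\<in>I. \<beta> i * (\<Sum>v\<in>V. g i v * real_of_int (a i v))) / B"
    by (simp add: sum_divide_distrib sum_distrib_left)
  ultimately show ?thesis
    using \<open>B > 0\<close> by (simp add: divide_le_eq mult.assoc)
qed

section \<open>Powers of the diamond graph in terms of words\<close>

lemma image_Times_image:
  "(\<lambda>(e, u). f e u) ` (F ` A \<times> G ` B) = (\<lambda>(a, b). f (F a) (G b)) ` (A \<times> B)"
  by force

context diamond_words
begin

definition nodes :: "nat \<Rightarrow> vert set" where
  "nodes n = lo ` words n \<union> hi ` words n"

lemma finite_nodes [simp]: "finite (nodes n)"
  by (simp add: nodes_def)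

lemma card_nodes: "card (nodes n) \<le> 2 * (k ^ n) ^ 2"
proof -
  have "card (nodes n) \<le> card (lo ` words n) + card (hi ` words n)"
    unfolding nodes_def by (rule card_Un_le)
  also have "\<dots> \<le> card (words n) + card (words n)"
    by (intro add_mono card_image_le) auto
  finally show ?thesis by (simp add: card_words)
qed

lemma nodes_0: "nodes 0 = {Src, Snk}"
  by (auto simp: nodes_def)

lemma nodes_Suc_pt: "nodes (Suc n) = (\<lambda>(w, i, b). pt w i b) ` (words n \<times> {..k} \<times> {1..k})"
proof (intro equalityI subsetI)
  fix x assume "x \<in> nodes (Suc n)"
  then obtain i b w where *: "i < k" "b \<in> {1..k}" "w \<in> words n" "x = pt w i b \<or> x = pt w (Suc i) b"
    unfolding nodes_def words_Suc by (auto simp: sym_def lo_Cons hi_Cons)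
  have mem: "pt w l b \<in> (\<lambda>(w, i, b). pt w i b) ` (words n \<times> {..k} \<times> {1..k})" if "l \<le> k" for l
    using * that by (intro image_eqI[of _ _ "(w, l, b)"]) auto
  show "x \<in> (\<lambda>(w, i, b). pt w i b) ` (words n \<times> {..k} \<times> {1..k})"
    using *(4) mem[OF less_imp_le[OF *(1)]] mem[OF Suc_leI[OF *(1)]] by (elim disjE) (simp_all only:)
next
  fix x assume "x \<in> (\<lambda>(w, i, b). pt w i b) ` (words n \<times> {..k} \<times> {1..k})"
  then obtain w i b where *: "w \<in> words n" "i \<le> k" "b \<in> {1..k}" "x = pt w i b"
    by auto
  show "x \<in> nodes (Suc n)"
  proof (cases "i = k")
    case True
    then have "(k - 1, b) # w \<in> words (Suc n)" "x = hi ((k - 1, b) # w)"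
      using * k2 by (auto simp: words_def sym_def hi_Cons)
    then show ?thesis by (auto simp: nodes_def)
  next
    case False
    then have "(i, b) # w \<in> words (Suc n)" "x = lo ((i, b) # w)"
      using * by (auto simp: words_def sym_def lo_Cons)
    then show ?thesis by (auto simp: nodes_def)
  qed
qed

definition mids :: "nat \<Rightarrow> vert set" where
  "mids n = (\<lambda>(w, i, b). Mid w i b) ` (words n \<times> {0<..<k} \<times> {1..k})"

lemma pt_nodes: "w \<in> words n \<Longrightarrow> i \<le> k \<Longrightarrow> b \<in> {1..k} \<Longrightarrow> pt w i b \<in> nodes (Suc n)"
  unfolding nodes_Suc_pt by (rule image_eqI[of _ _ "(w, i, b)"]) auto

lemma Mid_mids: "w \<in> words n \<Longrightarrow> 0 < i \<Longrightarrow> i < k \<Longrightarrow> b \<in> {1..k} \<Longrightarrow> Mid w i b \<in> mids n"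
  unfolding mids_def by (rule image_eqI[of _ _ "(w, i, b)"]) auto

lemma nodes_Suc: "nodes (Suc n) = nodes n \<union> mids n"
proof (intro equalityI subsetI)
  fix x assume "x \<in> nodes (Suc n)"
  then obtain w i b where "w \<in> words n" "i \<le> k" "b \<in> {1..k}" "x = pt w i b"
    unfolding nodes_Suc_pt by auto
  then show "x \<in> nodes n \<union> mids n"
    by (auto simp: pt_def nodes_def intro: Mid_mids)
next
  fix x assume "x \<in> nodes n \<union> mids n"
  then show "x \<in> nodes (Suc n)"
  proof
    assume "x \<in> nodes n"
    then obtain w where "w \<in> words n" "x = lo w \<or> x = hi w"
      by (auto simp: nodes_def)
    then show ?thesis
      using pt_nodes[of w n 0 1] pt_nodes[of w n k 1] k2 by auto
  next
    assume "x \<in> mids n"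
    then obtain w i b where "w \<in> words n" "0 < i" "i < k" "b \<in> {1..k}" "x = Mid w i b"
      by (auto simp: mids_def)
    then show ?thesis
      using pt_nodes[of w n i b] by (simp add: pt_def)
  qed
qed

lemma Src_Snk_nodes: "Src \<in> nodes n" "Snk \<in> nodes n"
  by (induction n) (auto simp: nodes_0 nodes_Suc)

lemma Mid_nodes: "Mid w i b \<in> nodes n \<Longrightarrow> length w < n"
  by (induction n) (auto simp: nodes_0 nodes_Suc mids_def words_def)

lemma ends_nodes: "w \<in> words n \<Longrightarrow> lo w \<in> nodes n" "w \<in> words n \<Longrightarrow> hi w \<in> nodes n"
  by (auto simp: nodes_def)

text \<open>As \<open>k\<close> is at least 2, every edge of the last level has an end in the
  interior of its branch, and \<open>Mid\<close> records the parent word, the branch and the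
  position. Edges are pairs of vertices in the graphs, so this is what lets words name them.\<close>

lemma lo_hi_inj:
  assumes "w \<in> words n" "w' \<in> words n" "lo w = lo w'" "hi w = hi w'"
  shows "w = w'"
proof (cases n)
  case 0
  then show ?thesis using assms by simp
next
  case (Suc m)
  obtain i b v i' b' v' where w: "w = (i, b) # v" "w' = (i', b') # v'" "v \<in> words m" "v' \<in> words m"
    "i < k" "i' < k"
    using assms(1,2) unfolding Suc words_Suc by (auto simp: sym_def)
  have short: "lo v \<noteq> Mid u j c" "hi v \<noteq> Mid u j c" "lo v' \<noteq> Mid u j c" "hi v' \<noteq> Mid u j c"
    if "length u = m" for u j c
    using that ends_nodes[OF w(3)] ends_nodes[OF w(4)] Mid_nodes[of u j c m] by auto
  have len: "length v = m" "length v' = m"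
    using w by (auto simp: words_def)
  show ?thesis
  proof (cases "Suc i < k")
    case True
    then show ?thesis
    proof -
      have "hi w = Mid v (Suc i) b"
        using True by (simp add: w(1) hi.simps)
      moreover have "hi w' = (if Suc i' = k then hi v' else Mid v' (Suc i') b')"
        by (simp add: w(2) hi.simps)
      ultimately have "Mid v (Suc i) b = Mid v' (Suc i') b'"
        using assms(4) short(4)[OF len(1), of "Suc i" b] by metis
      then show ?thesis
        by (simp add: w(1,2))
    qed
  next
    case False
    then have "i \<noteq> 0" using k2 w(5) by auto
    then show ?thesis
    proof -
      have "lo w = Mid v i b"
        using \<open>i \<noteq> 0\<close> by (simp add: w(1) lo.simps)
      moreover have "lo w' = (if i' = 0 then lo v' else Mid v' i' b')"
        by (simp add: w(2) lo.simps)
      ultimately have "Mid v i b = Mid v' i' b'"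
        using assms(3) short(3)[OF len(1), of i b] by metis
      then show ?thesis
        by (simp add: w(1,2))
    qed
  qed
qed

text \<open>The vertex type of \<open>G\<close> stays free because every product changes it; the
  labelling \<open>h\<close> absorbs the quotient classes as well as the renumbering.\<close>

definition words_graph :: "nat \<Rightarrow> 'a pair_pre_digraph \<Rightarrow> (vert \<Rightarrow> 'a) \<Rightarrow> bool" where
  "words_graph n G h \<longleftrightarrow> inj_on h (nodes n) \<and> pverts G = h ` nodes n \<and>
    parcs G = (\<lambda>w. (h (lo w), h (hi w))) ` words n"

section \<open>The diamond and its products as word graphs\<close>

abbreviation D :: "(real \<times> nat) set st_graph" where "D \<equiv> diamond k k"

definition dv :: "nat \<Rightarrow> nat \<Rightarrow> (real \<times> nat) set" where
  "dv i b = diamond_rel k k `` {(real i / real k, b)}"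

lemma path_vertex: "i \<le> k \<Longrightarrow> real i / real k \<in> pverts (path_graph k)"
  by (auto simp: path_graph_def)

lemma dv_eq_iff:
  assumes "i \<le> k" "i' \<le> k" "b \<in> {1..k}" "b' \<in> {1..k}"
  shows "dv i b = dv i' b' \<longleftrightarrow> i = i' \<and> (b = b' \<or> i = 0 \<or> i = k)"
proof -
  have "dv i b = dv i' b' \<longleftrightarrow> ((real i / real k, b), (real i' / real k, b')) \<in> diamond_rel k k"
    unfolding dv_def using assms path_vertex
    by (intro eq_equiv_class_iff[OF equiv_diamond_rel]) auto
  then show ?thesis
    using assms path_vertex k2 by (auto simp: diamond_rel_def)
qed

lemma source_D: "source D = dv 0 1" and sink_D: "sink D = dv k 1"
  using k2 by (simp_all add: diamond_def dv_def)

lemma vertices_D: "vertices D = (\<lambda>(i, b). dv i b) ` ({..k} \<times> {1..k})"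
  by (auto simp: diamond_def dv_def path_graph_def quotient_def atLeast0AtMost)

lemma edges_D: "edges D = (\<lambda>(i, b). (dv i b, dv (Suc i) b)) ` sym"
proof -
  have "(\<lambda>i. ((real i - 1) / real k, real i / real k)) ` {1..k}
      = (\<lambda>i. (real i / real k, real (Suc i) / real k)) ` {..<k}"
    unfolding image_Suc_lessThan[symmetric] image_image by simp
  then have "edges D = (\<lambda>(e, i). (diamond_rel k k `` {(fst e, i)}, diamond_rel k k `` {(snd e, i)}))
      ` ((\<lambda>i. (real i / real k, real (Suc i) / real k)) ` {..<k} \<times> (\<lambda>i. i) ` {1..k})"
    by (simp add: diamond_def path_graph_def)
  then show ?thesis
    unfolding image_Times_image by (simp add: dv_def sym_def)
qed

lemma words_graph_diamond: "\<exists>h. words_graph (Suc 0) (digraph_of D) h"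
proof -
  define h where "h x = (case x of Src \<Rightarrow> dv 0 1 | Snk \<Rightarrow> dv k 1 | Mid w i b \<Rightarrow> dv i b)" for x
  have one: "1 \<in> {1..k}" using k2 by auto
  have h: "h (pt [] i b) = dv i b" if "i \<le> k" "b \<in> {1..k}" for i b
    using that one k2 dv_eq_iff[of 0 0 1 b] dv_eq_iff[of k k 1 b] by (auto simp: h_def pt_def)
  have "inj_on h (nodes (Suc 0))"
    using one k2 unfolding nodes_Suc nodes_0 mids_def
    by (auto simp: inj_on_def h_def dv_eq_iff)
  moreover have "pverts (digraph_of D) = h ` nodes (Suc 0)"
  proof -
    have eq: "(\<lambda>(w, i, b). pt w i b) ` (words 0 \<times> {..k} \<times> {1..k}) = (\<lambda>(i, b). pt [] i b) ` ({..k} \<times> {1..k})"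
      by force
    show ?thesis
      unfolding vertices_D nodes_Suc_pt eq image_image using h by (intro image_cong) auto
  qed
  moreover have "parcs (digraph_of D) = (\<lambda>w. (h (lo w), h (hi w))) ` words (Suc 0)"
  proof -
    have "words (Suc 0) = (\<lambda>c. [c]) ` sym"
      by (force simp: words_Suc)
    then show ?thesis
      unfolding edges_D by (simp add: image_image) (auto simp: sym_def lo_Cons hi_Cons h intro!: image_cong)
  qed
  ultimately show ?thesis
    unfolding words_graph_def by blast
qed

text \<open>The edges of \<open>H\<close> are replaced by diamonds, so the product adds the finest
  level, which is the letter at the head of a word.\<close>

lemma words_graph_oslash:
  assumes "words_graph n H h"
  shows "\<exists>h'. words_graph (Suc n) (oslash H D) h'"
proof -
  define e where "e w = (h (lo w), h (hi w))" for w
  have inj: "inj_on h (nodes n)" and V: "pverts H = h ` nodes n" and E: "parcs H = e ` words n"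
    using assms by (auto simp: words_graph_def e_def)
  have one: "1 \<in> {1..k}" using k2 by auto
  have st: "source D \<in> vertices D" "sink D \<in> vertices D" "source D \<noteq> sink D"
    using one k2 unfolding source_D sink_D vertices_D by (force simp: dv_eq_iff)+
  have inj_e: "w = w'" if "w \<in> words n" "w' \<in> words n" "e w = e w'" for w w'
    using that inj ends_nodes by (intro lo_hi_inj) (auto simp: e_def inj_on_def)
  \<comment> \<open>An old vertex becomes the class that collects all its occurrences as an endpoint
    of an edge of \<open>H\<close>; a new interior vertex, recognised by
    \<open>length w = n\<close>, is a class by itself.\<close>
  define h' where "h' x = (case x of Mid w i b \<Rightarrow> if length w = n then {(e w, dv i b)} else oslash_incl H D (h x)
      | _ \<Rightarrow> oslash_incl H D (h x))" for x
  have old: "h' x = oslash_incl H D (h x)" if "x \<in> nodes n" for x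
    using that Mid_nodes by (force simp: h'_def split: vert.split)
  have mid: "dv i b \<notin> {source D, sink D}" if "0 < i" "i < k" "b \<in> {1..k}" for i b
    using that one by (auto simp: source_D sink_D dv_eq_iff)
  have vert: "oslash_vertex H D (e w) (dv i b) = h' (pt w i b)" if "w \<in> words n" "i \<le> k" "b \<in> {1..k}" for w i b
  proof -
    have ew: "e w \<in> parcs H" using that E by auto
    consider "i = 0" | "i = k" | "0 < i" "i < k" using \<open>i \<le> k\<close> by linarith
    then show ?thesis
    proof cases
      case 1
      then have "dv i b = source D"
        unfolding source_D using that one by (simp add: dv_eq_iff)
      then show ?thesis
        using oslash_vertex_source[OF ew st(1,2)] 1 that by (simp add: old ends_nodes e_def)
    next
      case 2
      then have "dv i b = sink D"
        unfolding sink_D using that one by (simp add: dv_eq_iff)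
      then show ?thesis
        using oslash_vertex_sink[OF ew st] 2 that by (simp add: old ends_nodes e_def)
    next
      case 3
      have "dv i b \<in> vertices D"
        using that by (auto simp: vertices_D)
      then have "oslash_vertex H D (e w) (dv i b) = {(e w, dv i b)}"
        using mid[OF 3] that ew by (auto simp: oslash_vertex_def oslash_rel_def)
      then show ?thesis
        using 3 that by (simp add: h'_def pt_def words_def)
    qed
  qed
  have incl: "\<exists>c. c \<in> oslash_incl H D (h x)" if x: "x \<in> nodes n" for x
  proof -
    from x obtain w where w: "w \<in> words n" "x = lo w \<or> x = hi w"
      by (auto simp: nodes_def)
    then have "(e w, source D) \<in> oslash_incl H D (h x) \<or> (e w, sink D) \<in> oslash_incl H D (h x)"
      using E st(3) by (auto simp: oslash_incl_def endpoint_def e_def)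
    then show ?thesis by blast
  qed
  have inj_old: "x = y" if xy: "x \<in> nodes n" "y \<in> nodes n" "oslash_incl H D (h x) = oslash_incl H D (h y)" for x y
  proof -
    obtain c where "c \<in> oslash_incl H D (h x)" "c \<in> oslash_incl H D (h y)"
      using incl[OF xy(1)] xy(3) by auto
    then have "h x = h y"
      by (auto simp: oslash_incl_def)
    then show ?thesis using inj that by (auto simp: inj_on_def)
  qed
  have old_new: False if x: "x \<in> nodes n" and y: "y \<in> mids n" "h' x = h' y" for x y
  proof -
    obtain w i b where y': "y = Mid w i b" "w \<in> words n" "0 < i" "i < k" "b \<in> {1..k}"
      using y by (auto simp: mids_def)
    then have "(e w, dv i b) \<in> oslash_incl H D (h x)"
      using y(2) old[OF x] by (auto simp: h'_def words_def)
    then show False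
      using mid[OF y'(3-5)] by (auto simp: oslash_incl_def)
  qed
  have new_new: "x = y" if x: "x \<in> mids n" and y: "y \<in> mids n" and eq: "h' x = h' y" for x y
  proof -
    obtain w i b where x': "x = Mid w i b" "w \<in> words n" "0 < i" "i < k" "b \<in> {1..k}"
      using x by (auto simp: mids_def)
    obtain w' i' b' where y': "y = Mid w' i' b'" "w' \<in> words n" "0 < i'" "i' < k" "b' \<in> {1..k}"
      using y by (auto simp: mids_def)
    have "e w = e w'" "dv i b = dv i' b'"
      using eq x' y' by (auto simp: h'_def words_def)
    then show ?thesis
      using inj_e x' y' by (simp add: dv_eq_iff)
  qed
  have "inj_on h' (nodes (Suc n))"
  proof (rule inj_onI)
    fix x y assume "x \<in> nodes (Suc n)" "y \<in> nodes (Suc n)" "h' x = h' y"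
    then show "x = y"
      unfolding nodes_Suc using inj_old[of x y] old[of x] old[of y] old_new[of x y] old_new[of y x] new_new[of x y]
      by auto
  qed
  moreover have "pverts (oslash H D) = h' ` nodes (Suc n)"
  proof -
    have "pverts (oslash H D) = (\<lambda>(e, u). oslash_vertex H D e u) ` (parcs H \<times> vertices D)"
      by (auto simp: oslash_def quotient_def oslash_vertex_def)
    also have "\<dots> = (\<lambda>(w, i, b). oslash_vertex H D (e w) (dv i b)) ` (words n \<times> {..k} \<times> {1..k})"
      unfolding E vertices_D image_Times_image by (intro image_cong) auto
    also have "\<dots> = h' ` nodes (Suc n)"
      unfolding nodes_Suc_pt image_image using vert by (intro image_cong) auto
    finally show ?thesis .
  qed
  moreover have "parcs (oslash H D) = (\<lambda>w. (h' (lo w), h' (hi w))) ` words (Suc n)"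
  proof -
    have "parcs (oslash H D) = (\<lambda>(e, f). (oslash_vertex H D e (fst f), oslash_vertex H D e (snd f))) ` (parcs H \<times> edges D)"
      by (simp add: oslash_def)
    also have "\<dots> = (\<lambda>(w, c). (oslash_vertex H D (e w) (dv (fst c) (snd c)), oslash_vertex H D (e w) (dv (Suc (fst c)) (snd c))))
        ` (words n \<times> sym)"
      unfolding E edges_D image_Times_image by (intro image_cong) auto
    also have "\<dots> = (\<lambda>(w, c). (h' (lo (c # w)), h' (hi (c # w)))) ` (words n \<times> sym)"
      using vert by (intro image_cong) (auto simp: sym_def lo_Cons hi_Cons)
    also have "\<dots> = (\<lambda>w. (h' (lo w), h' (hi w))) ` words (Suc n)"
      unfolding words_Suc image_image product_swap[symmetric, of "words n"] by (intro image_cong) auto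
    finally show ?thesis .
  qed
  ultimately show ?thesis
    unfolding words_graph_def by blast
qed

lemma words_graph_nat_copy:
  assumes "words_graph n (digraph_of G) h"
  shows "\<exists>h'. words_graph n (digraph_of (nat_copy G)) h'"
proof -
  define t where "t = to_nat_on (vertices G)"
  have V: "vertices G = h ` nodes n" and inj: "inj_on h (nodes n)"
    using assms by (auto simp: words_graph_def)
  have "inj_on t (h ` nodes n)"
    unfolding t_def V by (intro inj_on_to_nat_on countable_finite) simp
  then have "inj_on (t \<circ> h) (nodes n)"
    using inj by (intro comp_inj_on)
  moreover have "vertices (nat_copy G) = (t \<circ> h) ` nodes n"
    unfolding image_comp[symmetric] V[symmetric] by (simp add: nat_copy_def Let_def t_def)
  moreover have "edges (nat_copy G) = (\<lambda>w. ((t \<circ> h) (lo w), (t \<circ> h) (hi w))) ` words n"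
  proof -
    have "edges (nat_copy G) = map_prod t t ` edges G"
      by (simp add: nat_copy_def Let_def t_def)
    then show ?thesis
      using assms by (simp add: words_graph_def image_image)
  qed
  ultimately show ?thesis
    unfolding words_graph_def by blast
qed

lemma words_graph_power: "\<exists>h. words_graph (Suc n) (digraph_of (oslash_power D (Suc n))) h"
proof (induction n)
  case 0
  obtain h where "words_graph (Suc 0) (digraph_of D) h"
    using words_graph_diamond by blast
  from words_graph_nat_copy[OF this] show ?case
    by (simp add: oslash_power_def)
next
  case (Suc n)
  then obtain h where "words_graph (Suc n) (digraph_of (oslash_power D (Suc n))) h"
    by blast
  from words_graph_oslash[OF this] obtain h'
    where "words_graph (Suc (Suc n)) (digraph_of (st_oslash (oslash_power D (Suc n)) D)) h'"
    by (auto simp: st_oslash_def)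
  from words_graph_nat_copy[OF this] show ?case
    by (subst oslash_power_Suc) auto
qed

text \<open>Connectedness as an induction rule. Membership of the two ends agrees on the finest
  edges, hence on all coarser ones by following branch 1 upwards through the levels; starting from
  \<open>Src\<close> it then spreads down to every vertex.\<close>

lemma nodes_induct:
  assumes "Src \<in> C" and C: "\<And>w. w \<in> words n \<Longrightarrow> lo w \<in> C \<longleftrightarrow> hi w \<in> C"
  shows "nodes n \<subseteq> C"
proof -
  have iff: "lo w \<in> C \<longleftrightarrow> hi w \<in> C" if "w \<in> words j" "j \<le> n" for w j
    using that(2,1)
  proof (induction j arbitrary: w rule: inc_induct)
    case base
    then show ?case by (rule C)
  next
    case (step j)
    have "pt w i 1 \<in> C \<longleftrightarrow> lo w \<in> C" if "i \<le> k" for i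
      using that
    proof (induction i)
      case (Suc i)
      have "(i, 1) # w \<in> words (Suc j)"
        using Suc.prems step.prems by (auto simp: words_def sym_def)
      from step.IH[OF this] show ?case
        using Suc by (simp add: lo_Cons hi_Cons)
    qed simp
    from this[of k] show ?case by simp
  qed
  have "lo w \<in> C \<and> hi w \<in> C" if "w \<in> words j" "j \<le> n" for w j
    using that
  proof (induction j arbitrary: w)
    case 0
    then show ?case using iff[of "[]" 0] \<open>Src \<in> C\<close> by auto
  next
    case (Suc j)
    then obtain i b v where w: "w = (i, b) # v" "v \<in> words j" "i < k" "b \<in> {1..k}"
      unfolding words_Suc by (auto simp: sym_def)
    have "pt v l b \<in> C" if "l \<le> k" for l
      using that
    proof (induction l)
      case 0
      then show ?case using Suc.IH[OF w(2)] Suc.prems by simp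
    next
      case (Suc l)
      have "(l, b) # v \<in> words (Suc j)"
        using Suc.prems w by (auto simp: words_def sym_def)
      from iff[OF this \<open>Suc j \<le> n\<close>] show ?case
        using Suc by (simp add: lo_Cons hi_Cons)
    qed
    from this[of i] this[of "Suc i"] show ?case
      using w by (simp add: lo_Cons hi_Cons)
  qed
  then show ?thesis
    by (auto simp: nodes_def)
qed

end

section \<open>The shortest path metric and the lower bound\<close>

locale sym_graph =
  fixes G :: "'a pair_pre_digraph"
  assumes wf: "parcs G \<subseteq> pverts G \<times> pverts G"
begin

definition S :: "('a, 'a \<times> 'a) pre_digraph" where
  "S = with_proj (mk_symmetric (with_proj G))"

lemma verts_S [simp]: "verts S = pverts G"
  by (simp add: S_def)

lemma arcs_S: "arcs S = parcs G \<union> prod.swap ` parcs G"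
  by (force simp: S_def mk_symmetric_def)

lemma tail_S [simp]: "tail S = fst" and head_S [simp]: "head S = snd"
  by (simp_all add: S_def)

sublocale S: wf_digraph S
  by standard (use wf arcs_S in auto)

lemma graph_dist_eq: "graph_dist G u v = real_of_ereal (S.\<mu> (\<lambda>_. 1) u v)"
  by (simp add: graph_dist_def S_def)

lemma mu_nonneg: "S.\<mu> (\<lambda>_. 1) u v \<ge> 0"
  unfolding S.\<mu>_def by (rule INF_greatest) (auto intro!: S.pos_cost_pos_awalk_cost)

lemma graph_dist_nonneg: "graph_dist G u v \<ge> 0"
  unfolding graph_dist_eq using mu_nonneg by (rule real_of_ereal_pos)

lemma graph_dist_le:
  assumes "S.awalk u p v"
  shows "graph_dist G u v \<le> S.awalk_cost (\<lambda>_. 1) p"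
  unfolding graph_dist_eq using S.min_cost_le_walk_cost[OF assms, of "\<lambda>_. 1"] mu_nonneg[of u v]
  by (cases "S.\<mu> (\<lambda>_. 1) u v") auto

lemma graph_dist_self: "v \<in> pverts G \<Longrightarrow> graph_dist G v v = 0"
  using graph_dist_le[of v "[]" v] graph_dist_nonneg[of v v] by (simp add: S.awalk_Nil_iff)

lemma awalk_arc: "(u, v) \<in> arcs S \<Longrightarrow> S.awalk u [(u, v)] v"
  using S.arc_implies_awalk[of "(u, v)"] by simp

lemma graph_dist_arc:
  assumes "(u, v) \<in> arcs S"
  shows "graph_dist G u v \<le> 1"
  using graph_dist_le[OF awalk_arc[OF assms]] by simp

lemma awalk_lipschitz:
  fixes f :: "'a \<Rightarrow> real"
  assumes f: "\<And>u v. (u, v) \<in> parcs G \<Longrightarrow> \<bar>f v - f u\<bar> \<le> 1"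
  shows "S.awalk u p v \<Longrightarrow> f u - f v \<le> S.awalk_cost (\<lambda>_. 1) p"
proof (induction p arbitrary: u)
  case Nil
  then show ?case by (simp add: S.awalk_Nil_iff)
next
  case (Cons e p)
  then have e: "e \<in> arcs S" "u = fst e" "S.awalk (snd e) p v"
    by (auto simp: S.awalk_Cons_iff)
  have "\<bar>f (snd e) - f (fst e)\<bar> \<le> 1"
  proof (cases "e \<in> parcs G")
    case True
    then show ?thesis using f[of "fst e" "snd e"] by simp
  next
    case False
    then have "(snd e, fst e) \<in> parcs G" using e(1) by (auto simp: arcs_S)
    from f[OF this] show ?thesis by (simp add: abs_minus_commute)
  qed
  then show ?case
    using Cons.IH[OF e(3)] e(2) by simp
qed

text \<open>\<open>real_of_ereal\<close> maps infinity to 0, so the walk \<open>p\<close> is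
  required to make the infimum finite.\<close>

lemma graph_dist_ge:
  fixes f :: "'a \<Rightarrow> real"
  assumes f: "\<And>u v. (u, v) \<in> parcs G \<Longrightarrow> \<bar>f v - f u\<bar> \<le> 1" and p: "S.awalk u p v"
  shows "f u - f v \<le> graph_dist G u v"
proof -
  have "ereal (f u - f v) \<le> S.\<mu> (\<lambda>_. 1) u v"
    unfolding S.\<mu>_def using awalk_lipschitz[OF f] by (intro INF_greatest) auto
  moreover have "S.\<mu> (\<lambda>_. 1) u v \<le> S.awalk_cost (\<lambda>_. 1) p"
    by (rule S.min_cost_le_walk_cost[OF p])
  ultimately show ?thesis
    unfolding graph_dist_eq by (cases "S.\<mu> (\<lambda>_. 1) u v") auto
qed

section \<open>Connectedness and the test measures on the graph\<close>

definition linked :: "'a \<Rightarrow> 'a \<Rightarrow> bool" where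
  "linked u v \<longleftrightarrow> (\<exists>p. S.awalk u p v)"

lemma linked_refl: "v \<in> pverts G \<Longrightarrow> linked v v"
  unfolding linked_def using S.awalk_Nil_iff[of v v] by auto

lemma linked_trans: "linked u v \<Longrightarrow> linked v w \<Longrightarrow> linked u w"
  unfolding linked_def using S.awalk_appendI by blast

lemma linked_arc: "(u, v) \<in> parcs G \<Longrightarrow> linked u v \<and> linked v u"
  unfolding linked_def using awalk_arc[of u v] awalk_arc[of v u] by (force simp: arcs_S)

end

context diamond_words
begin

lemma words_graph_sym_graph: "words_graph n G h \<Longrightarrow> sym_graph G"
  using ends_nodes by unfold_locales (auto simp: words_graph_def)

lemma words_graph_linked:
  assumes "words_graph n G h" "u \<in> pverts G" "v \<in> pverts G"
  shows "sym_graph.linked G u v"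
proof -
  interpret sym_graph G
    using assms(1) by (rule words_graph_sym_graph)
  have V: "pverts G = h ` nodes n" and arc: "w \<in> words n \<Longrightarrow> (h (lo w), h (hi w)) \<in> parcs G" for w
    using assms(1) by (auto simp: words_graph_def)
  have "h Src \<in> pverts G"
    using V Src_Snk_nodes by auto
  then have refl: "linked (h Src) (h Src)"
    by (rule linked_refl)
  have "nodes n \<subseteq> {x. linked (h Src) (h x)}"
  proof (rule nodes_induct)
    fix w assume "w \<in> words n"
    from linked_arc[OF arc[OF this]] show "lo w \<in> {x. linked (h Src) (h x)} \<longleftrightarrow> hi w \<in> {x. linked (h Src) (h x)}"
      unfolding mem_Collect_eq by (blast intro: linked_trans)
  qed (simp add: refl)
  moreover have "nodes n \<subseteq> {x. linked (h x) (h Src)}"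
  proof (rule nodes_induct)
    fix w assume "w \<in> words n"
    from linked_arc[OF arc[OF this]] show "lo w \<in> {x. linked (h x) (h Src)} \<longleftrightarrow> hi w \<in> {x. linked (h x) (h Src)}"
      unfolding mem_Collect_eq by (blast intro: linked_trans)
  qed (simp add: refl)
  ultimately show ?thesis
    using assms(2,3) unfolding V by (blast intro: linked_trans)
qed

lemma pairing_cong:
  assumes "\<And>x. x \<in> nodes n \<Longrightarrow> \<phi> x = \<psi> x" "j < n"
  shows "pairing \<phi> n j Z = pairing \<psi> n j Z"
proof -
  have "total \<phi> (n - 1 - j) ((0, b) # w) = total \<psi> (n - 1 - j) ((0, b) # w)" if "w \<in> words j" "b \<in> {1, 2}" for w b
    unfolding total_def esum_def
  proof (rule sum.cong[OF refl])
    fix u assume "u \<in> words (n - 1 - j)"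
    then have "u @ (0, b) # w \<in> words n"
      using that assms(2) k2 by (auto simp: words_def sym_def)
    then show "\<phi> (hi (u @ (0, b) # w)) = \<psi> (hi (u @ (0, b) # w))"
      by (intro assms(1) ends_nodes)
  qed
  then show ?thesis
    unfolding pairing_def gap_def by (intro sum.cong) auto
qed

text \<open>The signed measure whose integral is \<open>pairing\<close>. Its values are integers, so
  it can serve as a lattice direction; coefficients add up at a vertex where several edges
  end.\<close>

definition test_vec :: "(vert \<Rightarrow> 'a) \<Rightarrow> nat \<Rightarrow> nat \<Rightarrow> (nat \<times> nat) list set \<Rightarrow> 'a \<Rightarrow> int" where
  "test_vec h n j Z v = (\<Sum>w\<in>words j. \<Sum>u\<in>words (n - 1 - j). (if w \<in> Z then 1 else - 1) *
     ((if v = h (hi (u @ (0, 1) # w)) then 1 else 0) - (if v = h (hi (u @ (0, 2) # w)) then 1 else 0)))"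

lemma sum_test_vec:
  fixes \<phi> :: "'a \<Rightarrow> real"
  assumes "words_graph n G h" "j < n"
  shows "(\<Sum>v\<in>pverts G. real_of_int (test_vec h n j Z v) * \<phi> v) = pairing (\<phi> \<circ> h) n j Z"
    and "v \<notin> pverts G \<Longrightarrow> test_vec h n j Z v = 0"
proof -
  have V: "pverts G = h ` nodes n"
    using assms(1) by (simp add: words_graph_def)
  have fin: "finite (pverts G)"
    by (simp add: V)
  have mem: "h (hi (u @ (0, b) # w)) \<in> pverts G" if "w \<in> words j" "u \<in> words (n - 1 - j)" "b \<in> {1, 2}" for u w b
  proof -
    have "u @ (0, b) # w \<in> words n"
      using that assms(2) k2 by (auto simp: words_def sym_def)
    then show ?thesis
      unfolding V by (intro imageI ends_nodes)
  qed
  have "(\<Sum>v\<in>pverts G. real_of_int (test_vec h n j Z v) * \<phi> v)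
      = (\<Sum>w\<in>words j. \<Sum>u\<in>words (n - 1 - j). \<Sum>v\<in>pverts G. sgn_of Z w *
          ((if v = h (hi (u @ (0, 1) # w)) then \<phi> v else 0) - (if v = h (hi (u @ (0, 2) # w)) then \<phi> v else 0)))"
  proof -
    have "real_of_int (test_vec h n j Z v) * \<phi> v = (\<Sum>w\<in>words j. \<Sum>u\<in>words (n - 1 - j). sgn_of Z w *
          ((if v = h (hi (u @ (0, 1) # w)) then \<phi> v else 0) - (if v = h (hi (u @ (0, 2) # w)) then \<phi> v else 0)))" for v
      unfolding test_vec_def of_int_sum sum_distrib_right by (intro sum.cong) (auto simp: sgn_of_def)
    then show ?thesis
      by (simp only: sum.swap[of _ "words (n - 1 - j)" "pverts G"] sum.swap[of _ "words j" "pverts G"])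
  qed
  also have "\<dots> = (\<Sum>w\<in>words j. \<Sum>u\<in>words (n - 1 - j). sgn_of Z w *
      (\<phi> (h (hi (u @ (0, 1) # w))) - \<phi> (h (hi (u @ (0, 2) # w)))))"
    unfolding sum_distrib_left[symmetric] sum_subtractf using fin mem
    by (intro sum.cong refl arg_cong2[where f = "(*)"]) (simp add: sum_subtractf)
  also have "\<dots> = pairing (\<phi> \<circ> h) n j Z"
    by (simp add: pairing_def gap_def total_def esum_def sum_subtractf sum_distrib_left[symmetric])
  finally show "(\<Sum>v\<in>pverts G. real_of_int (test_vec h n j Z v) * \<phi> v) = pairing (\<phi> \<circ> h) n j Z" .
  show "test_vec h n j Z v = 0" if "v \<notin> pverts G"
    unfolding test_vec_def using that mem by (intro sum.neutral ballI) auto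
qed

text \<open>The witnesses give at least \<open>k^(2(n-1))\<close> on each of \<open>n\<close>
  levels, while the upper bound contains \<open>sqrt n\<close> times the number
  \<open>k^(2n)\<close> of edges. The ratio of these powers of \<open>k\<close> is the factor
  \<open>k^2\<close>.\<close>

lemma wasserstein_lower_bound:
  fixes G :: "'a pair_pre_digraph" and F :: "'a pmf \<Rightarrow> 'w \<Rightarrow> real"
  assumes h: "words_graph n G h" and "n \<ge> 1" "A \<ge> 0" "B > 0"
    and F: "\<And>p. p \<in> Wa1 (pverts G) \<Longrightarrow> integrable M (F p)"
      "\<And>p q. p \<in> Wa1 (pverts G) \<Longrightarrow> q \<in> Wa1 (pverts G) \<Longrightarrow>
        l1 M (\<lambda>\<omega>. F p \<omega> - F q \<omega>) \<le> A * W1_dist (graph_dist G) p q"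
      "\<And>p q. p \<in> Wa1 (pverts G) \<Longrightarrow> q \<in> Wa1 (pverts G) \<Longrightarrow>
        W1_dist (graph_dist G) p q \<le> B * l1 M (\<lambda>\<omega>. F p \<omega> - F q \<omega>)"
  shows "sqrt (real n) \<le> sqrt 2 * (1 + real k) * real k ^ 2 * (A * B)"
proof -
  interpret sym_graph G
    using h by (rule words_graph_sym_graph)
  define V where "V = pverts G"
  have V: "V = h ` nodes n" and inj: "inj_on h (nodes n)" and E: "parcs G = (\<lambda>w. (h (lo w), h (hi w))) ` words n"
    using h by (auto simp: words_graph_def V_def)
  have "finite V" by (simp add: V)
  have v0: "h Src \<in> V"
    using V Src_Snk_nodes by auto
  define I where "I = (SIGMA j:{..<n}. Pow (words j))"
  \<comment> \<open>The uniform weight over signs, with the normalisation of the level from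
    \<open>sum_pairing_le\<close>.\<close>
  define \<beta> where "\<beta> i = 1 / (real k ^ (n - 1 - fst i) * 2 ^ card (words (fst i)))" for i :: "nat \<times> (nat \<times> nat) list set"
  define a where "a i = test_vec h n (fst i) (snd i)" for i
  define wit where "wit i = witness (n - 1 - fst i) (fst i) (sgn_of (snd i))" for i
  define g where "g i v = wit i (inv_into (nodes n) h v)" for i v
  have gh: "g i (h x) = wit i x" if "x \<in> nodes n" for i x
    using that inj by (simp add: g_def)
  have linked: "\<exists>p. S.awalk x p y" if "x \<in> V" "y \<in> V" for x y
    using words_graph_linked[OF h] that by (auto simp: V_def linked_def)
  have "(\<Sum>i\<in>I. \<beta> i * (\<Sum>v\<in>V. g i v * real_of_int (a i v)))
      \<le> (sqrt (real n) * (sqrt 2 * (1 + real k))) * real (card (words n)) * (A * B)"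
  proof (rule wasserstein_obstruction[where d = "graph_dist G" and F = F and M = M
        and p = "\<lambda>w. h (hi w)" and q = "\<lambda>w. h (lo w)", OF \<open>finite V\<close> v0])
    show "finite I" by (simp add: I_def)
    show "0 \<le> graph_dist G x y" for x y by (rule graph_dist_nonneg)
    show "graph_dist G x x = 0" if "x \<in> V" for x
      using that by (auto simp: V_def graph_dist_self)
    show "a i v = 0" if "i \<in> I" "v \<notin> V" for i v
      using that sum_test_vec(2)[OF h] by (auto simp: a_def I_def V_def)
    show "\<beta> i \<ge> 0" if "i \<in> I" for i by (simp add: \<beta>_def)
    show "h (hi w) \<in> V \<and> h (lo w) \<in> V" if "w \<in> words n" for w
      using that ends_nodes by (auto simp: V)
    show "graph_dist G (h (hi w)) (h (lo w)) \<le> 1" if "w \<in> words n" for w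
      using that E by (intro graph_dist_arc) (force simp: arcs_S)
    show "(\<Sum>i\<in>I. \<beta> i * \<bar>\<Sum>v\<in>V. real_of_int (a i v) * \<phi> v\<bar>)
        \<le> sqrt (real n) * (sqrt 2 * (1 + real k)) * (\<Sum>w\<in>words n. \<bar>\<phi> (h (hi w)) - \<phi> (h (lo w))\<bar>)" for \<phi>
    proof -
      have "(\<Sum>i\<in>I. \<beta> i * \<bar>\<Sum>v\<in>V. real_of_int (a i v) * \<phi> v\<bar>)
          = (\<Sum>i\<in>I. \<bar>pairing (\<phi> \<circ> h) n (fst i) (snd i)\<bar> / (real k ^ (n - 1 - fst i) * 2 ^ card (words (fst i))))"
        by (intro sum.cong) (auto simp: I_def \<beta>_def a_def V_def sum_test_vec(1)[OF h])
      also have "\<dots> = (\<Sum>j<n. \<Sum>Z\<in>Pow (words j). \<bar>pairing (\<phi> \<circ> h) n j Z\<bar> / (real k ^ (n - 1 - j) * 2 ^ card (words j)))"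
        unfolding I_def by (subst sum.Sigma) (auto simp: split_beta)
      also have "\<dots> \<le> sqrt (real n) * (sqrt 2 * (1 + real k)) * variation (\<phi> \<circ> h) n []"
        by (rule sum_pairing_le)
      finally show ?thesis
        by (simp add: variation_def esum_def)
    qed
    show "g i x - g i y \<le> graph_dist G x y" if "i \<in> I" "x \<in> V" "y \<in> V" for i x y
    proof -
      obtain p where "S.awalk x p y" using linked \<open>x \<in> V\<close> \<open>y \<in> V\<close> by blast
      moreover have "\<bar>g i v - g i u\<bar> \<le> 1" if uv: "(u, v) \<in> parcs G" for u v
      proof -
        obtain w where w: "w \<in> words n" "u = h (lo w)" "v = h (hi w)"
          using uv E by auto
        then show ?thesis
          using \<open>i \<in> I\<close> witness_lipschitz[of "sgn_of (snd i)" "fst i" n w]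
          by (auto simp: gh ends_nodes wit_def I_def sgn_of_def)
      qed
      ultimately show ?thesis by (intro graph_dist_ge)
    qed
    show "g i (h Src) = 0" if "i \<in> I" for i
      by (simp add: gh Src_Snk_nodes wit_def witness_def)
  qed (use F assms V_def in auto)
  moreover have "(\<Sum>i\<in>I. \<beta> i * (\<Sum>v\<in>V. g i v * real_of_int (a i v))) \<ge> real n * (real k ^ (n - 1)) ^ 2"
  proof -
    \<comment> \<open>The value is spread evenly over the signs, to be compared term by term with
      \<open>pairing_witness\<close>.\<close>
    have "real n * (real k ^ (n - 1)) ^ 2 = (\<Sum>j<n. \<Sum>Z\<in>Pow (words j). (real k ^ (n - 1)) ^ 2 / 2 ^ card (words j))"
      by (simp add: card_Pow)
    also have "\<dots> \<le> (\<Sum>j<n. \<Sum>Z\<in>Pow (words j). \<beta> (j, Z) * pairing (wit (j, Z)) n j Z)"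
    proof (intro sum_mono)
      fix j Z assume "j \<in> {..<n}"
      then have "(real k ^ (n - 1)) ^ 2 / 2 ^ card (words j)
          \<le> (pairing (wit (j, Z)) n j Z / real k ^ (n - 1 - j)) / 2 ^ card (words j)"
        unfolding wit_def fst_conv snd_conv by (intro divide_right_mono pairing_witness) auto
      then show "(real k ^ (n - 1)) ^ 2 / 2 ^ card (words j) \<le> \<beta> (j, Z) * pairing (wit (j, Z)) n j Z"
        by (simp add: \<beta>_def)
    qed
    also have "\<dots> = (\<Sum>i\<in>I. \<beta> i * pairing (wit i) n (fst i) (snd i))"
      unfolding I_def by (subst sum.Sigma) (auto simp: split_beta)
    also have "\<dots> = (\<Sum>i\<in>I. \<beta> i * (\<Sum>v\<in>V. g i v * real_of_int (a i v)))"
    proof (intro sum.cong refl arg_cong2[where f = "(*)"])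
      fix i assume "i \<in> I"
      then have "fst i < n" by (auto simp: I_def)
      have "pairing (wit i) n (fst i) (snd i) = pairing (g i \<circ> h) n (fst i) (snd i)"
        using \<open>fst i < n\<close> by (intro pairing_cong) (auto simp: gh)
      also have "\<dots> = (\<Sum>v\<in>V. real_of_int (a i v) * g i v)"
        unfolding a_def V_def using sum_test_vec(1)[OF h \<open>fst i < n\<close>] by simp
      finally show "pairing (wit i) n (fst i) (snd i) = (\<Sum>v\<in>V. g i v * real_of_int (a i v))"
        by (simp add: mult.commute)
    qed
    finally show ?thesis .
  qed
  ultimately have "real n * (real k ^ (n - 1)) ^ 2
      \<le> (sqrt (real n) * (sqrt 2 * (1 + real k))) * real (card (words n)) * (A * B)"
    by linarith
  also have "real (card (words n)) = real k ^ 2 * (real k ^ (n - 1)) ^ 2"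
    using \<open>n \<ge> 1\<close> by (cases n) (auto simp: card_words power_mult_distrib)
  finally have *: "real n * (real k ^ (n - 1)) ^ 2
      \<le> (sqrt (real n) * (real k ^ (n - 1)) ^ 2) * (sqrt 2 * (1 + real k) * real k ^ 2 * (A * B))"
    by (simp add: mult_ac)
  have "(sqrt (real n) * (real k ^ (n - 1)) ^ 2) * sqrt (real n) = (sqrt (real n) * sqrt (real n)) * (real k ^ (n - 1)) ^ 2"
    by (simp only: mult_ac)
  also have "\<dots> = real n * (real k ^ (n - 1)) ^ 2"
    by simp
  finally have "(sqrt (real n) * (real k ^ (n - 1)) ^ 2) * sqrt (real n)
      \<le> (sqrt (real n) * (real k ^ (n - 1)) ^ 2) * (sqrt 2 * (1 + real k) * real k ^ 2 * (A * B))"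
    using * by (simp only:)
  moreover have "sqrt (real n) * (real k ^ (n - 1)) ^ 2 > 0"
    using \<open>n \<ge> 1\<close> k2 by simp
  ultimately show ?thesis
    by (simp only: mult_le_cancel_left_pos)
qed

end

section \<open>From distortion to families of integrable functions\<close>

definition L1_rep :: "(real \<Rightarrow> real) set \<Rightarrow> real \<Rightarrow> real" where
  "L1_rep A = (SOME f. f \<in> A)"

lemma L1_rep:
  assumes "A \<in> L1"
  shows "L1_rep A \<in> L1_funs" "A = L1_rel `` {L1_rep A}"
proof -
  obtain f where f: "f \<in> L1_funs" "A = L1_rel `` {f}"
    using assms by (auto simp: L1_def quotient_def)
  then have "f \<in> A"
    by (auto simp: L1_rel_def)
  then have "L1_rep A \<in> A"
    unfolding L1_rep_def by (rule someI[of "\<lambda>f. f \<in> A"])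
  then have rel: "(f, L1_rep A) \<in> L1_rel"
    using f by auto
  then show "L1_rep A \<in> L1_funs"
    by (auto simp: L1_rel_def)
  show "A = L1_rel `` {L1_rep A}"
    using equiv_class_eq[OF equiv_L1_rel rel] f by simp
qed

lemma L1_dist_eq: "L1_dist A B = l1 (lebesgue_on {0..1}) (\<lambda>\<omega>. L1_rep A \<omega> - L1_rep B \<omega>)"
  by (simp add: L1_dist_def l1_def L1_rep_def)

lemma L1_dist_pos:
  assumes "A \<in> L1" "B \<in> L1" "A \<noteq> B"
  shows "L1_dist A B > 0"
proof (rule ccontr)
  let ?f = "\<lambda>\<omega>. \<bar>L1_rep A \<omega> - L1_rep B \<omega>\<bar>"
  assume "\<not> L1_dist A B > 0"
  moreover have "(\<integral>\<omega>. ?f \<omega> \<partial>lebesgue_on {0..1}) \<ge> 0"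
    by simp
  ultimately have "(\<integral>\<omega>. ?f \<omega> \<partial>lebesgue_on {0..1}) = 0"
    unfolding L1_dist_eq l1_def by linarith
  moreover have "integrable (lebesgue_on {0..1}) ?f"
    using L1_rep(1)[OF assms(1)] L1_rep(1)[OF assms(2)] by (simp add: L1_funs_def)
  ultimately have "AE \<omega> in lebesgue_on {0..1}. ?f \<omega> = 0"
    by (subst (asm) integral_nonneg_eq_0_iff_AE) auto
  then have "(L1_rep A, L1_rep B) \<in> L1_rel"
    using L1_rep(1)[OF assms(1)] L1_rep(1)[OF assms(2)] by (simp add: L1_rel_def)
  then have "L1_rel `` {L1_rep A} = L1_rel `` {L1_rep B}"
    by (rule equiv_class_eq[OF equiv_L1_rel])
  then have "A = B"
    by (simp only: L1_rep(2)[OF assms(1), symmetric] L1_rep(2)[OF assms(2), symmetric])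
  with assms show False by simp
qed

lemma Lip_ge:
  assumes "x \<in> X" "y \<in> X" "x \<noteq> y"
  shows "ennreal (dY (f x) (f y) / dX x y) \<le> Lip X dX dY f"
  unfolding Lip_def using assms by (intro SUP_upper2[of "(x, y)"]) auto

text \<open>A quotient with denominator 0 is 0 and carries no information, so distances of distinct
  points must be known to be positive; \<open>W1_dist_pos\<close> and \<open>L1_dist_pos\<close>
  provide this.\<close>

lemma Lip_bound:
  assumes "Lip X dX dY f = ennreal A" "A \<ge> 0" "x \<in> X" "y \<in> X" "x \<noteq> y" "dX x y > 0"
  shows "dY (f x) (f y) \<le> A * dX x y"
proof -
  have "ennreal (dY (f x) (f y) / dX x y) \<le> ennreal A"
    using Lip_ge[of x X y dY f dX] assms by simp
  then show ?thesis
    using assms by (simp add: ennreal_le_iff divide_le_eq)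
qed

context diamond_words
begin

text \<open>Duality with plus or minus the indicator of a vertex where the measures differ; such a
  function changes by at most 1 across any edge.\<close>

lemma W1_dist_pos:
  assumes h: "words_graph n G h" and pq: "p \<in> Wa1 (pverts G)" "q \<in> Wa1 (pverts G)" "p \<noteq> q"
  shows "W1_dist (graph_dist G) p q > 0"
proof -
  interpret sym_graph G
    using h by (rule words_graph_sym_graph)
  have "finite (pverts G)"
    using h by (simp add: words_graph_def)
  obtain v where v: "pmf p v \<noteq> pmf q v"
    using pq(3) by (auto simp: pmf_eq_iff)
  then have "v \<in> set_pmf p \<or> v \<in> set_pmf q"
    by (auto simp: set_pmf_eq)
  then have "v \<in> pverts G"
    using pq(1,2) by (auto simp: Wa1_def)
  define c :: real where "c = (if pmf p v > pmf q v then 1 else - 1)"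
  define f where "f x = (if x = v then c else 0)" for x
  have "0 < c * (pmf p v - pmf q v)"
    using v by (simp add: c_def)
  also have "\<dots> = (\<Sum>x\<in>pverts G. if x = v then c * (pmf p v - pmf q v) else 0)"
    using \<open>v \<in> pverts G\<close> \<open>finite (pverts G)\<close> by simp
  also have "\<dots> = (\<Sum>x\<in>pverts G. f x * (pmf p x - pmf q x))"
    by (intro sum.cong) (auto simp: f_def)
  also have "\<dots> \<le> W1_dist (graph_dist G) p q"
  proof (rule W1_dist_ge[OF \<open>finite (pverts G)\<close> pq(1,2)])
    fix x y assume "x \<in> pverts G" "y \<in> pverts G"
    then obtain r where "S.awalk x r y"
      using words_graph_linked[OF h, of x y] by (auto simp: linked_def)
    moreover have "\<bar>f y - f x\<bar> \<le> 1" if "(x, y) \<in> parcs G" for x y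
      by (simp add: f_def c_def)
    ultimately show "f x - f y \<le> graph_dist G x y"
      by (intro graph_dist_ge)
  qed
  finally show ?thesis .
qed

text \<open>Transport of mass 0. \<open>Lip\<close> only sees pairs of distinct points, so the
  Lipschitz inequalities at equal points come from here.\<close>

lemma W1_dist_self:
  assumes h: "words_graph n G h" and p: "p \<in> Wa1 (pverts G)"
  shows "W1_dist (graph_dist G) p p = 0"
proof -
  interpret sym_graph G
    using h by (rule words_graph_sym_graph)
  have fin: "finite (pverts G)"
    using h by (simp add: words_graph_def)
  have "h Src \<in> pverts G"
    using h Src_Snk_nodes by (auto simp: words_graph_def)
  then have "W1_dist (graph_dist G) p p \<le> 0 * graph_dist G (h Src) (h Src)"
    using p by (intro W1_dist_move[where r = "pmf p", OF fin])
      (auto simp: graph_dist_nonneg graph_dist_self Wa1_def set_pmf_eq)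
  moreover have "(\<Sum>v\<in>pverts G. 0 * (pmf p v - pmf p v)) \<le> W1_dist (graph_dist G) p p"
    using fin p by (intro W1_dist_ge) (auto simp: graph_dist_nonneg)
  ultimately show ?thesis by simp
qed

lemma distortion_ge:
  assumes h: "words_graph n G h" and n: "n \<ge> 1"
  shows "ennreal (sqrt (real n) / (sqrt 2 * (1 + real k) * real k ^ 2))
    \<le> distortion (Wa1 (pverts G)) (W1_dist (graph_dist G)) L1 L1_dist"
  unfolding distortion_def
proof (rule INF_greatest, clarify)
  define X where "X = Wa1 (pverts G)"
  define W where "W = W1_dist (graph_dist G)"
  fix f assume "f \<in> Wa1 (pverts G) \<rightarrow> L1" "inj_on f (Wa1 (pverts G))"
  then have f: "\<And>p. p \<in> X \<Longrightarrow> f p \<in> L1" and inj: "inj_on f X"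
    by (auto simp: X_def)
  define f' where "f' = inv_into X f"
  have f': "f' (f p) = p" if "p \<in> X" for p
    using that inj by (simp add: f'_def)
  have Wpos: "W p q > 0" if "p \<in> X" "q \<in> X" "p \<noteq> q" for p q
    using W1_dist_pos[OF h] that by (simp add: X_def W_def)
  have Lpos: "L1_dist (f p) (f q) > 0" if "p \<in> X" "q \<in> X" "p \<noteq> q" for p q
    using that f inj by (intro L1_dist_pos) (auto dest: inj_onD)
  have self: "W p p = 0" "L1_dist (f p) (f p) = 0" if "p \<in> X" for p
    using W1_dist_self[OF h] that by (auto simp: X_def W_def L1_dist_eq l1_def)
  obtain p0 q0 where pq0: "p0 \<in> X" "q0 \<in> X" "p0 \<noteq> q0"
  proof
    have "h Src \<noteq> h Snk"
      using h Src_Snk_nodes by (auto simp: words_graph_def dest: inj_onD)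
    then show "return_pmf (h Src) \<noteq> return_pmf (h Snk)"
      by simp
    show "return_pmf (h Src) \<in> X" "return_pmf (h Snk) \<in> X"
      using h Src_Snk_nodes by (auto simp: X_def Wa1_def words_graph_def)
  qed
  \<comment> \<open>Positivity of both constants excludes the product of 0 and infinity, which is 0
    in \<open>ennreal\<close>. Two distinct point masses suffice.\<close>
  have pos1: "Lip X W L1_dist f > 0"
  proof (rule less_le_trans)
    show "0 < ennreal (L1_dist (f p0) (f q0) / W p0 q0)"
      using Wpos[OF pq0] Lpos[OF pq0] by simp
  qed (rule Lip_ge[OF pq0])
  have "f p0 \<noteq> f q0"
    using pq0 inj by (auto dest: inj_onD)
  have pos2: "Lip (f ` X) L1_dist W f' > 0"
  proof (rule less_le_trans)
    show "0 < ennreal (W (f' (f p0)) (f' (f q0)) / L1_dist (f p0) (f q0))"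
      using Wpos[OF pq0] Lpos[OF pq0] pq0 by (simp add: f')
  qed (rule Lip_ge[OF imageI[OF pq0(1)] imageI[OF pq0(2)] \<open>f p0 \<noteq> f q0\<close>])
  show "ennreal (sqrt (real n) / (sqrt 2 * (1 + real k) * real k ^ 2))
    \<le> Lip (Wa1 (pverts G)) (W1_dist (graph_dist G)) L1_dist f *
      Lip (f ` Wa1 (pverts G)) L1_dist (W1_dist (graph_dist G)) (inv_into (Wa1 (pverts G)) f)"
    unfolding X_def[symmetric] W_def[symmetric] f'_def[symmetric]
  proof (cases "Lip X W L1_dist f = \<infinity> \<or> Lip (f ` X) L1_dist W f' = \<infinity>")
    case True
    then show "ennreal (sqrt (real n) / (sqrt 2 * (1 + real k) * real k ^ 2))
        \<le> Lip X W L1_dist f * Lip (f ` X) L1_dist W f'"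
      using pos1 pos2 by (auto simp: ennreal_mult_top ennreal_top_mult)
  next
    case False
    define A B where "A = enn2real (Lip X W L1_dist f)" and "B = enn2real (Lip (f ` X) L1_dist W f')"
    have AB: "Lip X W L1_dist f = ennreal A" "Lip (f ` X) L1_dist W f' = ennreal B"
      using False by (auto simp: A_def B_def less_top)
    have "A > 0" "B > 0"
      using pos1 pos2 unfolding AB by auto
    have "sqrt (real n) \<le> sqrt 2 * (1 + real k) * real k ^ 2 * (A * B)"
    proof (rule wasserstein_lower_bound[OF h n less_imp_le[OF \<open>A > 0\<close>] \<open>B > 0\<close>,
          where F = "\<lambda>p. L1_rep (f p)" and M = "lebesgue_on {0..1}"])
      fix p assume "p \<in> Wa1 (pverts G)"
      then show "integrable (lebesgue_on {0..1}) (L1_rep (f p))"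
        using L1_rep(1)[OF f, of p] by (simp add: X_def L1_funs_def)
    next
      fix p q assume "p \<in> Wa1 (pverts G)" "q \<in> Wa1 (pverts G)"
      then have "p \<in> X" "q \<in> X" by (auto simp: X_def)
      then have "L1_dist (f p) (f q) \<le> A * W p q"
        using Lip_bound[OF AB(1), of p q] \<open>A > 0\<close> Wpos[of p q] self[of p] by (cases "p = q") auto
      then show "l1 (lebesgue_on {0..1}) (\<lambda>\<omega>. L1_rep (f p) \<omega> - L1_rep (f q) \<omega>) \<le> A * W1_dist (graph_dist G) p q"
        by (simp add: L1_dist_eq W_def)
    next
      fix p q assume "p \<in> Wa1 (pverts G)" "q \<in> Wa1 (pverts G)"
      then have "p \<in> X" "q \<in> X" by (auto simp: X_def)
      moreover have "f p \<noteq> f q" if "p \<noteq> q"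
        using that \<open>p \<in> X\<close> \<open>q \<in> X\<close> inj by (auto dest: inj_onD)
      ultimately have "W p q \<le> B * L1_dist (f p) (f q)"
        using Lip_bound[OF AB(2), of "f p" "f q"] \<open>B > 0\<close> Lpos[of p q] self[of p] by (cases "p = q") (auto simp: f')
      then show "W1_dist (graph_dist G) p q \<le> B * l1 (lebesgue_on {0..1}) (\<lambda>\<omega>. L1_rep (f p) \<omega> - L1_rep (f q) \<omega>)"
        by (simp add: L1_dist_eq W_def)
    qed
    then have "sqrt (real n) / (sqrt 2 * (1 + real k) * real k ^ 2) \<le> A * B"
      using k2 by (simp add: divide_le_eq mult_ac)
    then show "ennreal (sqrt (real n) / (sqrt 2 * (1 + real k) * real k ^ 2))
        \<le> Lip X W L1_dist f * Lip (f ` X) L1_dist W f'"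
      unfolding AB using \<open>A > 0\<close> \<open>B > 0\<close> by (simp add: ennreal_mult[symmetric] ennreal_leI)
  qed
qed

text \<open>Every vertex is an end of an edge, so there are at most \<open>2 * k^(2n)\<close> of
  them; the \<open>ln 2\<close> is absorbed because \<open>n\<close> is at least 1.\<close>

lemma sqrt_ln_card_le:
  assumes "words_graph n G h" "n \<ge> 1"
  shows "sqrt (ln (real (card (pverts G)))) \<le> sqrt (1 + 2 * ln (real k)) * sqrt (real n)"
proof -
  have card: "card (pverts G) = card (nodes n)"
    using assms(1) by (simp add: words_graph_def card_image)
  have "card (nodes n) > 0"
    using Src_Snk_nodes[of n] by (auto simp: card_gt_0_iff)
  moreover have "real (card (nodes n)) \<le> 2 * (real k ^ n) ^ 2"
    using of_nat_mono[OF card_nodes[of n], where 'a = real] by simp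
  ultimately have "ln (real (card (nodes n))) \<le> ln (2 * (real k ^ n) ^ 2)"
    by (intro ln_mono) auto
  also have "\<dots> = ln 2 + 2 * (real n * ln (real k))"
    using k2 by (simp add: ln_mult ln_realpow)
  also have "\<dots> \<le> real n + 2 * (real n * ln (real k))"
    using assms(2) ln_2_less_1 by simp
  also have "\<dots> = (1 + 2 * ln (real k)) * real n"
    by (simp add: algebra_simps)
  finally show ?thesis
    unfolding card real_sqrt_mult[symmetric] by (rule real_sqrt_le_mono)
qed

end

theorem theoremA:
  fixes k :: nat
  assumes "k \<ge> 2"
  shows "\<exists>c::real. c > 0 \<and> (\<forall>n\<ge>1.
    (let D = oslash_power (diamond k k) n in
      ennreal (c * sqrt (ln (real (card (vertices D)))))
        \<le> distortion (Wa1 (vertices D)) (W1_dist (graph_dist (digraph_of D))) L1 L1_dist))"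
proof -
  interpret diamond_words k
    using assms by unfold_locales
  \<comment> \<open>\<open>K\<close> is the constant of \<open>distortion_ge\<close>; the other
    factor of \<open>c\<close> converts \<open>sqrt n\<close> into the root of the
    logarithm.\<close>
  define K where "K = sqrt 2 * (1 + real k) * real k ^ 2"
  define c where "c = 1 / (K * sqrt (1 + 2 * ln (real k)))"
  have K: "K > 0" and l: "sqrt (1 + 2 * ln (real k)) > 0"
    using assms by (simp_all add: K_def add_pos_nonneg)
  have "ennreal (c * sqrt (ln (real (card (vertices (oslash_power D n))))))
      \<le> distortion (Wa1 (vertices (oslash_power D n))) (W1_dist (graph_dist (digraph_of (oslash_power D n)))) L1 L1_dist"
    if n: "n \<ge> 1" for n
  proof -
    obtain h where h: "words_graph n (digraph_of (oslash_power D n)) h"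
      using words_graph_power[of "n - 1"] n by auto
    have "c * sqrt (ln (real (card (vertices (oslash_power D n)))))
        \<le> c * (sqrt (1 + 2 * ln (real k)) * sqrt (real n))"
      using K l by (intro mult_left_mono sqrt_ln_card_le[OF h n]) (simp add: c_def)
    also have "\<dots> = sqrt (real n) / K"
      using l by (simp add: c_def)
    finally have "ennreal (c * sqrt (ln (real (card (vertices (oslash_power D n))))))
        \<le> ennreal (sqrt (real n) / K)"
      by (rule ennreal_leI)
    also have "\<dots> \<le> distortion (Wa1 (vertices (oslash_power D n))) (W1_dist (graph_dist (digraph_of (oslash_power D n)))) L1 L1_dist"
      unfolding K_def by (rule distortion_ge[OF h n])
    finally show ?thesis .
  qed
  moreover have "c > 0"
    using K l by (simp add: c_def)
  ultimately show ?thesis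
    unfolding Let_def by blast
qed

end
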